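(* Let $1<p<\infty$, let $q$ be its conjugate exponent, and let $[\alpha,\beta]$ be a closed and bounded interval of $\mathbb{R}$. Let $u \in \mathcal{L}^p([\alpha - r, \beta], \mathbb{C}^n)$ and $v \in \mathcal{L}^q([\alpha, \beta + r], (\mathbb{C}^n)')$ be given. If the restrictions $u|_{[\alpha, \beta]}$ and $v|_{[\alpha, \beta]}$ are absolutely continuous, then $$\int_\alpha^\beta \left\{\left[\frac{d}{dt}\left(v(t) + L^* \int_\alpha^t v^s\, ds\right)\right] u(t) + v(t) \left[\frac{d}{dt}\left(u(t) - L \int_\alpha^t u_s\, ds\right)\right]\right\} dt = \tilde{B}(v^\beta, u_\beta)-\tilde{B}(v^\alpha, u_\alpha)$$ holds.
   Context: Let $r>0$ and let $n$ be a positive integer. $\mathbb{C}^n$ denotes column vectors, $(\mathbb{C}^n)'$ denotes $n$-dimensional complex row vectors, $M_n(\mathbb{C})$ the $n\times n$ complex matrices. Let $\eta=(\eta_{ij})\colon [-r,0]\to M_n(\mathbb{C})$ be a function of bounded variation. Integrals against $d\eta$ are Riemann–Stieltjes integrals taken componentwise: for continuous $\phi$ (column valued) and $\psi$ (row valued), $\left(\int d\eta(\theta)\,\phi(\theta)\right)_i=\sum_j\int \phi_j(\theta)\,d\eta_{ij}(\theta)$ and $\left(\int \psi(\theta)\,d\eta(\theta)\right)_j=\sum_i\int \psi_i(\theta)\,d\eta_{ij}(\theta)$. Write $C=C([-r,0],\mathbb{C}^n)$ and $C^*=C([0,r],(\mathbb{C}^n)')$ (supremum norms). Define $L\colon C\to\mathbb{C}^n$,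 $L\phi=\int_{-r}^0 d\eta(\theta)\,\phi(\theta)$, and $L^*\colon C^*\to(\mathbb{C}^n)'$, $L^*\psi=\int_{-r}^0\psi(-\theta)\,d\eta(\theta)$. The bilinear form $B\colon C^*\times C\to\mathbb{C}$ is $$B(\psi,\phi)=\psi(0)\phi(0)+\int_{-r}^0\left(\int_{-r}^{\xi}\psi(\xi-\theta)\,d\eta(\theta)\right)\phi(\xi)\,d\xi ,$$ where the inner integral, as a function of $\xi\in[-r,0]$, is Riemann integrable. Let $m$ be the sum of the Lebesgue measure on $[-r,0]$ and the Dirac measure at $0$, and let $m^*$ be the sum of the Lebesgue measure on $[0,r]$ and the Dirac measure at $0$. Set $M^p=L^p(([-r,0],m),\mathbb{C}^n)$ and $M^{*q}=L^q(([0,r],m^* ),(\mathbb{C}^n)')$. $C$ and $C^*$ are regarded as dense subspaces of $M^p$ and $M^{*q}$. $\tilde B\colon M^{*q}\times M^p\to\mathbb{C}$ denotes the unique bounded bilinear form extending $B$ (which exists). $\mathcal{L}^p(I,\cdot)$ denotes $p$-integrable functions (not equivalence classes), defined almost everywhere on the interval $I$; here $u$ and $v$ are defined at every point of $[\alpha,\beta]$. For $t\in[\alpha,\beta]$, $u_t\in M^p$ and $v^t\in M^{*q}$ are given by $u_t(\theta)=u(t+\theta)$ for $m$-a.e. $\theta\in[-r,0]$ and $v^t(\tau)=v(t+\tau)$ for $m^*$-a.e. $\tau\in[0,r]$. For $[a,b]\subset[\alpha,\beta]$, $\int_a^b u_t\,dt\in C$ and $\int_a^b v^t\,dt\in C^*$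 are the continuous functions $\left(\int_a^b u_t\,dt\right)(\theta)=\int_a^b u(t+\theta)\,dt$ for $\theta\in[-r,0]$ and $\left(\int_a^b v^t\,dt\right)(\tau)=\int_a^b v(t+\tau)\,dt$ for $\tau\in[0,r]$. The derivatives in the integrand are understood almost everywhere on $[\alpha,\beta]$. *)

theory Defs
  imports "HOL-Analysis.Analysis"
begin

text \<open>
  Column vectors and row vectors of length \<open>n = CARD('n)\<close> are both represented by
  \<open>complex ^ 'n\<close>; the product of a row and a column is the library's \<^const>\<open>scalar_product\<close>
  (no conjugation). Functions on an interval are total functions on the reals of which only
  the values on that interval matter.
\<close>

section \<open>Bounded variation and absolute continuity\<close>

definition bounded_variation_on :: "(real \<Rightarrow> 'a::real_normed_vector) \<Rightarrow> real \<Rightarrow> real \<Rightarrow> bool" where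
  "bounded_variation_on f a b \<longleftrightarrow>
     (\<exists>M. \<forall>D. D division_of {a..b} \<longrightarrow> (\<Sum>K\<in>D. norm (f (Sup K) - f (Inf K))) \<le> M)"

text \<open>\<open>D division_of \<Union>D\<close> says that \<open>D\<close> is a finite family of non-overlapping compact intervals.\<close>

definition abs_continuous_on :: "(real \<Rightarrow> 'a::real_normed_vector) \<Rightarrow> real \<Rightarrow> real \<Rightarrow> bool" where
  "abs_continuous_on f a b \<longleftrightarrow>
     (\<forall>\<epsilon>>0. \<exists>\<delta>>0. \<forall>D. D division_of \<Union>D \<longrightarrow> \<Union>D \<subseteq> {a..b} \<longrightarrow>
        (\<Sum>K\<in>D. Sup K - Inf K) < \<delta> \<longrightarrow> (\<Sum>K\<in>D. norm (f (Sup K) - f (Inf K))) < \<epsilon>)"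

section \<open>Riemann--Stieltjes integrals\<close>

text \<open>The integral of \<open>f\<close> against \<open>dg\<close> over \<open>[a, b]\<close>, as limit of the Riemann--Stieltjes sums
  when the mesh tends to \<open>0\<close> (mesh, not a gauge). Degenerate intervals, which a tagged division
  may contain, contribute \<open>0\<close>.\<close>

definition has_rs_integral ::
  "(real \<Rightarrow> complex) \<Rightarrow> (real \<Rightarrow> complex) \<Rightarrow> complex \<Rightarrow> real \<Rightarrow> real \<Rightarrow> bool" where
  "has_rs_integral f g I a b \<longleftrightarrow>
     (\<forall>\<epsilon>>0. \<exists>\<delta>>0. \<forall>D. D tagged_division_of {a..b} \<longrightarrow> (\<forall>(x, K)\<in>D. Sup K - Inf K < \<delta>) \<longrightarrow>
        norm ((\<Sum>(x, K)\<in>D. f x * (g (Sup K) - g (Inf K))) - I) < \<epsilon>)"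

definition rs_integral :: "real \<Rightarrow> real \<Rightarrow> (real \<Rightarrow> complex) \<Rightarrow> (real \<Rightarrow> complex) \<Rightarrow> complex" where
  "rs_integral a b f g = (THE I. has_rs_integral f g I a b)"

definition rs_integral_col ::
  "real \<Rightarrow> real \<Rightarrow> (real \<Rightarrow> complex ^ 'n ^ 'n) \<Rightarrow> (real \<Rightarrow> complex ^ 'n) \<Rightarrow> complex ^ 'n" where
  "rs_integral_col a b \<eta> \<phi> =
     (\<chi> i. \<Sum>j\<in>UNIV. rs_integral a b (\<lambda>\<theta>. \<phi> \<theta> $ j) (\<lambda>\<theta>. \<eta> \<theta> $ i $ j))"

definition rs_integral_row ::
  "real \<Rightarrow> real \<Rightarrow> (real \<Rightarrow> complex ^ 'n) \<Rightarrow> (real \<Rightarrow> complex ^ 'n ^ 'n) \<Rightarrow> complex ^ 'n" where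
  "rs_integral_row a b \<psi> \<eta> =
     (\<chi> j. \<Sum>i\<in>UNIV. rs_integral a b (\<lambda>\<theta>. \<psi> \<theta> $ i) (\<lambda>\<theta>. \<eta> \<theta> $ i $ j))"

section \<open>The operators and the bilinear form on continuous functions\<close>

definition L_op :: "real \<Rightarrow> (real \<Rightarrow> complex ^ 'n ^ 'n) \<Rightarrow> (real \<Rightarrow> complex ^ 'n) \<Rightarrow> complex ^ 'n" where
  "L_op r \<eta> \<phi> = rs_integral_col (-r) 0 \<eta> \<phi>"

definition L_star :: "real \<Rightarrow> (real \<Rightarrow> complex ^ 'n ^ 'n) \<Rightarrow> (real \<Rightarrow> complex ^ 'n) \<Rightarrow> complex ^ 'n" where
  "L_star r \<eta> \<psi> = rs_integral_row (-r) 0 (\<lambda>\<theta>. \<psi> (-\<theta>)) \<eta>"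

definition B_form ::
  "real \<Rightarrow> (real \<Rightarrow> complex ^ 'n ^ 'n) \<Rightarrow> (real \<Rightarrow> complex ^ 'n) \<Rightarrow> (real \<Rightarrow> complex ^ 'n) \<Rightarrow> complex" where
  "B_form r \<eta> \<psi> \<phi> = scalar_product (\<psi> 0) (\<phi> 0) +
     integral {-r..0} (\<lambda>\<xi>. scalar_product (rs_integral_row (-r) \<xi> (\<lambda>\<theta>. \<psi> (\<xi> - \<theta>)) \<eta>) (\<phi> \<xi>))"

section \<open>The spaces \<open>M\<^sup>p\<close> and the extended bilinear form\<close>

text \<open>\<open>p\<close>-integrable functions (not classes), with the corresponding seminorm.\<close>

definition Lp :: "real \<Rightarrow> real measure \<Rightarrow> (real \<Rightarrow> 'a::euclidean_space) set" where
  "Lp p M = {f \<in> borel_measurable M. integrable M (\<lambda>x. norm (f x) powr p)}"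

definition Lp_seminorm :: "real \<Rightarrow> real measure \<Rightarrow> (real \<Rightarrow> 'a::euclidean_space) \<Rightarrow> real" where
  "Lp_seminorm p M f = (LINT x|M. norm (f x) powr p) powr (1 / p)"

text \<open>Lebesgue measure on \<open>S\<close> plus the Dirac measure at \<open>0\<close>.\<close>

definition leb_dirac :: "real set \<Rightarrow> real measure" where
  "leb_dirac S = measure_of S (sets (lebesgue_on S)) (\<lambda>A. emeasure (lebesgue_on S) A + indicator A 0)"

lemma space_leb_dirac [simp]: "space (leb_dirac S) = S"
  by (simp add: leb_dirac_def space_measure_of_conv)

lemma sets_leb_dirac [simp]: "sets (leb_dirac S) = sets (lebesgue_on S)"
proof -
  have "sets (lebesgue_on S) \<subseteq> Pow S"
    using sets.space_closed[of "lebesgue_on S"] by simp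
  then show ?thesis
    using sets.sigma_sets_eq[of "lebesgue_on S"] by (simp add: leb_dirac_def sets_measure_of_conv)
qed

lemma emeasure_leb_dirac:
  assumes "A \<in> sets (lebesgue_on S)"
  shows "emeasure (leb_dirac S) A = emeasure (lebesgue_on S) A + indicator A 0"
proof (rule emeasure_measure_of[OF leb_dirac_def])
  show "sets (lebesgue_on S) \<subseteq> Pow S"
    using sets.space_closed[of "lebesgue_on S"] by simp
  show "A \<in> sets (leb_dirac S)" using assms by simp
  show "positive (sets (leb_dirac S)) (\<lambda>A. emeasure (lebesgue_on S) A + indicator A 0)"
    by (simp add: positive_def)
  show "countably_additive (sets (leb_dirac S)) (\<lambda>A. emeasure (lebesgue_on S) A + indicator A 0)"
  proof (rule countably_additiveI)
    fix F :: "nat \<Rightarrow> real set"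
    assume F: "range F \<subseteq> sets (leb_dirac S)" "disjoint_family F"
    have "(\<Sum>i. emeasure (lebesgue_on S) (F i) + indicator (F i) 0) =
        (\<Sum>i. emeasure (lebesgue_on S) (F i)) + (\<Sum>i. indicator (F i) (0::real))"
      by (rule suminf_add[symmetric]) auto
    also have "(\<Sum>i. emeasure (lebesgue_on S) (F i)) = emeasure (lebesgue_on S) (\<Union>(range F))"
      using F by (intro suminf_emeasure) auto
    also have "(\<Sum>i. indicator (F i) (0::real)) = (indicator (\<Union>(range F)) 0 :: ennreal)"
      using F(2) by (rule suminf_indicator)
    finally show "(\<Sum>i. emeasure (lebesgue_on S) (F i) + indicator (F i) 0) =
        emeasure (lebesgue_on S) (\<Union>(range F)) + indicator (\<Union>(range F)) 0" .
  qed
qed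

abbreviation Mp :: "real \<Rightarrow> real \<Rightarrow> (real \<Rightarrow> complex ^ 'n) set" where
  "Mp p r \<equiv> Lp p (leb_dirac {-r..0})"

abbreviation Mq_star :: "real \<Rightarrow> real \<Rightarrow> (real \<Rightarrow> complex ^ 'n) set" where
  "Mq_star q r \<equiv> Lp q (leb_dirac {0..r})"

text \<open>
  \<open>F\<close> is a bounded (complex) bilinear form on the product of \<open>Mq_star\<close> and \<open>Mp\<close> that extends
  \<open>B_form\<close>. It is a form on functions rather than on classes, but boundedness with respect to the
  seminorms forces it to depend on the classes only. The value \<open>0\<close> outside the two spaces makes
  \<open>F\<close> unique as a total function.
\<close>

definition is_B_extension ::
  "real \<Rightarrow> real \<Rightarrow> real \<Rightarrow> (real \<Rightarrow> complex ^ 'n ^ 'n) \<Rightarrow>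
   ((real \<Rightarrow> complex ^ 'n) \<Rightarrow> (real \<Rightarrow> complex ^ 'n) \<Rightarrow> complex) \<Rightarrow> bool" where
  "is_B_extension p q r \<eta> F \<longleftrightarrow>
     (\<forall>\<psi>1\<in>Mq_star q r. \<forall>\<psi>2\<in>Mq_star q r. \<forall>\<phi>\<in>Mp p r. F (\<lambda>x. \<psi>1 x + \<psi>2 x) \<phi> = F \<psi>1 \<phi> + F \<psi>2 \<phi>) \<and>
     (\<forall>c. \<forall>\<psi>\<in>Mq_star q r. \<forall>\<phi>\<in>Mp p r. F (\<lambda>x. c *s \<psi> x) \<phi> = c * F \<psi> \<phi>) \<and>
     (\<forall>\<psi>\<in>Mq_star q r. \<forall>\<phi>1\<in>Mp p r. \<forall>\<phi>2\<in>Mp p r. F \<psi> (\<lambda>x. \<phi>1 x + \<phi>2 x) = F \<psi> \<phi>1 + F \<psi> \<phi>2) \<and>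
     (\<forall>c. \<forall>\<psi>\<in>Mq_star q r. \<forall>\<phi>\<in>Mp p r. F \<psi> (\<lambda>x. c *s \<phi> x) = c * F \<psi> \<phi>) \<and>
     (\<exists>K. \<forall>\<psi>\<in>Mq_star q r. \<forall>\<phi>\<in>Mp p r. norm (F \<psi> \<phi>) \<le>
        K * Lp_seminorm q (leb_dirac {0..r}) \<psi> * Lp_seminorm p (leb_dirac {-r..0}) \<phi>) \<and>
     (\<forall>\<psi> \<phi>. continuous_on {0..r} \<psi> \<longrightarrow> continuous_on {-r..0} \<phi> \<longrightarrow> F \<psi> \<phi> = B_form r \<eta> \<psi> \<phi>) \<and>
     (\<forall>\<psi> \<phi>. \<psi> \<notin> Mq_star q r \<or> \<phi> \<notin> Mp p r \<longrightarrow> F \<psi> \<phi> = 0)"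

definition B_tilde ::
  "real \<Rightarrow> real \<Rightarrow> real \<Rightarrow> (real \<Rightarrow> complex ^ 'n ^ 'n) \<Rightarrow>
   (real \<Rightarrow> complex ^ 'n) \<Rightarrow> (real \<Rightarrow> complex ^ 'n) \<Rightarrow> complex" where
  "B_tilde p q r \<eta> = (THE F. is_B_extension p q r \<eta> F)"

section \<open>Translates\<close>

text \<open>Both the history \<open>u\<^sub>t\<close> (used on \<open>[-r, 0]\<close>) and the forward segment \<open>v\<^sup>t\<close> (used on
  \<open>[0, r]\<close>) are the translate by \<open>t\<close>.\<close>

definition translate :: "(real \<Rightarrow> 'a) \<Rightarrow> real \<Rightarrow> real \<Rightarrow> 'a" where
  "translate w t = (\<lambda>\<theta>. w (t + \<theta>))"

definition integral_translate :: "real \<Rightarrow> real \<Rightarrow> (real \<Rightarrow> 'a::euclidean_space) \<Rightarrow> real \<Rightarrow> 'a" where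
  "integral_translate a b w = (\<lambda>\<theta>. LINT t:{a..b}|lebesgue. w (t + \<theta>))"

end

theory Submission
  imports Defs
begin

text \<open>
  The identity is a product rule for \<open>t \<mapsto> B(v\<^sup>t, u\<^sub>t)\<close>, and the difficulty is that \<open>u\<close> and \<open>v\<close> are
  merely integrable on the outer intervals while \<open>\<eta>\<close> may jump, so that differentiation under the
  integral sign is not available in general. The way out is to exchange the two integrals in \<open>B\<close>
  (\<open>rs_integral_Fubini\<close>): with \<open>corr w h \<theta> = \<integral> w (s - \<theta>) h s ds\<close>,
  \<open>B(\<psi>, \<phi>) = \<psi>(0) \<phi>(0) + \<Sum>\<^sub>i\<^sub>j \<integral> corr \<psi>\<^sub>i \<phi>\<^sub>j d\<eta>\<^sub>i\<^sub>j\<close> over \<open>[-r, 0]\<close>,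
  where \<open>\<psi>\<close> and \<open>\<phi>\<close> are extended by zero. By Hoelder's inequality the cross-correlation is bounded
  by the product of the norms, and it is a continuous function of \<open>\<theta>\<close> for all \<open>q\<close>- and
  \<open>p\<close>-integrable arguments, as a uniform limit of the correlations of continuous ones. Hence the
  right-hand side makes sense on the whole of \<open>M\<^sup>*\<^sup>q \<times> M\<^sup>p\<close>, and by density of the continuous functions
  it is the extended form (\<open>B_tilde_eq\<close>).

  Write \<open>\<langle>w, h\<rangle>\<close> for the sum over \<open>i, j\<close> of the integrals of \<open>corr w\<^sub>i h\<^sub>j\<close> against \<open>d\<eta>\<^sub>i\<^sub>j\<close>.
  Substituting \<open>s = t + \<xi>\<close> and decomposing intervals gives, with \<open>1\<close> the indicator function
  of \<open>(\<alpha>, \<beta>]\<close>,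
  \<open>\<langle>v\<^sup>\<beta>, u\<^sub>\<beta>\<rangle> - \<langle>v\<^sup>\<alpha>, u\<^sub>\<alpha>\<rangle> = \<langle>v, 1 u\<rangle> - \<langle>1 v, u\<rangle>\<close>
  (\<open>corr_increment\<close>). On the other side, \<open>L\<^sup>* \<integral> v\<^sup>s ds\<close> and \<open>L \<integral> u\<^sub>s ds\<close> have as components sums of
  functions \<open>F t = \<Psi> (1\<^bsub>(\<alpha>, t]\<^esub>)\<close> with \<open>\<Psi>\<close> a bounded functional, the part of \<open>\<langle>v, \<cdot>\<rangle>\<close> or
  of \<open>\<langle>\<cdot>, u\<rangle>\<close> that belongs to one entry of \<open>\<eta>\<close>, on \<open>p\<close>- or on \<open>q\<close>-integrable functions. Such an \<open>F\<close> is absolutely continuous, and Stieltjes sums of a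
  continuous \<open>h\<close> against it are values of \<open>\<Psi>\<close> on step functions, which converge to \<open>\<Psi> (1 h)\<close>
  (\<open>Lp_functional\<close>). Therefore \<open>U\<close> and \<open>V\<close> are absolutely continuous, and the integral of
  \<open>V' u + v U'\<close> is the limit of Stieltjes sums of \<open>u\<close> against \<open>dV\<close>, with left tags, plus those of \<open>v\<close>
  against \<open>dU\<close>, with right tags. In them the sums against \<open>dv\<close> and \<open>du\<close> together telescope
  to the increment of \<open>v u\<close>, and the rest tends to \<open>\<langle>v, 1 u\<rangle> - \<langle>1 v, u\<rangle>\<close>.

  That absolutely continuous functions are indefinite integrals of their derivatives is proved from
  the Radon--Nikodym theorem, applied to the Stieltjes measures of the total variation \<open>T\<close> of \<open>f\<close>
  and of \<open>T - f\<close>. Riemann--Stieltjes integrals are handled throughout as limits of sums over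
  equidistant partitions; \<open>partial_rs_sum_tendsto\<close> relates these to the mesh definition.
\<close>

section \<open>Bounded variation, absolute continuity and monotone majorants\<close>

text \<open>All estimates use bounded variation only through a real function whose increments dominate those
of \<open>g\<close>; its sums telescope. The same majorant serves every entry of a matrix-valued function.\<close>

definition variation_majorant ::
  "(real \<Rightarrow> real) \<Rightarrow> (real \<Rightarrow> 'a::real_normed_vector) \<Rightarrow> real \<Rightarrow> real \<Rightarrow> bool" where
  "variation_majorant T g a b \<longleftrightarrow>
     (\<forall>x y. a \<le> x \<longrightarrow> x \<le> y \<longrightarrow> y \<le> b \<longrightarrow> norm (g y - g x) \<le> T y - T x)"

lemma variation_majorantD:
  "variation_majorant T g a b \<Longrightarrow> a \<le> x \<Longrightarrow> x \<le> y \<Longrightarrow> y \<le> b \<Longrightarrow> norm (g y - g x) \<le> T y - T x"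
  unfolding variation_majorant_def by blast

lemma variation_majorant_mono:
  "variation_majorant T g a b \<Longrightarrow> a \<le> x \<Longrightarrow> x \<le> y \<Longrightarrow> y \<le> b \<Longrightarrow> T x \<le> T y"
  using variation_majorantD[of T g a b x y] norm_ge_zero[of "g y - g x"] by linarith

definition chain_variation :: "(real \<Rightarrow> 'a::real_normed_vector) \<Rightarrow> (nat \<Rightarrow> real) \<Rightarrow> nat \<Rightarrow> real" where
  "chain_variation f t N = (\<Sum>k<N. norm (f (t (Suc k)) - f (t k)))"

lemma mono_min_const: "mono t \<Longrightarrow> mono (\<lambda>k::nat. min (t k) (x::real))"
  by (intro monoI min.mono) (auto dest: monoD)

lemma mono_max_const: "mono t \<Longrightarrow> mono (\<lambda>k::nat. max (t k) (x::real))"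
  by (intro monoI max.mono) (auto dest: monoD)

definition chain_cells :: "(nat \<Rightarrow> real) \<Rightarrow> nat \<Rightarrow> real set set" where
  "chain_cells t N = (\<lambda>k. {t k..t (Suc k)}) ` {k. k < N \<and> t k < t (Suc k)}"

text \<open>Links of length zero contribute no cell, since distinct indices could otherwise have the same cell
and a sum over the set of cells would lose terms.\<close>

lemma chain_cells_sum:
  fixes h :: "real \<Rightarrow> real \<Rightarrow> real"
  assumes t: "mono t" and h: "\<And>x. h x x = 0"
  shows "(\<Sum>K\<in>chain_cells t N. h (Inf K) (Sup K)) = (\<Sum>k<N. h (t k) (t (Suc k)))"
proof -
  let ?I = "{k. k < N \<and> t k < t (Suc k)}"
  have inj: "inj_on (\<lambda>k. {t k..t (Suc k)}) ?I"
  proof (rule inj_onI)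
    fix j k assume "j \<in> ?I" "k \<in> ?I" and eq: "{t j..t (Suc j)} = {t k..t (Suc k)}"
    then have *: "t j < t (Suc j)" "t k < t (Suc k)" by auto
    with eq have "t j = t k" "t (Suc j) = t (Suc k)" by (auto simp: Icc_eq_Icc)
    then show "j = k"
      using * monoD[OF t, of "Suc j" k] monoD[OF t, of "Suc k" j] by (metis leD not_less_eq_eq nat_less_le linorder_neqE_nat Suc_leI)
  qed
  have "(\<Sum>K\<in>chain_cells t N. h (Inf K) (Sup K)) = (\<Sum>k\<in>?I. h (Inf {t k..t (Suc k)}) (Sup {t k..t (Suc k)}))"
    unfolding chain_cells_def by (subst sum.reindex[OF inj]) simp
  also have "\<dots> = (\<Sum>k\<in>?I. h (t k) (t (Suc k)))"
    by (intro sum.cong) auto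
  also have "\<dots> = (\<Sum>k<N. h (t k) (t (Suc k)))"
  proof (rule sum.mono_neutral_left)
    show "\<forall>k\<in>{..<N} - ?I. h (t k) (t (Suc k)) = 0"
    proof
      fix k assume "k \<in> {..<N} - ?I"
      then have "t k = t (Suc k)" using monoD[OF t, of k "Suc k"] by auto
      then show "h (t k) (t (Suc k)) = 0" using h by simp
    qed
  qed auto
  finally show ?thesis .
qed

lemma chain_cells_division:
  assumes t: "mono t"
  shows "chain_cells t N division_of \<Union>(chain_cells t N)"
proof (rule division_ofI)
  show "finite (chain_cells t N)" by (simp add: chain_cells_def)
  fix K assume K: "K \<in> chain_cells t N"
  then show "K \<subseteq> \<Union>(chain_cells t N)" by auto
  show "K \<noteq> {}" using K by (auto simp: chain_cells_def)
  show "\<exists>a b. K = cbox a b" using K by (auto simp: chain_cells_def)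
next
  have disj: "{t j<..<t (Suc j)} \<inter> {t k<..<t (Suc k)} = {}" if "j < k" for j k
    using monoD[OF t, of "Suc j" k] that by auto
  fix K1 K2 assume "K1 \<in> chain_cells t N" "K2 \<in> chain_cells t N" "K1 \<noteq> K2"
  then obtain j k where jk: "K1 = {t j..t (Suc j)}" "K2 = {t k..t (Suc k)}" "j \<noteq> k"
    by (auto simp: chain_cells_def)
  then show "interior K1 \<inter> interior K2 = {}"
    using disj[of j k] disj[of k j] by (auto simp: linorder_neq_iff interior_atLeastAtMost_real)
qed simp

lemma chain_cells_subset:
  assumes "range t \<subseteq> {a..b}" shows "\<Union>(chain_cells t N) \<subseteq> {a..b}"
proof -
  have "a \<le> t k" "t k \<le> b" for k using assms by (auto simp: image_subset_iff)
  then have "{t k..t (Suc k)} \<subseteq> {a..b}" for k by simp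
  then show ?thesis unfolding chain_cells_def by blast
qed

lemma chain_cells_cover:
  assumes t: "mono t" and "t 0 < t N"
  shows "\<Union>(chain_cells t N) = {t 0..t N}"
proof
  show "\<Union>(chain_cells t N) \<subseteq> {t 0..t N}"
  proof (clarsimp simp: chain_cells_def)
    fix x k assume "t k \<le> x" "x \<le> t (Suc k)" "k < N"
    then show "t 0 \<le> x \<and> x \<le> t N"
      using monoD[OF t, of 0 k] monoD[OF t, of "Suc k" N] by auto
  qed
  have "t 0 < t n \<Longrightarrow> {t 0..t n} \<subseteq> \<Union>(chain_cells t n)" for n
  proof (induction n)
    case (Suc n)
    have sub: "\<Union>(chain_cells t n) \<subseteq> \<Union>(chain_cells t (Suc n))"
      by (auto simp: chain_cells_def intro: less_SucI)
    show ?case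
    proof (cases "t n < t (Suc n)")
      case True
      then have last: "{t n..t (Suc n)} \<subseteq> \<Union>(chain_cells t (Suc n))"
        by (auto simp: chain_cells_def)
      show ?thesis
      proof (cases "t 0 < t n")
        case True
        have "{t 0..t (Suc n)} \<subseteq> {t 0..t n} \<union> {t n..t (Suc n)}" by auto
        with Suc.IH[OF True] last sub show ?thesis by blast
      next
        case False
        then have "t 0 = t n" using monoD[OF t, of 0 n] by simp
        then show ?thesis using last by simp
      qed
    next
      case False
      then have "t n = t (Suc n)" using monoD[OF t, of n "Suc n"] by simp
      then show ?thesis using Suc.IH Suc.prems sub by auto
    qed
  qed simp
  then show "{t 0..t N} \<subseteq> \<Union>(chain_cells t N)" using assms by simp
qed

text \<open>Chains may have repeated points and need not reach the end points of the interval, so that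
truncating a chain by \<^const>\<open>min\<close> or \<^const>\<open>max\<close> yields a chain again. This makes splitting the variation
at a point easier than with divisions into intervals.\<close>

definition chain_variations :: "(real \<Rightarrow> 'a::real_normed_vector) \<Rightarrow> real \<Rightarrow> real \<Rightarrow> real set" where
  "chain_variations f c d = {chain_variation f t N |t N. mono t \<and> range t \<subseteq> {c..d}}"

definition total_variation :: "(real \<Rightarrow> 'a::real_normed_vector) \<Rightarrow> real \<Rightarrow> real \<Rightarrow> real" where
  "total_variation f c d = Sup (chain_variations f c d)"

lemma chain_variations_nonempty:
  assumes "c \<le> d" shows "chain_variations f c d \<noteq> {}"
proof -
  have "chain_variation f (\<lambda>_. c) 0 \<in> chain_variations f c d"
    using assms unfolding chain_variations_def by (auto intro!: exI[of _ "\<lambda>_. c"] exI[of _ 0] simp: mono_def)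
  then show ?thesis by blast
qed

lemma chain_variations_bdd_subset:
  assumes "bdd_above (chain_variations f a b)" "a \<le> c" "d \<le> b"
  shows "bdd_above (chain_variations f c d)"
  by (rule bdd_above_mono[OF assms(1)]) (use assms(2,3) in \<open>force simp: chain_variations_def\<close>)

text \<open>A chain in \<open>[a, c]\<close> is prolonged by the two points \<open>c\<close> and \<open>d\<close>.\<close>

lemma total_variation_append:
  assumes bdd: "bdd_above (chain_variations f a b)" and "a \<le> c" "c \<le> d" "d \<le> b"
  shows "total_variation f a c + norm (f d - f c) \<le> total_variation f a d"
proof -
  have "s \<le> total_variation f a d - norm (f d - f c)" if "s \<in> chain_variations f a c" for s
  proof -
    obtain t N where t: "mono t" "range t \<subseteq> {a..c}" and s: "s = chain_variation f t N"
      using \<open>s \<in> _\<close> by (auto simp: chain_variations_def)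
    define t' where "t' k = (if k \<le> N then t k else if k = Suc N then c else d)" for k
    have tr: "a \<le> t k" "t k \<le> c" for k using t(2) by (auto simp: image_subset_iff)
    have "mono t'"
    proof (rule monoI)
      fix j k :: nat assume "j \<le> k"
      then show "t' j \<le> t' k"
        using monoD[OF t(1), of j k] tr[of j] \<open>c \<le> d\<close> by (auto simp: t'_def)
    qed
    moreover have "range t' \<subseteq> {a..d}"
      using tr assms by (auto simp: t'_def intro: order_trans[OF tr(2)])
    ultimately have "chain_variation f t' (Suc (Suc N)) \<in> chain_variations f a d"
      unfolding chain_variations_def by blast
    then have "chain_variation f t' (Suc (Suc N)) \<le> total_variation f a d"
      unfolding total_variation_def
      by (intro cSup_upper chain_variations_bdd_subset[OF bdd]) (use assms in auto)
    moreover have "chain_variation f t' (Suc (Suc N)) = s + norm (f c - f (t N)) + norm (f d - f c)"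
      unfolding s chain_variation_def by (simp add: t'_def)
    ultimately show ?thesis using norm_ge_zero[of "f c - f (t N)"] by linarith
  qed
  then have "total_variation f a c \<le> total_variation f a d - norm (f d - f c)"
    unfolding total_variation_def
    by (intro cSup_least chain_variations_nonempty) (use assms in auto)
  then show ?thesis by simp
qed

text \<open>Only the link that straddles \<open>x\<close> is affected by the truncations, and there the triangle inequality
at \<open>x\<close> applies.\<close>

lemma chain_variation_split:
  assumes t: "mono t"
  shows "chain_variation f t N \<le> chain_variation f (\<lambda>k. min (t k) x) N + chain_variation f (\<lambda>k. max (t k) x) N"
  unfolding chain_variation_def sum.distrib[symmetric]
proof (rule sum_mono)
  fix k
  have "t k \<le> t (Suc k)" using t by (simp add: monoD)
  moreover have "norm (f (t (Suc k)) - f (t k)) \<le> norm (f x - f (t k)) + norm (f (t (Suc k)) - f x)"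
    using norm_triangle_ineq[of "f x - f (t k)" "f (t (Suc k)) - f x"] by (simp add: algebra_simps)
  ultimately show "norm (f (t (Suc k)) - f (t k)) \<le>
     norm (f (min (t (Suc k)) x) - f (min (t k) x)) + norm (f (max (t (Suc k)) x) - f (max (t k) x))"
    by (cases "t (Suc k) \<le> x"; cases "x \<le> t k") (auto simp: min_def max_def)
qed

lemma total_variation_split:
  assumes bdd: "bdd_above (chain_variations f a b)" and "a \<le> c" "c \<le> d" "d \<le> b"
  shows "total_variation f a d \<le> total_variation f a c + total_variation f c d"
  unfolding total_variation_def[of f a d]
proof (rule cSup_least)
  show "chain_variations f a d \<noteq> {}" using assms by (intro chain_variations_nonempty) auto
  fix s assume "s \<in> chain_variations f a d"
  then obtain t N where t: "mono t" "range t \<subseteq> {a..d}" and s: "s = chain_variation f t N"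
    by (auto simp: chain_variations_def)
  have tr: "a \<le> t k" "t k \<le> d" for k using t(2) by (auto simp: image_subset_iff)
  have "chain_variation f (\<lambda>k. min (t k) c) N \<in> chain_variations f a c"
    using mono_min_const[OF t(1)] tr assms unfolding chain_variations_def
    by (intro CollectI exI[of _ "\<lambda>k. min (t k) c"] exI[of _ N]) (auto simp: min_le_iff_disj)
  then have 1: "chain_variation f (\<lambda>k. min (t k) c) N \<le> total_variation f a c"
    unfolding total_variation_def
    by (intro cSup_upper chain_variations_bdd_subset[OF bdd]) (use assms in auto)
  have "chain_variation f (\<lambda>k. max (t k) c) N \<in> chain_variations f c d"
    using mono_max_const[OF t(1)] tr assms unfolding chain_variations_def
    by (intro CollectI exI[of _ "\<lambda>k. max (t k) c"] exI[of _ N]) (auto simp: le_max_iff_disj)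
  then have 2: "chain_variation f (\<lambda>k. max (t k) c) N \<le> total_variation f c d"
    unfolding total_variation_def
    by (intro cSup_upper chain_variations_bdd_subset[OF bdd]) (use assms in auto)
  show "s \<le> total_variation f a c + total_variation f c d"
    using chain_variation_split[OF t(1), of f N c] 1 2 s by linarith
qed

lemma total_variation_majorant:
  assumes "bdd_above (chain_variations f a b)"
  shows "variation_majorant (total_variation f a) f a b"
  unfolding variation_majorant_def
proof (intro allI impI)
  fix x y assume "a \<le> x" "x \<le> y" "y \<le> b"
  then show "norm (f y - f x) \<le> total_variation f a y - total_variation f a x"
    using total_variation_append[OF assms, of x y] by linarith
qed

text \<open>The total variation on \<open>[a, x]\<close>, as a function of \<open>x\<close>, is a majorant as soon as it is finite. A chain
becomes a division of \<open>[a, b]\<close> by adjoining the end points, which can only increase its sum.\<close>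

lemma bounded_variation_on_imp_majorant:
  assumes "bounded_variation_on f a b"
  shows "\<exists>T. variation_majorant T f a b"
proof (cases "a < b")
  case True
  obtain M where M: "\<And>D. D division_of {a..b} \<Longrightarrow> (\<Sum>K\<in>D. norm (f (Sup K) - f (Inf K))) \<le> M"
    using assms unfolding bounded_variation_on_def by blast
  have "bdd_above (chain_variations f a b)"
  proof (rule bdd_aboveI)
    fix s assume "s \<in> chain_variations f a b"
    then obtain t N where t: "mono t" "range t \<subseteq> {a..b}" and s: "s = chain_variation f t N"
      by (auto simp: chain_variations_def)
    have tr: "a \<le> t k" "t k \<le> b" for k using t(2) by (auto simp: image_subset_iff)
    define t' where "t' k = (case k of 0 \<Rightarrow> a | Suc j \<Rightarrow> if j \<le> N then t j else b)" for k
    have m: "mono t'"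
      unfolding mono_iff_le_Suc using monoD[OF t(1)] tr
      by (auto simp: t'_def split: nat.split)
    have e: "t' 0 = a" "t' (Suc (Suc N)) = b" by (auto simp: t'_def)
    have div: "chain_cells t' (Suc (Suc N)) division_of {a..b}"
      using chain_cells_division[OF m, of "Suc (Suc N)"] chain_cells_cover[OF m, of "Suc (Suc N)"] True
      by (simp add: e)
    have "s = (\<Sum>k<N. norm (f (t' (Suc (Suc k))) - f (t' (Suc k))))"
      unfolding s chain_variation_def by (intro sum.cong) (auto simp: t'_def)
    also have "\<dots> \<le> (\<Sum>k<Suc N. norm (f (t' (Suc (Suc k))) - f (t' (Suc k))))"
      by simp
    also have "\<dots> \<le> (\<Sum>k<Suc (Suc N). norm (f (t' (Suc k)) - f (t' k)))"
      by (subst (2) sum.lessThan_Suc_shift) simp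
    also have "\<dots> = (\<Sum>K\<in>chain_cells t' (Suc (Suc N)). norm (f (Sup K) - f (Inf K)))"
      using chain_cells_sum[OF m, of "\<lambda>x y. norm (f y - f x)" "Suc (Suc N)"] by simp
    also have "\<dots> \<le> M" by (rule M[OF div])
    finally show "s \<le> M" .
  qed
  then show ?thesis using total_variation_majorant by blast
next
  case False
  then have "variation_majorant (\<lambda>_. 0) f a b"
    by (auto simp: variation_majorant_def dest: order_antisym)
  then show ?thesis by blast
qed

lemma abs_continuous_on_chain:
  assumes "abs_continuous_on f a b" "\<epsilon> > 0"
  obtains \<delta> where "\<delta> > 0"
    "\<And>(t::nat \<Rightarrow> real) N. mono t \<Longrightarrow> range t \<subseteq> {a..b} \<Longrightarrow> t N - t 0 < \<delta> \<Longrightarrow> chain_variation f t N < \<epsilon>"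
proof -
  obtain \<delta> where \<delta>: "\<delta> > 0" "\<And>D. D division_of \<Union>D \<Longrightarrow> \<Union>D \<subseteq> {a..b} \<Longrightarrow>
        (\<Sum>K\<in>D. Sup K - Inf K) < \<delta> \<Longrightarrow> (\<Sum>K\<in>D. norm (f (Sup K) - f (Inf K))) < \<epsilon>"
    using assms unfolding abs_continuous_on_def by blast
  show ?thesis
  proof (rule that[OF \<delta>(1)])
    fix t :: "nat \<Rightarrow> real" and N assume t: "mono t" "range t \<subseteq> {a..b}" "t N - t 0 < \<delta>"
    have sub: "\<Union>(chain_cells t N) \<subseteq> {a..b}"
      by (rule chain_cells_subset[OF t(2)])
    have "(\<Sum>K\<in>chain_cells t N. Sup K - Inf K) = (\<Sum>k<N. t (Suc k) - t k)"
      using chain_cells_sum[OF t(1), of "\<lambda>x y. y - x" N] by simp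
    also have "\<dots> < \<delta>" using t(3) by (simp add: sum_lessThan_telescope)
    finally have "(\<Sum>K\<in>chain_cells t N. norm (f (Sup K) - f (Inf K))) < \<epsilon>"
      by (rule \<delta>(2)[OF chain_cells_division[OF t(1)] sub])
    then show "chain_variation f t N < \<epsilon>"
      using chain_cells_sum[OF t(1), of "\<lambda>x y. norm (f y - f x)" N] by (simp add: chain_variation_def)
  qed
qed

text \<open>Chains shorter than some \<open>\<delta>\<close> have variation below \<open>1\<close>, and any chain is cut into a bounded number of
pieces that are shorter than \<open>\<delta>\<close>.\<close>

lemma abs_continuous_on_bdd_variation:
  assumes ac: "abs_continuous_on f a b"
  shows "bdd_above (chain_variations f a b)"
proof -
  obtain \<delta> where \<delta>: "\<delta> > 0"
    "\<And>(t::nat \<Rightarrow> real) N. mono t \<Longrightarrow> range t \<subseteq> {a..b} \<Longrightarrow> t N - t 0 < \<delta> \<Longrightarrow> chain_variation f t N < 1"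
    using abs_continuous_on_chain[OF ac, of 1] by auto
  have *: "chain_variation f t N \<le> real m" 
    if "mono t" "range t \<subseteq> {a..b}" "t N - t 0 < real m * (\<delta> / 2)" for t :: "nat \<Rightarrow> real" and N m
    using that
  proof (induction m arbitrary: t)
    case 0
    then have "t N < t 0" by simp
    then show ?case using monoD[OF 0(1), of 0 N] by simp
  next
    case (Suc m)
    have tr: "a \<le> t k" "t k \<le> b" for k using Suc.prems(2) by (auto simp: image_subset_iff)
    define x where "x = min b (t 0 + \<delta> / 2)"
    have x: "a \<le> x" "x \<le> b" "x \<le> t 0 + \<delta>/2" "x \<ge> t 0" using tr[of 0] \<delta>(1) by (auto simp: x_def)
    have 1: "chain_variation f (\<lambda>k. min (t k) x) N < 1"
    proof (rule \<delta>(2))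
      show "mono (\<lambda>k. min (t k) x)" by (rule mono_min_const[OF Suc.prems(1)])
      show "range (\<lambda>k. min (t k) x) \<subseteq> {a..b}" using tr x by (auto simp: min_le_iff_disj)
      show "min (t N) x - min (t 0) x < \<delta>" using x \<delta>(1) by (simp add: min_def)
    qed
    have 2: "chain_variation f (\<lambda>k. max (t k) x) N \<le> real m"
    proof (cases "t N \<le> x")
      case True
      have "t k \<le> x" if "k \<le> N" for k using monoD[OF Suc.prems(1) that] True by linarith
      then have "chain_variation f (\<lambda>k. max (t k) x) N = (\<Sum>k<N. 0)"
        unfolding chain_variation_def by (intro sum.cong) (auto simp: max_def dest: Suc_leI order_antisym)
      then show ?thesis by simp
    next
      case False
      show ?thesis
      proof (rule Suc.IH)
        show "mono (\<lambda>k. max (t k) x)" by (rule mono_max_const[OF Suc.prems(1)])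
        show "range (\<lambda>k. max (t k) x) \<subseteq> {a..b}" using tr x by (auto simp: le_max_iff_disj)
        have "x = t 0 + \<delta>/2" using False tr[of N] by (auto simp: x_def)
        then show "max (t N) x - max (t 0) x < real m * (\<delta> / 2)"
          using False Suc.prems(3) x by (simp add: field_simps)
      qed
    qed
    show ?case using chain_variation_split[OF Suc.prems(1), of f N x] 1 2 by simp
  qed
  obtain m :: nat where m: "(b - a) / (\<delta>/2) < real m" using reals_Archimedean2 by blast
  show ?thesis
  proof (rule bdd_aboveI)
    fix s assume "s \<in> chain_variations f a b"
    then obtain t N where t: "mono t" "range t \<subseteq> {a..b}" and s: "s = chain_variation f t N"
      by (auto simp: chain_variations_def)
    have "t N \<le> b" "a \<le> t 0" using t(2) by (auto simp: image_subset_iff)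
    moreover have "b - a < real m * (\<delta>/2)" using m \<delta>(1) by (simp add: field_simps)
    ultimately have "t N - t 0 < real m * (\<delta>/2)" by linarith
    then show "s \<le> real m" using * t s by blast
  qed
qed

text \<open>For a short family of intervals, each increment of the total variation is the variation of \<open>f\<close> on
that interval, which a chain inside the interval attains up to a small error. The cells of all
these chains form one short family of non-overlapping intervals, to which the absolute continuity
of \<open>f\<close> applies.\<close>

lemma abs_continuous_on_total_variation:
  assumes ac: "abs_continuous_on f a b"
  shows "abs_continuous_on (total_variation f a) a b"
  unfolding abs_continuous_on_def
proof (intro allI impI)
  fix \<epsilon> :: real assume "\<epsilon> > 0"
  then have "\<epsilon>/2 > 0" by simp
  note bdd = abs_continuous_on_bdd_variation[OF ac]
  obtain \<delta> where \<delta>: "\<delta> > 0" "\<And>D. D division_of \<Union>D \<Longrightarrow> \<Union>D \<subseteq> {a..b} \<Longrightarrow>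
        (\<Sum>K\<in>D. Sup K - Inf K) < \<delta> \<Longrightarrow> (\<Sum>K\<in>D. norm (f (Sup K) - f (Inf K))) < \<epsilon>/2"
    using ac \<open>\<epsilon>/2 > 0\<close> unfolding abs_continuous_on_def by blast
  show "\<exists>\<delta>>0. \<forall>D. D division_of \<Union>D \<longrightarrow> \<Union>D \<subseteq> {a..b} \<longrightarrow> (\<Sum>K\<in>D. Sup K - Inf K) < \<delta> \<longrightarrow>
        (\<Sum>K\<in>D. norm (total_variation f a (Sup K) - total_variation f a (Inf K))) < \<epsilon>"
  proof (intro exI conjI allI impI, rule \<delta>(1))
    fix D assume D: "D division_of \<Union>D" "\<Union>D \<subseteq> {a..b}" "(\<Sum>K\<in>D. Sup K - Inf K) < \<delta>"
    have fin: "finite D" using D(1) by blast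
    have K: "K = {Inf K..Sup K} \<and> Inf K \<le> Sup K \<and> a \<le> Inf K \<and> Sup K \<le> b" if KD: "K \<in> D" for K
    proof -
      obtain c d where cd: "K = cbox c d" "K \<noteq> {}" using D(1) KD by blast
      then have "c \<le> d" by simp
      have "K \<subseteq> {a..b}" using D(2) KD by blast
      then have "{c..d} \<subseteq> {a..b}" using cd by simp
      then show ?thesis using \<open>c \<le> d\<close> cd(1) by simp
    qed
    define e where "e = \<epsilon> / (2 * (real (card D) + 1))"
    have e: "e > 0" "real (card D) * e \<le> \<epsilon>/2" using \<open>\<epsilon> > 0\<close> by (auto simp: e_def field_simps)
    have "\<exists>t N. mono t \<and> range t \<subseteq> {Inf K..Sup K} \<and>
        total_variation f (Inf K) (Sup K) < chain_variation f t N + e" if KD: "K \<in> D" for K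
    proof -
      have "\<exists>s\<in>chain_variations f (Inf K) (Sup K). total_variation f (Inf K) (Sup K) - e < s"
        unfolding total_variation_def
        using K[OF KD] e(1) by (intro less_cSupD chain_variations_nonempty) auto
      then show ?thesis unfolding chain_variations_def by (force simp: algebra_simps)
    qed
    then obtain t N where tN: "\<And>K. K \<in> D \<Longrightarrow> mono (t K) \<and> range (t K) \<subseteq> {Inf K..Sup K} \<and>
        total_variation f (Inf K) (Sup K) < chain_variation f (t K) (N K) + e" by metis
    define E where "E K = chain_cells (t K) (N K)" for K
    have E_sub: "\<Union>(E K) \<subseteq> K" if "K \<in> D" for K
      unfolding E_def using tN[OF that] K[OF that] chain_cells_subset by metis
    have E_nondeg: "interior X \<noteq> {}" if "X \<in> E K" for X K
      using that by (auto simp: E_def chain_cells_def interior_atLeastAtMost_real)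
    have E_div: "E K division_of \<Union>(E K)" if "K \<in> D" for K
      unfolding E_def using tN[OF that] by (intro chain_cells_division) auto
    have E_meet: "interior X \<inter> interior Y = {}" if "K \<in> D" "L \<in> D" "K \<noteq> L" "X \<in> E K" "Y \<in> E L" for K L X Y
    proof -
      have "X \<subseteq> K" "Y \<subseteq> L" using E_sub that by auto
      then have "interior X \<subseteq> interior K" "interior Y \<subseteq> interior L" by (simp_all add: interior_mono)
      moreover have "interior K \<inter> interior L = {}" using D(1) that by blast
      ultimately show ?thesis by blast
    qed
    have E_disj: "E K \<inter> E L = {}" if "K \<in> D" "L \<in> D" "K \<noteq> L" for K L
      using E_meet[OF that] E_nondeg by blast
    have E_fin: "finite (E K)" for K by (simp add: E_def chain_cells_def)
    define EE where "EE = (\<Union>K\<in>D. E K)"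
    have EE_div: "EE division_of \<Union>EE"
    proof (rule division_ofI)
      show "finite EE" using fin E_fin by (simp add: EE_def)
      fix X assume X: "X \<in> EE"
      then obtain K where KX: "K \<in> D" "X \<in> E K" by (auto simp: EE_def)
      show "X \<noteq> {}" "\<exists>a b. X = cbox a b" using E_div[OF KX(1)] KX(2) by blast+
      show "X \<subseteq> \<Union>EE" using X by blast
    next
      fix X Y assume "X \<in> EE" "Y \<in> EE" "X \<noteq> Y"
      then obtain K L where "K \<in> D" "X \<in> E K" "L \<in> D" "Y \<in> E L" by (auto simp: EE_def)
      then show "interior X \<inter> interior Y = {}"
        using E_meet[of K L X Y] E_div[of K] \<open>X \<noteq> Y\<close> by (cases "K = L") blast+
    qed simp
    have EE_sub: "\<Union>EE \<subseteq> {a..b}" using E_sub D(2) by (fastforce simp: EE_def)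
    have EE_sum: "(\<Sum>X\<in>EE. h X) = (\<Sum>K\<in>D. \<Sum>X\<in>E K. h X)" for h :: "real set \<Rightarrow> real"
      unfolding EE_def using fin E_fin E_disj by (intro sum.UNION_disjoint) auto
    have "(\<Sum>X\<in>EE. Sup X - Inf X) \<le> (\<Sum>K\<in>D. Sup K - Inf K)"
      unfolding EE_sum
    proof (rule sum_mono)
      fix K assume KD: "K \<in> D"
      have "(\<Sum>X\<in>E K. Sup X - Inf X) = (\<Sum>k<N K. t K (Suc k) - t K k)"
        unfolding E_def using tN[OF KD] chain_cells_sum[of "t K" "\<lambda>x y. y - x" "N K"] by simp
      also have "\<dots> = t K (N K) - t K 0" by (rule sum_lessThan_telescope)
      also have "\<dots> \<le> Sup K - Inf K" using tN[OF KD] by (intro diff_mono) (auto simp: image_subset_iff)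
      finally show "(\<Sum>X\<in>E K. Sup X - Inf X) \<le> Sup K - Inf K" .
    qed
    then have small: "(\<Sum>X\<in>EE. norm (f (Sup X) - f (Inf X))) < \<epsilon>/2"
      using D(3) by (intro \<delta>(2)[OF EE_div EE_sub]) simp
    have "norm (total_variation f a (Sup K) - total_variation f a (Inf K)) \<le>
        (\<Sum>X\<in>E K. norm (f (Sup X) - f (Inf X))) + e" if KD: "K \<in> D" for K
    proof -
      have "total_variation f a (Inf K) \<le> total_variation f a (Sup K)"
        using variation_majorant_mono[OF total_variation_majorant[OF bdd]] K[OF KD] by blast
      moreover have "total_variation f a (Sup K) \<le> total_variation f a (Inf K) + total_variation f (Inf K) (Sup K)"
        using K[OF KD] by (intro total_variation_split[OF bdd]) auto
      moreover have "chain_variation f (t K) (N K) = (\<Sum>X\<in>E K. norm (f (Sup X) - f (Inf X)))"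
        unfolding E_def chain_variation_def
        using tN[OF KD] chain_cells_sum[of "t K" "\<lambda>x y. norm (f y - f x)" "N K"] by simp
      ultimately show ?thesis using tN[OF KD] by (simp add: real_norm_def)
    qed
    then have "(\<Sum>K\<in>D. norm (total_variation f a (Sup K) - total_variation f a (Inf K))) \<le>
        (\<Sum>K\<in>D. (\<Sum>X\<in>E K. norm (f (Sup X) - f (Inf X))) + e)"
      by (rule sum_mono)
    also have "\<dots> = (\<Sum>X\<in>EE. norm (f (Sup X) - f (Inf X))) + real (card D) * e"
      by (simp add: sum.distrib EE_sum)
    also have "\<dots> < \<epsilon>" using small e(2) by linarith
    finally show "(\<Sum>K\<in>D. norm (total_variation f a (Sup K) - total_variation f a (Inf K))) < \<epsilon>" .
  qed
qed

section \<open>Absolutely continuous functions are indefinite integrals\<close>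

lemma abs_continuous_on_imp_pair:
  assumes "abs_continuous_on f a b" "\<epsilon> > 0"
  obtains \<delta> where "\<delta> > 0"
    "\<And>x y. a \<le> x \<Longrightarrow> x \<le> y \<Longrightarrow> y \<le> b \<Longrightarrow> y - x < \<delta> \<Longrightarrow> norm (f y - f x) < \<epsilon>"
proof -
  obtain \<delta> where \<delta>: "\<delta> > 0" "\<And>D. D division_of \<Union>D \<Longrightarrow> \<Union>D \<subseteq> {a..b} \<Longrightarrow>
        (\<Sum>K\<in>D. Sup K - Inf K) < \<delta> \<Longrightarrow> (\<Sum>K\<in>D. norm (f (Sup K) - f (Inf K))) < \<epsilon>"
    using assms unfolding abs_continuous_on_def by blast
  show ?thesis
  proof (rule that[OF \<delta>(1)])
    fix x y assume "a \<le> x" "x \<le> y" "y \<le> b" "y - x < \<delta>"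
    moreover have "{{x..y}} division_of \<Union>{{x..y}}"
      using division_of_self[of x y] \<open>x \<le> y\<close> by simp
    ultimately show "norm (f y - f x) < \<epsilon>"
      using \<delta>(2)[of "{{x..y}}"] by simp
  qed
qed

lemma abs_continuous_on_imp_continuous_on:
  assumes "abs_continuous_on f a b"
  shows "continuous_on {a..b} f"
  unfolding continuous_on_iff
proof (intro ballI allI impI)
  fix x e :: real assume x: "x \<in> {a..b}" and "e > 0"
  obtain d where d: "d > 0"
    "\<And>x y. a \<le> x \<Longrightarrow> x \<le> y \<Longrightarrow> y \<le> b \<Longrightarrow> y - x < d \<Longrightarrow> norm (f y - f x) < e"
    using abs_continuous_on_imp_pair[OF assms \<open>e > 0\<close>] by blast
  show "\<exists>d>0. \<forall>x'\<in>{a..b}. dist x' x < d \<longrightarrow> dist (f x') (f x) < e"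
  proof (intro exI[of _ d] conjI ballI impI)
    fix x' assume "x' \<in> {a..b}" "dist x' x < d"
    then show "dist (f x') (f x) < e"
      using d(2)[of x x'] d(2)[of x' x] x
      by (cases "x \<le> x'") (auto simp: dist_norm norm_minus_commute)
  qed (rule d(1))
qed

lemma abs_continuous_on_bound:
  assumes f: "abs_continuous_on f a b"
    and g: "abs_continuous_on g a b"
    and h: "\<And>x y. norm (h y - h x) \<le> norm (f y - f x) + norm (g y - g x)"
  shows "abs_continuous_on h a b"
  unfolding abs_continuous_on_def
proof (intro allI impI)
  fix \<epsilon> :: real assume "\<epsilon> > 0"
  then have e: "\<epsilon>/2 > 0" by simp
  obtain d1 where d1: "d1 > 0" "\<And>D. D division_of \<Union>D \<Longrightarrow> \<Union>D \<subseteq> {a..b} \<Longrightarrow>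
        (\<Sum>K\<in>D. Sup K - Inf K) < d1 \<Longrightarrow> (\<Sum>K\<in>D. norm (f (Sup K) - f (Inf K))) < \<epsilon>/2"
    using f e unfolding abs_continuous_on_def by blast
  obtain d2 where d2: "d2 > 0" "\<And>D. D division_of \<Union>D \<Longrightarrow> \<Union>D \<subseteq> {a..b} \<Longrightarrow>
        (\<Sum>K\<in>D. Sup K - Inf K) < d2 \<Longrightarrow> (\<Sum>K\<in>D. norm (g (Sup K) - g (Inf K))) < \<epsilon>/2"
    using g e unfolding abs_continuous_on_def by blast
  show "\<exists>\<delta>>0. \<forall>D. D division_of \<Union>D \<longrightarrow> \<Union>D \<subseteq> {a..b} \<longrightarrow> (\<Sum>K\<in>D. Sup K - Inf K) < \<delta> \<longrightarrow>
        (\<Sum>K\<in>D. norm (h (Sup K) - h (Inf K))) < \<epsilon>"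
  proof (intro exI[of _ "min d1 d2"] conjI allI impI)
    fix D assume D: "D division_of \<Union>D" "\<Union>D \<subseteq> {a..b}" "(\<Sum>K\<in>D. Sup K - Inf K) < min d1 d2"
    have "(\<Sum>K\<in>D. norm (h (Sup K) - h (Inf K))) \<le>
        (\<Sum>K\<in>D. norm (f (Sup K) - f (Inf K)) + norm (g (Sup K) - g (Inf K)))"
      by (intro sum_mono h)
    also have "\<dots> < \<epsilon>"
      using d1(2)[OF D(1,2)] d2(2)[OF D(1,2)] D(3) by (simp add: sum.distrib)
    finally show "(\<Sum>K\<in>D. norm (h (Sup K) - h (Inf K))) < \<epsilon>" .
  qed (use d1 d2 in auto)
qed

lemma abs_continuous_on_const: "abs_continuous_on (\<lambda>_. c) a b"
  unfolding abs_continuous_on_def by (auto intro: exI[of _ 1])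

lemma abs_continuous_on_add:
  assumes "abs_continuous_on f a b" "abs_continuous_on g a b"
  shows "abs_continuous_on (\<lambda>x. f x + g x) a b"
  by (rule abs_continuous_on_bound[OF assms]) (metis add_diff_add norm_triangle_ineq)

lemma abs_continuous_on_diff:
  assumes "abs_continuous_on f a b" "abs_continuous_on g a b"
  shows "abs_continuous_on (\<lambda>x. f x - g x) a b"
proof (rule abs_continuous_on_bound[OF assms])
  fix x y
  have "f y - g y - (f x - g x) = (f y - f x) - (g y - g x)" by simp
  then show "norm (f y - g y - (f x - g x)) \<le> norm (f y - f x) + norm (g y - g x)"
    by (metis norm_triangle_ineq4)
qed

lemma abs_continuous_on_sum:
  assumes "\<And>i. i \<in> I \<Longrightarrow> abs_continuous_on (f i) a b"
  shows "abs_continuous_on (\<lambda>x. \<Sum>i\<in>I. f i x) a b"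
  using assms
proof (induction I rule: infinite_finite_induct)
  case (insert x F)
  then show ?case by (auto intro!: abs_continuous_on_add)
qed (simp_all add: abs_continuous_on_const)

text \<open>The Stieltjes measure of a function that is constant outside \<open>[a, b]\<close> lives on the open interval;
the end points have measure zero by continuity.\<close>

lemma interval_measure_null_outside:
  fixes G :: "real \<Rightarrow> real"
  assumes G: "\<And>x y. x \<le> y \<Longrightarrow> G x \<le> G y" "continuous_on UNIV G"
    and "\<And>x. x \<le> a \<Longrightarrow> G x = G a" "\<And>x. b \<le> x \<Longrightarrow> G x = G b"
  shows "{..a} \<union> {b..} \<in> null_sets (interval_measure G)"
proof -
  have "{a - real n..a} \<union> {b..b + real n} \<in> null_sets (interval_measure G)" for n
    using assms(3)[of "a - real n"] assms(4)[of "b + real n"]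
    by (intro null_sets.Un) (auto intro!: null_setsI simp: emeasure_interval_measure_Icc[OF _ G])
  then have N: "(\<Union>n. {a - real n..a} \<union> {b..b + real n}) \<in> null_sets (interval_measure G)"
    by (rule null_sets_UN)
  have S: "{..a} \<union> {b..} \<subseteq> (\<Union>n. {a - real n..a} \<union> {b..b + real n})"
  proof
    fix x assume "x \<in> {..a} \<union> {b..}"
    moreover obtain n :: nat where "\<bar>x - a\<bar> + \<bar>x - b\<bar> < real n" using reals_Archimedean2 by blast
    ultimately show "x \<in> (\<Union>n. {a - real n..a} \<union> {b..b + real n})"
      by (intro UN_I[of n]) auto
  qed
  show ?thesis by (rule null_sets_subset[OF N _ S]) auto
qed

lemma division_sum_lengths:
  fixes W :: "real set"
  assumes p: "p division_of W"
  shows "ennreal (\<Sum>K\<in>p. Sup K - Inf K) = emeasure lborel W"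
proof -
  have W: "W \<in> lmeasurable" using p by (rule lmeasurable_division)
  have "measure lebesgue K = Sup K - Inf K" if K: "K \<in> p" for K
  proof -
    obtain c d where "K = cbox c d" "K \<noteq> {}" using division_ofD(3,4)[OF p K] by blast
    then show ?thesis by simp
  qed
  then have "(\<Sum>K\<in>p. Sup K - Inf K) = measure lebesgue W"
    using content_division[OF p] by simp
  moreover have "W \<in> sets borel"
  proof -
    have "K \<in> sets borel" if "K \<in> p" for K using division_ofD(4)[OF p that] by auto
    then have "\<Union>p \<in> sets borel" using p by (intro sets.finite_Union) auto
    then show ?thesis using division_ofD(6)[OF p] by simp
  qed
  ultimately show ?thesis
    using emeasure_eq_measure2[OF W] by simp
qed

text \<open>A Lebesgue null set inside \<open>(a, b)\<close> is covered by an open set of small length, which is exhausted by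
finite unions of intervals. Each such union can be rearranged into a division of the same small
length, so that the absolute continuity of \<open>H\<close> bounds its Stieltjes measure.\<close>

lemma abs_continuous_interval_measure:
  fixes H G :: "real \<Rightarrow> real"
  assumes ac: "abs_continuous_on H a b"
    and G: "\<And>x y. x \<le> y \<Longrightarrow> G x \<le> G y" "continuous_on UNIV G"
    and GH: "\<And>x. a \<le> x \<Longrightarrow> x \<le> b \<Longrightarrow> G x = H x"
    and out: "\<And>x. x \<le> a \<Longrightarrow> G x = G a" "\<And>x. b \<le> x \<Longrightarrow> G x = G b"
  shows "absolutely_continuous lborel (interval_measure G)"
  unfolding absolutely_continuous_def
proof
  let ?\<mu> = "interval_measure G"
  fix A :: "real set" assume A: "A \<in> null_sets lborel"
  let ?A = "A \<inter> {a<..<b}"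
  have "?A \<in> null_sets lborel" by (rule null_sets_subset[OF A]) (use A in auto)
  then have A': "?A \<in> sets borel" "emeasure lborel ?A = 0" by auto
  have "emeasure ?\<mu> ?A \<le> ennreal \<epsilon>" if "\<epsilon> > 0" for \<epsilon>
  proof -
    obtain \<delta> where \<delta>: "\<delta> > 0" "\<And>D. D division_of \<Union>D \<Longrightarrow> \<Union>D \<subseteq> {a..b} \<Longrightarrow>
        (\<Sum>K\<in>D. Sup K - Inf K) < \<delta> \<Longrightarrow> (\<Sum>K\<in>D. norm (H (Sup K) - H (Inf K))) < \<epsilon>"
      using ac \<open>\<epsilon> > 0\<close> unfolding abs_continuous_on_def by blast
    obtain U0 where U0: "open U0" "?A \<subseteq> U0" "emeasure lborel (U0 - ?A) < ennreal \<delta>"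
      using outer_regular_lborel[OF A'(1) \<delta>(1)] by blast
    define U where "U = U0 \<inter> {a<..<b}"
    have U: "open U" "?A \<subseteq> U" "U \<subseteq> {a..b}" using U0 by (auto simp: U_def)
    have "emeasure lborel U \<le> emeasure lborel ((U0 - ?A) \<union> ?A)"
      using U0(1) A'(1) by (intro emeasure_mono) (auto simp: U_def)
    also have "\<dots> \<le> emeasure lborel (U0 - ?A) + emeasure lborel ?A"
      using U0(1) A'(1) by (intro emeasure_subadditive) auto
    also have "\<dots> < ennreal \<delta>" using U0(3) A'(2) by simp
    finally have lU: "emeasure lborel U < ennreal \<delta>" .
    obtain \<D> where \<D>: "countable \<D>" "\<D> \<subseteq> Pow U" "\<And>X. X \<in> \<D> \<Longrightarrow> \<exists>a b. X = cbox a b" "\<Union>\<D> = U"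
      using open_countable_Union_open_cbox[OF U(1)] by metis
    have fin: "emeasure ?\<mu> (\<Union>F) \<le> ennreal \<epsilon>" if F: "finite F" "F \<subseteq> \<D>" for F
    proof -
      obtain p where p: "p division_of \<Union>F"
        using elementary_unions_intervals[OF F(1)] \<D>(3) F(2) by (metis subsetD)
      have Up: "\<Union>p = \<Union>F" using p by (rule division_ofD(6))
      have sub: "\<Union>p \<subseteq> U" using F(2) \<D>(2) Up by auto
      have K: "K = {Inf K..Sup K} \<and> Inf K \<le> Sup K \<and> a \<le> Inf K \<and> Sup K \<le> b" if "K \<in> p" for K
      proof -
        obtain c d where cd: "K = cbox c d" "K \<noteq> {}" using division_ofD(3,4)[OF p \<open>K \<in> p\<close>] by blast
        moreover have "K \<subseteq> {a..b}" using sub U(3) \<open>K \<in> p\<close> by blast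
        ultimately show ?thesis by auto
      qed
      have Kle: "Inf K \<le> Sup K" if "K \<in> p" for K using K[OF that] by blast
      have "ennreal (\<Sum>K\<in>p. Sup K - Inf K) = emeasure lborel (\<Union>F)"
        by (rule division_sum_lengths[OF p])
      also have "\<dots> \<le> emeasure lborel U"
        using sub Up U(1) by (intro emeasure_mono) auto
      also note lU
      finally have "(\<Sum>K\<in>p. Sup K - Inf K) < \<delta>"
        using \<delta>(1) by (subst (asm) ennreal_less_iff) (auto intro!: sum_nonneg Kle)
      then have *: "(\<Sum>K\<in>p. norm (H (Sup K) - H (Inf K))) < \<epsilon>"
        using p Up sub U(3) by (intro \<delta>(2)) auto
      have "emeasure ?\<mu> (\<Union>F) = emeasure ?\<mu> (\<Union>((\<lambda>K. K) ` p))" using Up by simp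
      also have "\<dots> \<le> (\<Sum>K\<in>p. emeasure ?\<mu> K)"
      proof (rule emeasure_subadditive_finite)
        show "finite p" using p by auto
        have "K \<in> sets borel" if "K \<in> p" for K
          by (subst K[OF that, THEN conjunct1]) simp
        then show "(\<lambda>K. K) ` p \<subseteq> sets ?\<mu>" by auto
      qed
      also have "\<dots> = (\<Sum>K\<in>p. ennreal (norm (H (Sup K) - H (Inf K))))"
      proof (rule sum.cong)
        fix K assume "K \<in> p"
        note Keq = K[OF this, THEN conjunct1] and K = K[OF this, THEN conjunct2]
        have "emeasure ?\<mu> K = emeasure ?\<mu> {Inf K..Sup K}" by (subst Keq) (rule refl)
        also have "\<dots> = ennreal (G (Sup K) - G (Inf K))"
          using K by (intro emeasure_interval_measure_Icc G) auto
        finally show "emeasure ?\<mu> K = ennreal (norm (H (Sup K) - H (Inf K)))"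
          using GH[of "Sup K"] GH[of "Inf K"] G(1)[of "Inf K" "Sup K"] K by auto
      qed simp
      also have "\<dots> = ennreal (\<Sum>K\<in>p. norm (H (Sup K) - H (Inf K)))" by simp
      also have "\<dots> \<le> ennreal \<epsilon>" using * by (intro ennreal_leI) simp
      finally show ?thesis .
    qed
    show ?thesis
    proof (cases "\<D> = {}")
      case True
      then have "?A = {}" using U(2) \<D>(4) by auto
      then show ?thesis by (simp only: emeasure_empty) simp
    next
      case False
      define W where "W n = \<Union>(from_nat_into \<D> ` {..n::nat})" for n
      have rng: "range (from_nat_into \<D>) = \<D>" using False \<D>(1) by (rule range_from_nat_into)
      have "(\<Union>n. W n) = \<Union>(range (from_nat_into \<D>))" by (auto simp: W_def)
      then have UW: "U = \<Union>(range W)" using \<D>(4) rng by simp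
      have "range W \<subseteq> sets ?\<mu>"
      proof (clarsimp simp: W_def)
        fix n
        have "from_nat_into \<D> i \<in> sets borel" for i
          using \<D>(3)[OF from_nat_into[OF False], of i] by auto
        then show "\<Union>(from_nat_into \<D> ` {..n}) \<in> sets borel"
          by (intro sets.finite_UN) auto
      qed
      moreover have "incseq W" by (force simp: W_def incseq_def)
      ultimately have "(SUP n. emeasure ?\<mu> (W n)) = emeasure ?\<mu> U"
        unfolding UW by (rule SUP_emeasure_incseq)
      moreover have "emeasure ?\<mu> (W n) \<le> ennreal \<epsilon>" for n
        unfolding W_def using rng by (intro fin) auto
      ultimately have "emeasure ?\<mu> U \<le> ennreal \<epsilon>" using SUP_least[of UNIV "\<lambda>n. emeasure ?\<mu> (W n)"] by simp
      moreover have "emeasure ?\<mu> ?A \<le> emeasure ?\<mu> U" using U by (intro emeasure_mono) auto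
      ultimately show ?thesis by (rule order_trans[rotated])
    qed
  qed
  note small = this
  have "emeasure ?\<mu> ?A \<le> 0"
  proof (rule ennreal_le_epsilon)
    fix e :: real assume "0 < e"
    from small[OF this] show "emeasure ?\<mu> ?A \<le> 0 + ennreal e" by (simp only: add_0)
  qed
  then have "emeasure ?\<mu> ?A = 0" by simp
  then have "?A \<in> null_sets ?\<mu>" using A'(1) by (auto intro: null_setsI)
  then have N: "?A \<union> ({..a} \<union> {b..}) \<in> null_sets ?\<mu>"
    by (rule null_sets.Un) (rule interval_measure_null_outside[OF G out])
  have S: "A \<subseteq> ?A \<union> ({..a} \<union> {b..})" by auto
  have "A \<in> sets ?\<mu>" using A by auto
  then show "A \<in> null_sets ?\<mu>" by (rule null_sets_subset[OF N _ S])
qed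

text \<open>The Radon--Nikodym density of the Stieltjes measure of \<open>H\<close>, continued constantly beyond \<open>[a, b]\<close>, with
respect to Lebesgue measure.\<close>

lemma mono_abs_continuous_density:
  fixes H :: "real \<Rightarrow> real"
  assumes ac: "abs_continuous_on H a b"
    and mono: "\<And>x y. a \<le> x \<Longrightarrow> x \<le> y \<Longrightarrow> y \<le> b \<Longrightarrow> H x \<le> H y"
    and ab: "a \<le> b"
  shows "\<exists>f. integrable lborel f \<and> (\<forall>x\<in>{a..b}. H x - H a = (LINT t:{a..x}|lborel. f t))"
proof -
  define G where "G x = H (max a (min b x))" for x
  have G: "\<And>x y. x \<le> y \<Longrightarrow> G x \<le> G y" unfolding G_def using ab by (intro mono) auto
  have cG: "continuous_on UNIV G"
    unfolding G_def
    by (rule continuous_on_compose2[OF abs_continuous_on_imp_continuous_on[OF ac]])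
       (use ab in \<open>auto intro!: continuous_intros\<close>)
  have GH: "G x = H x" if "a \<le> x" "x \<le> b" for x using that by (simp add: G_def)
  have out: "x \<le> a \<Longrightarrow> G x = G a" "b \<le> x \<Longrightarrow> G x = G b" for x using ab by (simp_all add: G_def)
  let ?\<mu> = "interval_measure G"
  have "absolutely_continuous lborel ?\<mu>"
    by (rule abs_continuous_interval_measure[OF ac G cG GH out])
  then obtain f where f: "f \<in> borel_measurable lborel" "density lborel f = ?\<mu>"
    using sigma_finite_measure.Radon_Nikodym[OF sigma_finite_lborel, of ?\<mu>] by auto
  define g where "g x = enn2real (f x * indicator {a..b} x)" for x
  have fin: "(\<integral>\<^sup>+x. f x * indicator {a..x1} x \<partial>lborel) = ennreal (H x1 - H a)" if "x1 \<in> {a..b}" for x1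
  proof -
    have "(\<integral>\<^sup>+x. f x * indicator {a..x1} x \<partial>lborel) = emeasure ?\<mu> {a..x1}"
      using emeasure_density[OF f(1), of "{a..x1}"] f(2) by simp
    also have "\<dots> = ennreal (G x1 - G a)" using that by (intro emeasure_interval_measure_Icc G cG) auto
    finally show ?thesis using GH that by simp
  qed
  have m: "g \<in> borel_measurable lborel" unfolding g_def using f(1) by measurable
  have "AE x in lborel. f x * indicator {a..b} x \<noteq> \<infinity>"
    using f(1) fin[of b] ab by (intro nn_integral_PInf_AE) auto
  then have gf: "AE x in lborel. ennreal (g x) = f x * indicator {a..b} x"
    by eventually_elim (simp add: g_def less_top)
  have gi: "(\<integral>\<^sup>+x. ennreal (indicator {a..x1} x * g x) \<partial>lborel) = ennreal (H x1 - H a)" if "x1 \<in> {a..b}" for x1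
  proof -
    have "(\<integral>\<^sup>+x. ennreal (indicator {a..x1} x * g x) \<partial>lborel) = (\<integral>\<^sup>+x. f x * indicator {a..x1} x \<partial>lborel)"
      by (rule nn_integral_cong_AE, use gf in eventually_elim)
         (use that in \<open>auto simp: indicator_def g_def\<close>)
    then show ?thesis using fin[OF that] by simp
  qed
  have g0: "g x \<ge> 0" for x by (simp add: g_def)
  have gab: "indicator {a..b} x * g x = g x" for x by (simp add: g_def indicator_def)
  have "integrable lborel g"
    using gi[of b] ab m g0 by (intro integrableI_nonneg) (auto simp: gab)
  moreover have "H x1 - H a = (LINT t:{a..x1}|lborel. g t)" if "x1 \<in> {a..b}" for x1
  proof -
    have "(LINT t:{a..x1}|lborel. g t) = enn2real (\<integral>\<^sup>+x. ennreal (indicator {a..x1} x * g x) \<partial>lborel)"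
      unfolding set_lebesgue_integral_def using m g0
      by (subst integral_eq_nn_integral) (auto simp: real_scaleR_def)
    also have "\<dots> = H x1 - H a" using gi[OF that] mono[of a x1] that by simp
    finally show ?thesis by simp
  qed
  ultimately show ?thesis by blast
qed

text \<open>Jordan decomposition: \<open>f\<close> is the difference of its total variation \<open>T\<close> and \<open>T - f\<close>, both nondecreasing
and absolutely continuous.\<close>

lemma abs_continuous_on_real_integral:
  fixes f :: "real \<Rightarrow> real"
  assumes ac: "abs_continuous_on f a b" and ab: "a \<le> b"
  shows "\<exists>f'. integrable lborel f' \<and> (\<forall>x\<in>{a..b}. f x - f a = (LINT t:{a..x}|lborel. f' t))"
proof -
  let ?T = "total_variation f a"
  note maj = total_variation_majorant[OF abs_continuous_on_bdd_variation[OF ac]]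
  note acT = abs_continuous_on_total_variation[OF ac]
  obtain g where g: "integrable lborel g" "\<And>x. x \<in> {a..b} \<Longrightarrow> ?T x - ?T a = (LINT t:{a..x}|lborel. g t)"
    using mono_abs_continuous_density[OF acT variation_majorant_mono[OF maj] ab] by blast
  have "?T x - f x \<le> ?T y - f y" if "a \<le> x" "x \<le> y" "y \<le> b" for x y
    using variation_majorantD[OF maj that] by (simp add: abs_le_iff)
  then obtain h where h: "integrable lborel h"
      "\<And>x. x \<in> {a..b} \<Longrightarrow> (?T x - f x) - (?T a - f a) = (LINT t:{a..x}|lborel. h t)"
    using mono_abs_continuous_density[OF abs_continuous_on_diff[OF acT ac] _ ab] by blast
  have si: "set_integrable lborel {a..x} k" if "integrable lborel k" for k :: "real \<Rightarrow> real" and x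
    using that unfolding set_integrable_def by (intro integrable_mult_indicator) auto
  have "f x - f a = (LINT t:{a..x}|lborel. g t - h t)" if "x \<in> {a..b}" for x
    using g(2)[OF that] h(2)[OF that] set_integral_diff(2)[OF si[OF g(1)] si[OF h(1)], of x] by simp
  moreover have "integrable lborel (\<lambda>t. g t - h t)" using g h by simp
  ultimately show ?thesis by blast
qed


lemma lborel_integrable_imp_lebesgue:
  fixes f :: "real \<Rightarrow> 'a::euclidean_space"
  assumes "integrable lborel f" shows "integrable lebesgue f"
  using assms by (subst integrable_completion) auto

lemma integrable_lebesgue_imp_HK:
  fixes f :: "real \<Rightarrow> 'a::euclidean_space"
  assumes "integrable lebesgue f"
  shows "f absolutely_integrable_on {a..b}" "f integrable_on {a..b}"
proof -
  show "f absolutely_integrable_on {a..b}"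
    using integrable_mult_indicator[OF _ assms, of "{a..b}"] by (simp add: set_integrable_def)
  then show "f integrable_on {a..b}" by (rule set_lebesgue_integral_eq_integral)
qed

lemma abs_continuous_on_integral:
  fixes f :: "real \<Rightarrow> 'a::euclidean_space"
  assumes ac: "abs_continuous_on f a b" and ab: "a \<le> b"
  shows "\<exists>f'. integrable lebesgue f' \<and> (\<forall>c d. a \<le> c \<longrightarrow> c \<le> d \<longrightarrow> d \<le> b \<longrightarrow> f d - f c = integral {c..d} f')"
proof -
  have "\<exists>g. integrable lborel g \<and> (\<forall>x\<in>{a..b}. f x \<bullet> k - f a \<bullet> k = (LINT t:{a..x}|lborel. g t))"
    if k: "k \<in> Basis" for k
  proof (rule abs_continuous_on_real_integral[OF _ ab])
    show "abs_continuous_on (\<lambda>x. f x \<bullet> k) a b"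
    proof (rule abs_continuous_on_bound[OF ac abs_continuous_on_const[of "0::real"]])
      fix x y show "norm (f y \<bullet> k - f x \<bullet> k) \<le> norm (f y - f x) + norm (0 - 0 :: real)"
        using Basis_le_norm[OF k, of "f y - f x"] by (simp add: inner_diff_left)
    qed
  qed
  then obtain g where g: "\<And>k. k \<in> Basis \<Longrightarrow> integrable lborel (g k)"
    "\<And>k x. k \<in> Basis \<Longrightarrow> x \<in> {a..b} \<Longrightarrow> f x \<bullet> k - f a \<bullet> k = (LINT t:{a..x}|lborel. g k t)" by metis
  have gl: "integrable lebesgue (g k)" if "k \<in> Basis" for k
    by (rule lborel_integrable_imp_lebesgue[OF g(1)[OF that]])
  define f' where "f' t = (\<Sum>k\<in>Basis. g k t *\<^sub>R k)" for t
  have int: "integrable lebesgue f'"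
    unfolding f'_def by (intro Bochner_Integration.integrable_sum integrable_scaleR_left gl)
  have main: "f x - f a = integral {a..x} f'" if x: "x \<in> {a..b}" for x
  proof -
    have gHK: "f x \<bullet> k - f a \<bullet> k = integral {a..x} (g k)" if k: "k \<in> Basis" for k
    proof -
      have "set_integrable lborel {a..x} (g k)"
        unfolding set_integrable_def using g(1)[OF k] by (intro integrable_mult_indicator) auto
      then show ?thesis using g(2)[OF k x] set_borel_integral_eq_integral(2) by simp
    qed
    have "integral {a..x} f' = (\<Sum>k\<in>Basis. integral {a..x} (\<lambda>t. g k t *\<^sub>R k))"
      unfolding f'_def by (intro integral_sum integrable_on_scaleR_left integrable_lebesgue_imp_HK gl) auto
    also have "\<dots> = (\<Sum>k\<in>Basis. ((f x - f a) \<bullet> k) *\<^sub>R k)"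
    proof (intro sum.cong refl)
      fix k :: 'a assume k: "k \<in> Basis"
      have "integral {a..x} ((\<lambda>c. c *\<^sub>R k) \<circ> g k) = integral {a..x} (g k) *\<^sub>R k"
        by (rule integral_linear[OF integrable_lebesgue_imp_HK(2)[OF gl[OF k]] bounded_linear_scaleR_left])
      then show "integral {a..x} (\<lambda>t. g k t *\<^sub>R k) = ((f x - f a) \<bullet> k) *\<^sub>R k"
        by (simp add: o_def inner_diff_left gHK[OF k])
    qed
    finally show ?thesis by (simp add: euclidean_representation)
  qed
  have "f d - f c = integral {c..d} f'" if "a \<le> c" "c \<le> d" "d \<le> b" for c d
    using main[of c] main[of d] Henstock_Kurzweil_Integration.integral_combine[of a c d f'] that
      integrable_lebesgue_imp_HK(2)[OF int, of a d] by (simp add: algebra_simps)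
  with int show ?thesis by blast
qed

lemma negligible_uminus_image:
  fixes N :: "real set" assumes "negligible N" shows "negligible {x. - x \<in> N}"
proof -
  have "negligible ((\<lambda>x. - x) ` N)"
    by (rule negligible_differentiable_image_negligible[OF _ assms]) auto
  moreover have "(\<lambda>x. - x) ` N = {x. - x \<in> N}" by (auto intro: image_eqI[of _ _ "- x" for x])
  ultimately show ?thesis by simp
qed

text \<open>Lebesgue's differentiation theorem for difference quotients to the right.\<close>

lemma indefinite_integral_right_difference:
  fixes g :: "real \<Rightarrow> 'a::euclidean_space"
  assumes g: "integrable lebesgue g"
  obtains N where "negligible N"
    "\<And>x e. x \<notin> N \<Longrightarrow> e > 0 \<Longrightarrow> \<exists>d>0. \<forall>h. 0 < h \<and> h < d \<longrightarrow> norm (integral {x..x + h} g - h *\<^sub>R g x) \<le> e * h"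
proof -
  have "g integrable_on cbox a b" for a b using integrable_lebesgue_imp_HK(2)[OF g] by simp
  then obtain N where N: "negligible N" "\<And>x e. \<lbrakk>x \<notin> N; 0 < e\<rbrakk> \<Longrightarrow>
     \<exists>d>0. \<forall>h. 0 < h \<and> h < d \<longrightarrow> norm(integral (cbox x (x + h *\<^sub>R One)) g /\<^sub>R h ^ DIM(real) - g x) < e"
    by (rule integrable_ccontinuous_explicit) blast
  show ?thesis
  proof (rule that[OF N(1)])
    fix x e :: real assume "x \<notin> N" "e > 0"
    then obtain d where d: "d > 0"
      "\<And>h. 0 < h \<and> h < d \<Longrightarrow> norm (integral {x..x + h} g /\<^sub>R h - g x) < e"
      using N(2)[of x e] by auto
    have "norm (integral {x..x + h} g - h *\<^sub>R g x) \<le> e * h" if h: "0 < h" "h < d" for h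
    proof -
      have "integral {x..x + h} g - h *\<^sub>R g x = h *\<^sub>R (integral {x..x + h} g /\<^sub>R h - g x)"
        using h by (simp add: scaleR_diff_right)
      then have "norm (integral {x..x + h} g - h *\<^sub>R g x) = h * norm (integral {x..x + h} g /\<^sub>R h - g x)"
        using h by simp
      also have "\<dots> \<le> h * e" using d(2)[of h] h by (intro mult_left_mono) auto
      finally show ?thesis by (simp add: mult.commute)
    qed
    then show "\<exists>d>0. \<forall>h. 0 < h \<and> h < d \<longrightarrow> norm (integral {x..x + h} g - h *\<^sub>R g x) \<le> e * h"
      using d(1) by blast
  qed
qed

text \<open>Left difference quotients are right ones of the reflected function.\<close>

lemma indefinite_integral_has_vector_derivative_ae:
  fixes g :: "real \<Rightarrow> 'a::euclidean_space"
  assumes g: "integrable lebesgue g"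
    and f: "\<And>c d. a \<le> c \<Longrightarrow> c \<le> d \<Longrightarrow> d \<le> b \<Longrightarrow> f d - f c = integral {c..d} g"
  obtains N where "negligible N"
    "\<And>x. x \<in> {a..b} - N \<Longrightarrow> (f has_vector_derivative g x) (at x within {a..b})"
proof -
  obtain N1 where N1: "negligible N1"
    "\<And>x e. x \<notin> N1 \<Longrightarrow> e > 0 \<Longrightarrow> \<exists>d>0. \<forall>h. 0 < h \<and> h < d \<longrightarrow> norm (integral {x..x + h} g - h *\<^sub>R g x) \<le> e * h"
    using indefinite_integral_right_difference[OF g] by blast
  have g': "integrable lebesgue (\<lambda>x. g (- x))"
    using lebesgue_integrable_real_affine[OF g, of "-1" 0] by simp
  obtain N2 where N2: "negligible N2"
    "\<And>x e. x \<notin> N2 \<Longrightarrow> e > 0 \<Longrightarrow> \<exists>d>0. \<forall>h. 0 < h \<and> h < d \<longrightarrow>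
        norm (integral {x..x + h} (\<lambda>x. g (- x)) - h *\<^sub>R g (- x)) \<le> e * h"
    using indefinite_integral_right_difference[OF g'] by blast
  show ?thesis
  proof (rule that[of "N1 \<union> {x. - x \<in> N2}"])
    show "negligible (N1 \<union> {x. - x \<in> N2})"
      using N1 N2 negligible_uminus_image by (intro negligible_Un) auto
    fix x assume x: "x \<in> {a..b} - (N1 \<union> {x. - x \<in> N2})"
    show "(f has_vector_derivative g x) (at x within {a..b})"
      unfolding has_vector_derivative_def has_derivative_within_alt
    proof (intro conjI allI impI)
      fix e :: real assume "e > 0"
      obtain d1 where d1: "d1 > 0" "\<And>h. 0 < h \<Longrightarrow> h < d1 \<Longrightarrow> norm (integral {x..x + h} g - h *\<^sub>R g x) \<le> e * h"
        using N1(2)[of x e] x \<open>e > 0\<close> by blast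
      obtain d2 where d2: "d2 > 0" "\<And>h. 0 < h \<Longrightarrow> h < d2 \<Longrightarrow>
          norm (integral {- x..- x + h} (\<lambda>x. g (- x)) - h *\<^sub>R g x) \<le> e * h"
        using N2(2)[of "- x" e] x \<open>e > 0\<close> by auto
      show "\<exists>d>0. \<forall>y\<in>{a..b}. norm (y - x) < d \<longrightarrow> norm (f y - f x - (y - x) *\<^sub>R g x) \<le> e * norm (y - x)"
      proof (intro exI[of _ "min d1 d2"] conjI ballI impI)
        fix y assume y: "y \<in> {a..b}" "norm (y - x) < min d1 d2"
        consider "y = x" | "x < y" | "y < x" by linarith
        then show "norm (f y - f x - (y - x) *\<^sub>R g x) \<le> e * norm (y - x)"
        proof cases
          case 2
          then show ?thesis using d1(2)[of "y - x"] f[of x y] x y by simp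
        next
          case 3
          have "integral {- x..- x + (x - y)} (\<lambda>x. g (- x)) = integral {y..x} g"
            using Henstock_Kurzweil_Integration.integral_reflect_real[of y x g] by simp
          then have "norm ((f x - f y) - (x - y) *\<^sub>R g x) \<le> e * (x - y)"
            using d2(2)[of "x - y"] f[of y x] x y 3 by simp
          moreover have "f y - f x - (y - x) *\<^sub>R g x = - ((f x - f y) - (x - y) *\<^sub>R g x)"
            by (simp add: algebra_simps)
          ultimately show ?thesis using 3 by (metis norm_minus_cancel norm_minus_commute real_norm_def abs_of_pos diff_gt_0_iff_gt)
        qed simp
      qed (use d1 d2 in auto)
    qed (rule bounded_linear_scaleR_left)
  qed
qed

section \<open>Riemann--Stieltjes integrals of continuous functions\<close>

definition grid :: "real \<Rightarrow> real \<Rightarrow> nat \<Rightarrow> nat \<Rightarrow> real" where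
  "grid a b N k = a + real k * ((b - a) / real N)"

lemma grid_0 [simp]: "grid a b N 0 = a" by (simp add: grid_def)

lemma grid_N [simp]: "0 < N \<Longrightarrow> grid a b N N = b" by (simp add: grid_def)

lemma grid_Suc: "grid a b N (Suc k) = grid a b N k + (b - a) / real N"
  unfolding grid_def by (simp only: of_nat_Suc distrib_right mult_1_left ac_simps)

lemma grid_mono: "a \<le> b \<Longrightarrow> j \<le> k \<Longrightarrow> grid a b N j \<le> grid a b N k"
  unfolding grid_def by (intro add_left_mono mult_right_mono) auto

lemma grid_ge: "a \<le> b \<Longrightarrow> a \<le> grid a b N k"
  using grid_mono[of a b 0 k N] by simp

lemma grid_le: "a \<le> b \<Longrightarrow> k \<le> N \<Longrightarrow> grid a b N k \<le> b"
  using grid_mono[of a b k N N] by (cases "N = 0") (auto simp: grid_def)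

lemma grid_telescope:
  fixes h :: "real \<Rightarrow> 'a::ab_group_add"
  assumes "0 < N"
  shows "(\<Sum>k<N. h (grid a b N (Suc k)) - h (grid a b N k)) = h b - h a"
  using sum_lessThan_telescope[of "\<lambda>k. h (grid a b N k)" N] assms by simp

lemma mesh_small:
  assumes "(e::real) > 0"
  obtains N0 where "\<And>N. N \<ge> N0 \<Longrightarrow> 0 < N \<and> (b - a) / real N < e"
proof -
  obtain m :: nat where m: "(b - a) / e < real m" using reals_Archimedean2 by blast
  show ?thesis
  proof (rule that[of "Suc m"])
    fix N assume N: "N \<ge> Suc m"
    then have "(b - a) / e < real N" using m by linarith
    then have "b - a < real N * e" using assms by (simp add: field_simps)
    then show "0 < N \<and> (b - a) / real N < e" using N by (simp add: field_simps)
  qed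
qed

text \<open>The left Riemann--Stieltjes sum over the equidistant partition of \<open>[a, b]\<close>, for the integrator
stopped at \<open>x\<close>. As a function of \<open>x\<close> it approximates the indefinite integral; keeping the partition
of \<open>[a, b]\<close> for every \<open>x\<close> makes the sums measurable in \<open>x\<close> and additive over intervals.\<close>

definition partial_rs_sum ::
  "(real \<Rightarrow> complex) \<Rightarrow> (real \<Rightarrow> complex) \<Rightarrow> real \<Rightarrow> real \<Rightarrow> nat \<Rightarrow> real \<Rightarrow> complex" where
  "partial_rs_sum f g a b N x =
     (\<Sum>k<N. f (grid a b N k) * (g (min x (grid a b N (Suc k))) - g (min x (grid a b N k))))"

text \<open>On a short interval \<open>[c, d]\<close> the increment of the sum only sees values of \<open>f\<close> at points near \<open>[c, d]\<close>, so
it differs little from \<open>f y * (g d - g c)\<close>, relative to the increment of the majorant. Relative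
errors of this kind add up without loss, which yields both the convergence of the sums and their
agreement with the sums over arbitrary fine tagged divisions, without common refinements.\<close>

lemma partial_rs_sum_local:
  assumes f: "continuous_on {a..b} f" and g: "variation_majorant T g a b"
    and ab: "a \<le> b" and "\<epsilon> > 0"
  obtains \<delta> N0 where "\<delta> > 0"
    "\<And>N c y d. N0 \<le> N \<Longrightarrow> a \<le> c \<Longrightarrow> c \<le> y \<Longrightarrow> y \<le> d \<Longrightarrow> d \<le> b \<Longrightarrow> d - c < \<delta> \<Longrightarrow>
       norm (partial_rs_sum f g a b N d - partial_rs_sum f g a b N c - f y * (g d - g c)) \<le> \<epsilon> * (T d - T c)"
proof -
  have "uniformly_continuous_on {a..b} f" using f by (intro compact_uniformly_continuous) auto
  then obtain e where e: "e > 0"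
    "\<And>x y. x \<in> {a..b} \<Longrightarrow> y \<in> {a..b} \<Longrightarrow> dist y x < e \<Longrightarrow> dist (f y) (f x) < \<epsilon>"
    using \<open>\<epsilon> > 0\<close> unfolding uniformly_continuous_on_def by blast
  obtain N0 where N0: "\<And>N. N \<ge> N0 \<Longrightarrow> 0 < N \<and> (b - a) / real N < e / 2"
    using mesh_small[of "e/2" b a] e(1) by auto
  show ?thesis
  proof (rule that[of "e/2" N0])
    show "e/2 > 0" using e by simp
    fix N c y d assume "N0 \<le> N" and cd: "a \<le> c" "c \<le> y" "y \<le> d" "d \<le> b" "d - c < e/2"
    then have N: "0 < N" "(b - a) / real N < e/2" using N0 by auto
    define t where "t k = grid a b N k" for k
    define w where "w k = max c (min d (t k))" for k
    have tm: "t k \<le> t (Suc k)" for k using ab by (simp add: t_def grid_mono)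
    have wm: "w k \<le> w (Suc k)" for k using tm[of k] by (auto simp: w_def)
    have wr: "c \<le> w k" "w k \<le> d" for k using cd by (auto simp: w_def)
    \<comment> \<open>The increment over \<open>[c, d]\<close> is a sum over the partition points truncated to \<open>[c, d]\<close>.\<close>
    have eq: "g (min d s) - g (min c s) = g (max c (min d s)) - g c" for s
      using cd by (auto simp: min_def max_def)
    have "w 0 = c" "w N = d" using cd N by (auto simp: w_def t_def)
    then have tel: "(\<Sum>k<N. h (w (Suc k)) - h (w k)) = h d - h c" for h :: "real \<Rightarrow> 'b::ab_group_add"
      using sum_lessThan_telescope[of "\<lambda>k. h (w k)" N] by simp
    have telg: "g d - g c = (\<Sum>k<N. g (w (Suc k)) - g (w k))" by (simp add: tel)
    have "partial_rs_sum f g a b N d - partial_rs_sum f g a b N c =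
        (\<Sum>k<N. f (t k) * ((g (min d (t (Suc k))) - g (min c (t (Suc k)))) - (g (min d (t k)) - g (min c (t k)))))"
      unfolding partial_rs_sum_def t_def[symmetric] sum_subtractf[symmetric]
      by (intro sum.cong) (auto simp: algebra_simps)
    also have "\<dots> = (\<Sum>k<N. f (t k) * (g (w (Suc k)) - g (w k)))"
      unfolding eq w_def by simp
    finally have "partial_rs_sum f g a b N d - partial_rs_sum f g a b N c - f y * (g d - g c) =
        (\<Sum>k<N. (f (t k) - f y) * (g (w (Suc k)) - g (w k)))"
      unfolding telg sum_distrib_left by (simp add: left_diff_distrib flip: sum_subtractf)
    also have "norm \<dots> \<le> (\<Sum>k<N. \<epsilon> * (T (w (Suc k)) - T (w k)))"
    proof (rule sum_norm_le)
      fix k assume "k \<in> {..<N}"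
      then have tk: "t k \<in> {a..b}" using ab by (auto simp: t_def grid_ge grid_le)
      have gT: "norm (g (w (Suc k)) - g (w k)) \<le> T (w (Suc k)) - T (w k)"
        using wr[of k] wr[of "Suc k"] cd by (intro variation_majorantD[OF g] wm) auto
      show "norm ((f (t k) - f y) * (g (w (Suc k)) - g (w k))) \<le> \<epsilon> * (T (w (Suc k)) - T (w k))"
      proof (cases "w k = w (Suc k)")
        case False
        then have "w k < w (Suc k)" using wm[of k] by simp
        then have "t k < d" "c < t (Suc k)" by (auto simp: w_def min_def max_def split: if_splits)
        moreover have "t (Suc k) - t k < e/2" using N(2) by (simp add: t_def grid_Suc)
        ultimately have "dist (t k) y < e" using cd unfolding dist_real_def by linarith
        then have "norm (f (t k) - f y) \<le> \<epsilon>"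
          using e(2)[of y "t k"] tk cd by (simp add: dist_norm)
        then show ?thesis unfolding norm_mult using gT \<open>\<epsilon> > 0\<close> by (intro mult_mono) auto
      qed simp
    qed
    also have "\<dots> = \<epsilon> * (T d - T c)" using tel[of T] by (simp flip: sum_distrib_left)
    finally show "norm (partial_rs_sum f g a b N d - partial_rs_sum f g a b N c - f y * (g d - g c)) \<le> \<epsilon> * (T d - T c)" .
  qed
qed

lemma partial_rs_sum_left [simp]: "a \<le> b \<Longrightarrow> partial_rs_sum f g a b N a = 0"
  by (simp add: partial_rs_sum_def min_absorb1 grid_ge)

lemma partial_rs_sum_Cauchy:
  assumes f: "continuous_on {a..b} f" and g: "variation_majorant T g a b" and x: "x \<in> {a..b}"
  shows "Cauchy (\<lambda>N. partial_rs_sum f g a b N x)"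
proof (rule metric_CauchyI)
  fix e :: real assume "e > 0"
  let ?J = "partial_rs_sum f g a b"
  have ab: "a \<le> b" using x by simp
  define V where "V = T x - T a"
  have V: "V \<ge> 0" using variation_majorant_mono[OF g, of a x] x by (simp add: V_def)
  define \<epsilon> where "\<epsilon> = e / (2 * (V + 1))"
  have \<epsilon>: "\<epsilon> > 0" "2 * \<epsilon> * V < e" using \<open>e > 0\<close> V by (auto simp: \<epsilon>_def field_simps)
  obtain \<delta> N0 where \<delta>: "\<delta> > 0" "\<And>N c y d. N0 \<le> N \<Longrightarrow> a \<le> c \<Longrightarrow> c \<le> y \<Longrightarrow> y \<le> d \<Longrightarrow> d \<le> b \<Longrightarrow> d - c < \<delta> \<Longrightarrow>
       norm (?J N d - ?J N c - f y * (g d - g c)) \<le> \<epsilon> * (T d - T c)"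
    using partial_rs_sum_local[OF f g ab \<epsilon>(1)] by metis
  obtain L where L: "0 < L" "(x - a) / real L < \<delta>" using mesh_small[OF \<delta>(1), of x a] by (metis order_refl)
  show "\<exists>M. \<forall>m\<ge>M. \<forall>n\<ge>M. dist (?J m x) (?J n x) < e"
  proof (intro exI allI impI)
    fix m n assume mn: "m \<ge> N0" "n \<ge> N0"
    \<comment> \<open>An auxiliary partition of \<open>[a, x]\<close>, finer than \<open>\<delta>\<close>, localizes the comparison of the two sums.\<close>
    define s where "s l = grid a x L l" for l
    have ax: "a \<le> x" using x by simp
    have "norm ((?J m x - ?J n x) - (?J m a - ?J n a)) =
        norm (\<Sum>l<L. (?J m (s (Suc l)) - ?J n (s (Suc l))) - (?J m (s l) - ?J n (s l)))"
      unfolding s_def using grid_telescope[OF L(1), of "\<lambda>z. ?J m z - ?J n z" a x] by simp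
    also have "\<dots> \<le> (\<Sum>l<L. 2 * \<epsilon> * (T (s (Suc l)) - T (s l)))"
    proof (rule sum_norm_le)
      fix l assume "l \<in> {..<L}"
      then have sl: "a \<le> s l" "s l \<le> s (Suc l)" "s (Suc l) \<le> b" "s (Suc l) - s l < \<delta>"
        unfolding s_def using ax x L grid_le[OF ax, of "Suc l" L] grid_mono[OF ax, of l "Suc l" L] grid_ge[OF ax, of L l]
        by (simp_all add: grid_Suc)
      let ?R = "f (s l) * (g (s (Suc l)) - g (s l))"
      have "(?J m (s (Suc l)) - ?J n (s (Suc l))) - (?J m (s l) - ?J n (s l)) =
          (?J m (s (Suc l)) - ?J m (s l) - ?R) - (?J n (s (Suc l)) - ?J n (s l) - ?R)" by simp
      also have "norm \<dots> \<le> \<epsilon> * (T (s (Suc l)) - T (s l)) + \<epsilon> * (T (s (Suc l)) - T (s l))"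
        using sl mn by (intro order_trans[OF norm_triangle_ineq4] add_mono \<delta>(2)) auto
      finally show "norm ((?J m (s (Suc l)) - ?J n (s (Suc l))) - (?J m (s l) - ?J n (s l)))
          \<le> 2 * \<epsilon> * (T (s (Suc l)) - T (s l))" by simp
    qed
    also have "\<dots> = 2 * \<epsilon> * V"
      using grid_telescope[OF L(1), of T a x] by (simp add: s_def V_def flip: sum_distrib_left)
    also note \<epsilon>(2)
    finally show "dist (?J m x) (?J n x) < e" using ab by (simp add: dist_norm)
  qed
qed

lemma has_rs_integral_unique:
  assumes I: "has_rs_integral f g I a b" and J: "has_rs_integral f g J a b"
  shows "I = J"
proof (rule ccontr)
  assume "I \<noteq> J"
  then have e: "norm (I - J) / 2 > 0" by simp
  let ?S = "\<lambda>D. \<Sum>(x, K)\<in>D. f x * (g (Sup K) - g (Inf K))"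
  obtain d1 where d1: "d1 > 0" "\<And>D. D tagged_division_of {a..b} \<Longrightarrow> (\<forall>(x, K)\<in>D. Sup K - Inf K < d1) \<Longrightarrow>
      norm (?S D - I) < norm (I - J) / 2" using I e unfolding has_rs_integral_def by blast
  obtain d2 where d2: "d2 > 0" "\<And>D. D tagged_division_of {a..b} \<Longrightarrow> (\<forall>(x, K)\<in>D. Sup K - Inf K < d2) \<Longrightarrow>
      norm (?S D - J) < norm (I - J) / 2" using J e unfolding has_rs_integral_def by blast
  define d where "d = min d1 d2 / 2"
  have "gauge (\<lambda>x. ball x d)" using d1 d2 by (intro gauge_ball) (auto simp: d_def)
  then obtain D where D: "D tagged_division_of {a..b}" "(\<lambda>x. ball x d) fine D"
    using fine_division_exists_real by blast
  have mesh: "Sup K - Inf K < min d1 d2" if xK: "(x, K) \<in> D" for x K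
  proof -
    have "K \<subseteq> ball x d" using D(2) xK by (auto simp: fine_def)
    moreover obtain p q where "K = cbox p q" "x \<in> K"
      using tagged_division_ofD(2,4)[OF D(1) xK] by blast
    moreover from this have "K = {p..q}" "p \<le> q" by auto
    ultimately have "K = {p..q}" "p \<in> ball x d" "q \<in> ball x d" "p \<le> q"
      by (metis atLeastAtMost_iff order_refl subsetD)+
    then have "Sup K - Inf K = q - p" "\<bar>x - p\<bar> < d" "\<bar>x - q\<bar> < d" by (auto simp: dist_real_def)
    moreover have "2 * d = min d1 d2" by (simp add: d_def)
    ultimately show ?thesis by linarith
  qed
  have "norm (?S D - I) < norm (I - J) / 2" "norm (?S D - J) < norm (I - J) / 2"
    by (rule d1(2)[OF D(1)], use mesh in fastforce, rule d2(2)[OF D(1)], use mesh in fastforce)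
  moreover have "norm (I - J) \<le> norm (?S D - J) + norm (?S D - I)"
    using norm_triangle_ineq4[of "?S D - J" "?S D - I"] by simp
  ultimately show False by linarith
qed

text \<open>The limit \<open>J\<close> of the sums inherits the local estimate. Adding it up over the intervals of a fine
tagged division shows that the sums of the definition of the integral are close to \<open>J x\<close>.\<close>

lemma partial_rs_sum_tendsto:
  assumes f: "continuous_on {a..b} f" and g: "variation_majorant T g a b" and x: "x \<in> {a..b}"
  shows "(\<lambda>N. partial_rs_sum f g a b N x) \<longlonglongrightarrow> rs_integral a x f g"
proof -
  let ?J = "partial_rs_sum f g a b"
  have ab: "a \<le> b" and ax: "a \<le> x" and xb: "x \<le> b" using x by auto
  define J where "J y = lim (\<lambda>N. ?J N y)" for y
  have J: "(\<lambda>N. ?J N y) \<longlonglongrightarrow> J y" if "y \<in> {a..b}" for y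
    unfolding J_def using partial_rs_sum_Cauchy[OF f g that]
    by (simp add: Cauchy_convergent_iff convergent_LIMSEQ_iff)
  have Ja: "J a = 0" using J[of a] ab by (simp add: LIMSEQ_const_iff)
  have "has_rs_integral f g (J x) a x"
    unfolding has_rs_integral_def
  proof (intro allI impI)
    fix e :: real assume "e > 0"
    define V where "V = T x - T a"
    have V: "V \<ge> 0" using variation_majorant_mono[OF g, of a x] x by (simp add: V_def)
    define \<epsilon> where "\<epsilon> = e / (V + 1)"
    have \<epsilon>: "\<epsilon> > 0" "\<epsilon> * V < e" using \<open>e > 0\<close> V by (auto simp: \<epsilon>_def field_simps)
    obtain \<delta> N0 where \<delta>: "\<delta> > 0" "\<And>N c y d. N0 \<le> N \<Longrightarrow> a \<le> c \<Longrightarrow> c \<le> y \<Longrightarrow> y \<le> d \<Longrightarrow> d \<le> b \<Longrightarrow> d - c < \<delta> \<Longrightarrow>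
         norm (?J N d - ?J N c - f y * (g d - g c)) \<le> \<epsilon> * (T d - T c)"
      using partial_rs_sum_local[OF f g ab \<epsilon>(1)] by metis
    have loc: "norm (J d - J c - f y * (g d - g c)) \<le> \<epsilon> * (T d - T c)"
      if "a \<le> c" "c \<le> y" "y \<le> d" "d \<le> b" "d - c < \<delta>" for c y d
    proof (rule Lim_bounded)
      show "(\<lambda>N. norm (?J N d - ?J N c - f y * (g d - g c))) \<longlonglongrightarrow> norm (J d - J c - f y * (g d - g c))"
        using that by (intro tendsto_intros J) auto
      show "\<forall>n\<ge>N0. norm (?J n d - ?J n c - f y * (g d - g c)) \<le> \<epsilon> * (T d - T c)"
        using \<delta>(2) that by blast
    qed
    show "\<exists>\<delta>>0. \<forall>D. D tagged_division_of {a..x} \<longrightarrow> (\<forall>(x, K)\<in>D. Sup K - Inf K < \<delta>) \<longrightarrow>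
        norm ((\<Sum>(x, K)\<in>D. f x * (g (Sup K) - g (Inf K))) - J x) < e"
    proof (intro exI conjI allI impI, rule \<delta>(1))
      fix D assume D: "D tagged_division_of {a..x}" and mesh: "\<forall>(x, K)\<in>D. Sup K - Inf K < \<delta>"
      have JD: "J x = (\<Sum>(y, K)\<in>D. J (Sup K) - J (Inf K))"
        using additive_tagged_division_1[OF ax D, of J] Ja by simp
      have "norm ((\<Sum>(y, K)\<in>D. f y * (g (Sup K) - g (Inf K))) - J x) =
          norm (\<Sum>(y, K)\<in>D. J (Sup K) - J (Inf K) - f y * (g (Sup K) - g (Inf K)))"
        unfolding JD by (subst norm_minus_commute) (simp add: case_prod_unfold sum_subtractf)
      also have "\<dots> \<le> (\<Sum>(y, K)\<in>D. \<epsilon> * (T (Sup K) - T (Inf K)))"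
        unfolding case_prod_unfold
      proof (rule sum_norm_le)
        fix z assume z: "z \<in> D"
        obtain y K where zyK: "z = (y, K)" by (cases z)
        obtain p q where pq: "K = cbox p q" "y \<in> K" "K \<subseteq> {a..x}"
          using tagged_division_ofD(2,3,4)[OF D, of y K] z zyK by blast
        moreover have "p \<le> q" using pq by auto
        ultimately have "Inf K = p" "Sup K = q" "a \<le> p" "p \<le> y" "y \<le> q" "q \<le> b" using xb by auto
        moreover have "Sup K - Inf K < \<delta>" using mesh z zyK by auto
        ultimately show "norm (J (Sup (snd z)) - J (Inf (snd z)) - f (fst z) * (g (Sup (snd z)) - g (Inf (snd z))))
            \<le> \<epsilon> * (T (Sup (snd z)) - T (Inf (snd z)))"
          using loc[of p y q] zyK by simp
      qed
      also have "\<dots> = \<epsilon> * V"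
        using additive_tagged_division_1[OF ax D, of T]
        by (simp add: V_def case_prod_unfold flip: sum_distrib_left)
      also note \<epsilon>(2)
      finally show "norm ((\<Sum>(x, K)\<in>D. f x * (g (Sup K) - g (Inf K))) - J x) < e" .
    qed
  qed
  then have "rs_integral a x f g = J x"
    unfolding rs_integral_def using has_rs_integral_unique by blast
  then show ?thesis using J[OF x] by simp
qed

definition rs_sum :: "(real \<Rightarrow> complex) \<Rightarrow> (real \<Rightarrow> complex) \<Rightarrow> real \<Rightarrow> real \<Rightarrow> nat \<Rightarrow> complex" where
  "rs_sum f g a b N = (\<Sum>k<N. f (grid a b N k) * (g (grid a b N (Suc k)) - g (grid a b N k)))"

lemma rs_sum_tendsto:
  assumes f: "continuous_on {a..b} f" and g: "variation_majorant T g a b" and ab: "a \<le> b"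
  shows "rs_sum f g a b \<longlonglongrightarrow> rs_integral a b f g"
proof -
  have "partial_rs_sum f g a b N b = rs_sum f g a b N" for N
    unfolding partial_rs_sum_def rs_sum_def
    using ab by (intro sum.cong refl) (simp add: min_absorb2 grid_le)
  then show ?thesis using partial_rs_sum_tendsto[OF f g, of b] ab by simp
qed

lemma rs_sum_bound:
  assumes g: "variation_majorant T g a b" and ab: "a \<le> b" and B: "0 \<le> B"
    and f: "\<And>x. x \<in> {a..b} \<Longrightarrow> norm (f x) \<le> B"
  shows "norm (rs_sum f g a b N) \<le> B * (T b - T a)"
proof (cases "N = 0")
  case True
  then show ?thesis using variation_majorant_mono[OF g, of a b] ab B by (simp add: rs_sum_def)
next
  case False
  have "norm (rs_sum f g a b N) \<le> (\<Sum>k<N. B * (T (grid a b N (Suc k)) - T (grid a b N k)))"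
    unfolding rs_sum_def
  proof (rule sum_norm_le)
    fix k assume "k \<in> {..<N}"
    then have "grid a b N k \<in> {a..b}" "grid a b N (Suc k) \<le> b" "grid a b N k \<le> grid a b N (Suc k)"
      using ab by (auto simp: grid_ge grid_le grid_mono)
    then show "norm (f (grid a b N k) * (g (grid a b N (Suc k)) - g (grid a b N k))) \<le> B * (T (grid a b N (Suc k)) - T (grid a b N k))"
      unfolding norm_mult using B by (intro mult_mono f variation_majorantD[OF g]) auto
  qed
  also have "\<dots> = B * (T b - T a)"
    using grid_telescope[of N T a b] False by (simp flip: sum_distrib_left)
  finally show ?thesis .
qed

lemma rs_integral_bound:
  assumes f: "continuous_on {a..b} f" and g: "variation_majorant T g a b" and ab: "a \<le> b" and B: "0 \<le> B"
    and fB: "\<And>x. x \<in> {a..b} \<Longrightarrow> norm (f x) \<le> B"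
  shows "norm (rs_integral a b f g) \<le> B * (T b - T a)"
proof (rule Lim_bounded[OF tendsto_norm[OF rs_sum_tendsto[OF f g ab]]])
  show "\<forall>N\<ge>0. norm (rs_sum f g a b N) \<le> B * (T b - T a)" using rs_sum_bound[OF g ab B fB] by simp
qed

lemma rs_integral_add:
  assumes f: "continuous_on {a..b} f" and h: "continuous_on {a..b} h"
    and g: "variation_majorant T g a b" and ab: "a \<le> b"
  shows "rs_integral a b (\<lambda>x. f x + h x) g = rs_integral a b f g + rs_integral a b h g"
proof (rule LIMSEQ_unique[OF rs_sum_tendsto[OF _ g ab]])
  show "continuous_on {a..b} (\<lambda>x. f x + h x)" by (intro continuous_intros f h)
  have "rs_sum (\<lambda>x. f x + h x) g a b = (\<lambda>N. rs_sum f g a b N + rs_sum h g a b N)"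
    by (simp add: rs_sum_def distrib_right sum.distrib fun_eq_iff)
  then show "rs_sum (\<lambda>x. f x + h x) g a b \<longlonglongrightarrow> rs_integral a b f g + rs_integral a b h g"
    using tendsto_add[OF rs_sum_tendsto[OF f g ab] rs_sum_tendsto[OF h g ab]] by simp
qed

lemma rs_integral_cmult:
  assumes f: "continuous_on {a..b} f"
    and g: "variation_majorant T g a b" and ab: "a \<le> b"
  shows "rs_integral a b (\<lambda>x. c * f x) g = c * rs_integral a b f g"
proof (rule LIMSEQ_unique[OF rs_sum_tendsto[OF _ g ab]])
  show "continuous_on {a..b} (\<lambda>x. c * f x)" by (intro continuous_intros f)
  have "rs_sum (\<lambda>x. c * f x) g a b = (\<lambda>N. c * rs_sum f g a b N)"
    by (simp add: rs_sum_def mult.assoc sum_distrib_left fun_eq_iff)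
  then show "rs_sum (\<lambda>x. c * f x) g a b \<longlonglongrightarrow> c * rs_integral a b f g"
    using tendsto_mult_left[OF rs_sum_tendsto[OF f g ab], of c] by simp
qed

lemma rs_integral_cong:
  assumes "\<And>x. x \<in> {a..b} \<Longrightarrow> f x = h x"
  shows "rs_integral a b f g = rs_integral a b h g"
proof -
  have "(\<Sum>(x, K)\<in>D. f x * (g (Sup K) - g (Inf K))) = (\<Sum>(x, K)\<in>D. h x * (g (Sup K) - g (Inf K)))"
    if "D tagged_division_of {a..b}" for D
  proof (intro sum.cong refl, clarify)
    fix x K assume "(x, K) \<in> D"
    then have "x \<in> {a..b}" using tagged_division_ofD(2,3)[OF that] by blast
    then show "f x * (g (Sup K) - g (Inf K)) = h x * (g (Sup K) - g (Inf K))" using assms by simp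
  qed
  then have "has_rs_integral f g I a b = has_rs_integral h g I a b" for I
    unfolding has_rs_integral_def by simp
  then show ?thesis unfolding rs_integral_def by simp
qed

section \<open>Spaces of p-integrable functions\<close>

lemma LpD: "f \<in> Lp p M \<Longrightarrow> f \<in> borel_measurable M" "f \<in> Lp p M \<Longrightarrow> integrable M (\<lambda>x. norm (f x) powr p)"
  by (auto simp: Lp_def)

lemma LpI: "f \<in> borel_measurable M \<Longrightarrow> integrable M (\<lambda>x. norm (f x) powr p) \<Longrightarrow> f \<in> Lp p M"
  by (auto simp: Lp_def)

lemma Lp_dominated:
  assumes "g \<in> Lp p M" "f \<in> borel_measurable M" "0 \<le> p" "\<And>x. x \<in> space M \<Longrightarrow> norm (f x) \<le> norm (g x)"
  shows "f \<in> Lp p M" "Lp_seminorm p M f \<le> Lp_seminorm p M g"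
proof -
  show f: "f \<in> Lp p M"
  proof (rule LpI[OF assms(2)], rule Bochner_Integration.integrable_bound[OF LpD(2)[OF assms(1)]])
    show "(\<lambda>x. norm (f x) powr p) \<in> borel_measurable M" using assms(2) by measurable
    show "AE x in M. norm (norm (f x) powr p) \<le> norm (norm (g x) powr p)"
      using assms by (intro AE_I2) (auto intro!: powr_mono2)
  qed
  show "Lp_seminorm p M f \<le> Lp_seminorm p M g"
    unfolding Lp_seminorm_def
    using assms LpD(2)[OF f] LpD(2)[OF assms(1)]
    by (intro powr_mono2 integral_mono) (auto intro!: powr_mono2)
qed

lemma powr_add_le:
  fixes x y p :: real
  assumes "0 \<le> x" "0 \<le> y" "0 \<le> p"
  shows "(x + y) powr p \<le> 2 powr p * (x powr p + y powr p)"
proof -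
  have "(x + y) powr p \<le> (2 * max x y) powr p" using assms by (intro powr_mono2) auto
  also have "\<dots> = 2 powr p * max x y powr p" using assms by (simp add: powr_mult)
  also have "\<dots> \<le> 2 powr p * (x powr p + y powr p)"
    by (intro mult_left_mono) (auto simp: max_def)
  finally show ?thesis .
qed

lemma Lp_add:
  assumes f: "f \<in> Lp p M" and g: "g \<in> Lp p M" and p: "0 \<le> p"
  shows "(\<lambda>x. f x + g x) \<in> Lp p M"
    and "(LINT x|M. norm (f x + g x) powr p) \<le>
      2 powr p * ((LINT x|M. norm (f x) powr p) + (LINT x|M. norm (g x) powr p))"
proof -
  note [measurable] = LpD(1)[OF f] LpD(1)[OF g]
  note int = LpD(2)[OF f] LpD(2)[OF g]
  have b: "norm (f x + g x) powr p \<le> 2 powr p * (norm (f x) powr p + norm (g x) powr p)" for x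
    using p by (intro order_trans[OF powr_mono2[OF _ _ norm_triangle_ineq] powr_add_le]) auto
  have i: "integrable M (\<lambda>x. norm (f x + g x) powr p)"
    by (rule Bochner_Integration.integrable_bound[where f="\<lambda>x. 2 powr p * (norm (f x) powr p + norm (g x) powr p)"])
       (use int b in \<open>auto intro!: order_trans[OF b]\<close>)
  then show "(\<lambda>x. f x + g x) \<in> Lp p M" by (intro LpI) measurable
  have "(LINT x|M. norm (f x + g x) powr p) \<le> (LINT x|M. 2 powr p * (norm (f x) powr p + norm (g x) powr p))"
    using int i b by (intro integral_mono) auto
  then show "(LINT x|M. norm (f x + g x) powr p) \<le>
      2 powr p * ((LINT x|M. norm (f x) powr p) + (LINT x|M. norm (g x) powr p))"
    using int by simp
qed

lemma Lp_linear_image: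
  fixes T :: "'a::euclidean_space \<Rightarrow> 'b::euclidean_space"
  assumes f: "f \<in> Lp p M" and p: "0 \<le> p" and T: "linear T"
  shows "(\<lambda>x. T (f x)) \<in> Lp p M"
proof -
  obtain B where B: "B > 0" "\<And>x. norm (T x) \<le> B * norm x" using linear_bounded_pos[OF T] by blast
  note [measurable] = LpD(1)[OF f]
  have m: "(\<lambda>x. T (f x)) \<in> borel_measurable M"
    using borel_measurable_continuous_on[OF linear_continuous_on LpD(1)[OF f]] T
    unfolding linear_conv_bounded_linear by blast
  have "(\<lambda>x. B *\<^sub>R f x) \<in> Lp p M"
    by (rule LpI) (use LpD(2)[OF f] B(1) in \<open>auto simp: powr_mult\<close>)
  then show ?thesis
    by (rule Lp_dominated(1)[OF _ m p]) (use B in \<open>auto simp: abs_of_pos\<close>)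
qed

lemma Lp_diff:
  assumes f: "f \<in> Lp p M" and g: "g \<in> Lp p M" and p: "0 \<le> p"
  shows "(\<lambda>x. f x - g x) \<in> Lp p M"
  using Lp_add(1)[OF f Lp_linear_image[OF g p linear_uminus] p] by simp

lemma Lp_seminorm_nonneg [simp]: "0 \<le> Lp_seminorm p M f"
  by (simp add: Lp_seminorm_def)

lemma Lp_seminorm_powr:
  assumes "p > 0"
  shows "Lp_seminorm p M f powr p = (LINT x|M. norm (f x) powr p)"
  using assms by (simp add: Lp_seminorm_def powr_powr integral_nonneg_AE)

text \<open>Young's inequality for the normalized functions, integrated.\<close>

lemma Holder_inequality:
  fixes f g :: "real \<Rightarrow> complex"
  assumes p: "1 < p" "1 < q" "1 / p + 1 / q = 1"
    and f: "f \<in> Lp p M" and g: "g \<in> Lp q M"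
  shows "integrable M (\<lambda>x. f x * g x)"
    and "norm (LINT x|M. f x * g x) \<le> Lp_seminorm p M f * Lp_seminorm q M g"
proof -
  note [measurable] = LpD(1)[OF f] LpD(1)[OF g]
  note int = LpD(2)[OF f] LpD(2)[OF g]
  have m: "(\<lambda>x. f x * g x) \<in> borel_measurable M" by measurable
  have young: "norm (f x * g x) \<le> norm (f x) powr p / p + norm (g x) powr q / q" for x
    unfolding norm_mult using p by (intro Youngs_inequality) auto
  show i: "integrable M (\<lambda>x. f x * g x)"
    by (rule Bochner_Integration.integrable_bound[where f="\<lambda>x. norm (f x) powr p / p + norm (g x) powr q / q", OF _ m])
       (use int young in \<open>auto intro!: order_trans[OF young]\<close>)
  have inorm: "integrable M (\<lambda>x. norm (f x * g x))" by (rule integrable_norm[OF i])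
  define A B where "A = Lp_seminorm p M f" and "B = Lp_seminorm q M g"
  have A: "A \<ge> 0" "A powr p = (LINT x|M. norm (f x) powr p)" and B: "B \<ge> 0" "B powr q = (LINT x|M. norm (g x) powr q)"
    using p by (auto simp: A_def B_def Lp_seminorm_powr)
  have "norm (LINT x|M. f x * g x) \<le> A * B"
  proof (cases "A = 0 \<or> B = 0")
    case True
    then have "(AE x in M. norm (f x) powr p = 0) \<or> (AE x in M. norm (g x) powr q = 0)"
      using A B p int integral_nonneg_eq_0_iff_AE[of M "\<lambda>x. norm (f x) powr p"]
        integral_nonneg_eq_0_iff_AE[of M "\<lambda>x. norm (g x) powr q"] by auto
    then have "AE x in M. f x * g x = 0" by (auto elim: eventually_mono)
    then have "(LINT x|M. f x * g x) = 0" by (rule integral_eq_zero_AE)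
    then show ?thesis using A B by simp
  next
    case False
    then have AB: "A > 0" "B > 0" using A B by auto
    have pt: "norm (f x * g x) \<le> A * B * (norm (f x) powr p / (A powr p * p) + norm (g x) powr q / (B powr q * q))" for x
    proof -
      have "norm (f x) / A * (norm (g x) / B) \<le> (norm (f x) / A) powr p / p + (norm (g x) / B) powr q / q"
        using p AB by (intro Youngs_inequality) auto
      then show ?thesis using AB by (simp add: norm_mult powr_divide field_simps)
    qed
    have "norm (LINT x|M. f x * g x) \<le> (LINT x|M. norm (f x * g x))" by (rule integral_norm_bound)
    also have "\<dots> \<le> (LINT x|M. A * B * (norm (f x) powr p / (A powr p * p) + norm (g x) powr q / (B powr q * q)))"
      by (rule integral_mono[OF inorm _ pt]) (use int in auto)
    also have "\<dots> = A * B * (A powr p / (A powr p * p) + B powr q / (B powr q * q))"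
      using int by (simp add: A(2) B(2))
    also have "\<dots> = A * B * (1 / p + 1 / q)" using AB by simp
    also have "\<dots> = A * B" using p by simp
    finally show ?thesis .
  qed
  then show "norm (LINT x|M. f x * g x) \<le> Lp_seminorm p M f * Lp_seminorm q M g"
    by (simp add: A_def B_def)
qed

definition zero_ext :: "real set \<Rightarrow> (real \<Rightarrow> 'a::zero) \<Rightarrow> real \<Rightarrow> 'a" where
  "zero_ext S f x = (if x \<in> S then f x else 0)"

lemma Lp_zero_ext:
  fixes f :: "real \<Rightarrow> 'a::euclidean_space"
  assumes S: "S \<in> sets lebesgue" and f: "f \<in> Lp p (lebesgue_on S)"
  shows "zero_ext S f \<in> Lp p lebesgue"
    and "Lp_seminorm p lebesgue (zero_ext S f) = Lp_seminorm p (lebesgue_on S) f"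
proof -
  have e: "norm (zero_ext S f x) powr p = (if x \<in> S then norm (f x) powr p else 0)" for x
    by (simp add: zero_ext_def)
  show "zero_ext S f \<in> Lp p lebesgue"
  proof (rule LpI)
    show "zero_ext S f \<in> borel_measurable lebesgue"
      using borel_measurable_if_I[OF LpD(1)[OF f] S] by (simp add: zero_ext_def[abs_def])
    show "integrable lebesgue (\<lambda>x. norm (zero_ext S f x) powr p)"
      unfolding e using LpD(2)[OF f] by (subst Lebesgue_Measure.integrable_restrict_UNIV[OF S])
  qed
  show "Lp_seminorm p lebesgue (zero_ext S f) = Lp_seminorm p (lebesgue_on S) f"
    unfolding Lp_seminorm_def e using S by (subst Lebesgue_Measure.integral_restrict_UNIV) auto
qed

lemma Lp_zero_ext_iff:
  fixes f :: "real \<Rightarrow> 'a::euclidean_space"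
  assumes S: "S \<in> sets lebesgue"
  shows "zero_ext S f \<in> Lp p lebesgue \<longleftrightarrow> f \<in> Lp p (lebesgue_on S)"
proof
  assume z: "zero_ext S f \<in> Lp p lebesgue"
  have e: "norm (zero_ext S f x) powr p = (if x \<in> S then norm (f x) powr p else 0)" for x
    by (simp add: zero_ext_def)
  have "f \<in> borel_measurable (lebesgue_on S)"
    by (rule borel_measurable_if_D) (use LpD(1)[OF z] in \<open>simp only: zero_ext_def[abs_def]\<close>)
  moreover have "integrable (lebesgue_on S) (\<lambda>x. norm (f x) powr p)"
    using LpD(2)[OF z] unfolding e by (subst (asm) Lebesgue_Measure.integrable_restrict_UNIV[OF S])
  ultimately show "f \<in> Lp p (lebesgue_on S)" by (rule LpI)
qed (rule Lp_zero_ext[OF S])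

lemma Lp_affine:
  fixes f :: "real \<Rightarrow> 'a::euclidean_space"
  assumes f: "f \<in> Lp p lebesgue" and c: "\<bar>c\<bar> = 1"
  shows "(\<lambda>s. f (t + c * s)) \<in> Lp p lebesgue"
    and "Lp_seminorm p lebesgue (\<lambda>s. f (t + c * s)) = Lp_seminorm p lebesgue f"
proof -
  have c0: "c \<noteq> 0" using c by auto
  show "(\<lambda>s. f (t + c * s)) \<in> Lp p lebesgue"
    using borel_measurable_affine[OF LpD(1)[OF f] c0, of t] lebesgue_integrable_real_affine[OF LpD(2)[OF f] c0, of t]
    by (intro LpI) auto
  show "Lp_seminorm p lebesgue (\<lambda>s. f (t + c * s)) = Lp_seminorm p lebesgue f"
    using lebesgue_integral_real_affine[OF c0, of "\<lambda>s. norm (f s) powr p" t] c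
    by (simp add: Lp_seminorm_def)
qed

lemma nn_integral_leb_dirac:
  assumes S: "S \<in> sets lebesgue" "0 \<in> S" and f: "f \<in> borel_measurable (lebesgue_on S)"
  shows "(\<integral>\<^sup>+x. f x \<partial>leb_dirac S) = (\<integral>\<^sup>+x. f x \<partial>lebesgue_on S) + f 0"
  using f
proof (induction rule: borel_measurable_induct)
  case (cong f g)
  have "(\<integral>\<^sup>+x. f x \<partial>leb_dirac S) = (\<integral>\<^sup>+x. g x \<partial>leb_dirac S)"
    using cong(3) by (intro nn_integral_cong) simp
  moreover have "(\<integral>\<^sup>+x. f x \<partial>lebesgue_on S) = (\<integral>\<^sup>+x. g x \<partial>lebesgue_on S)"
    using cong(3) by (intro nn_integral_cong) simp
  ultimately show ?case using cong S(2) by simp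
next
  case (set A)
  then show ?case by (simp add: emeasure_leb_dirac)
next
  case (mult u c)
  then have "u \<in> borel_measurable (leb_dirac S)" by (simp cong: measurable_cong_sets)
  then show ?case using mult by (simp add: nn_integral_cmult distrib_left)
next
  case (add u v)
  then have "u \<in> borel_measurable (leb_dirac S)" "v \<in> borel_measurable (leb_dirac S)"
    by (simp_all cong: measurable_cong_sets)
  then show ?case using add by (simp add: nn_integral_add ac_simps)
next
  case (seq U)
  then have m: "U i \<in> borel_measurable (leb_dirac S)" for i by (simp cong: measurable_cong_sets)
  have inc: "incseq (\<lambda>i. \<integral>\<^sup>+x. U i x \<partial>lebesgue_on S)" "incseq (\<lambda>i. U i 0)"
    using seq(3) by (auto simp: incseq_def le_fun_def intro!: nn_integral_mono)
  have "(\<integral>\<^sup>+x. (SUP i. U i) x \<partial>leb_dirac S) = (SUP i. \<integral>\<^sup>+x. U i x \<partial>leb_dirac S)"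
    using seq(3) m by (simp add: nn_integral_monotone_convergence_SUP image_comp)
  also have "\<dots> = (SUP i. (\<integral>\<^sup>+x. U i x \<partial>lebesgue_on S) + U i 0)" by (simp add: seq.IH)
  also have "\<dots> = (SUP i. \<integral>\<^sup>+x. U i x \<partial>lebesgue_on S) + (SUP i. U i 0)"
    by (rule ennreal_SUP_add[OF inc])
  also have "(SUP i. \<integral>\<^sup>+x. U i x \<partial>lebesgue_on S) = (\<integral>\<^sup>+x. (SUP i. U i) x \<partial>lebesgue_on S)"
    using seq by (simp add: nn_integral_monotone_convergence_SUP image_comp)
  finally show ?case by (simp add: image_comp)
qed

lemma
  fixes f :: "real \<Rightarrow> real"
  assumes S: "S \<in> sets lebesgue" "0 \<in> S" and f0: "\<And>x. 0 \<le> f x"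
  shows integrable_leb_dirac: "integrable (leb_dirac S) f \<longleftrightarrow> integrable (lebesgue_on S) f"
    and integral_leb_dirac: "integrable (lebesgue_on S) f \<Longrightarrow>
      (LINT x|leb_dirac S. f x) = (LINT x|lebesgue_on S. f x) + f 0"
proof -
  have m: "f \<in> borel_measurable (leb_dirac S) \<longleftrightarrow> f \<in> borel_measurable (lebesgue_on S)"
    by (simp cong: measurable_cong_sets)
  show "integrable (leb_dirac S) f \<longleftrightarrow> integrable (lebesgue_on S) f"
    unfolding integrable_iff_bounded m
    using S f0 by (auto simp: nn_integral_leb_dirac)
  assume i: "integrable (lebesgue_on S) f"
  then have "f \<in> borel_measurable (lebesgue_on S)" by auto
  then have "enn2real (\<integral>\<^sup>+x. ennreal (f x) \<partial>leb_dirac S) = enn2real (\<integral>\<^sup>+x. ennreal (f x) \<partial>lebesgue_on S) + f 0"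
    using i f0 by (subst nn_integral_leb_dirac[OF S]) (auto simp: nn_integral_eq_integral integral_nonneg_AE simp flip: ennreal_plus)
  then show "(LINT x|leb_dirac S. f x) = (LINT x|lebesgue_on S. f x) + f 0"
    using i f0 m by (simp add: integral_eq_nn_integral)
qed

lemma Lp_leb_dirac_iff:
  fixes f :: "real \<Rightarrow> 'a::euclidean_space"
  assumes "S \<in> sets lebesgue" "0 \<in> S"
  shows "f \<in> Lp p (leb_dirac S) \<longleftrightarrow> f \<in> Lp p (lebesgue_on S)"
  unfolding Lp_def using integrable_leb_dirac[OF assms, of "\<lambda>x. norm (f x) powr p"]
  by (simp cong: measurable_cong_sets)

text \<open>Both parts of the measure contribute nonnegative summands to the \<open>p\<close>-th power of the seminorm.\<close>

lemma Lp_seminorm_leb_dirac: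
  fixes f :: "real \<Rightarrow> 'a::euclidean_space"
  assumes S: "S \<in> sets lebesgue" "0 \<in> S" and p: "0 < p" and f: "f \<in> Lp p (lebesgue_on S)"
  shows "Lp_seminorm p (lebesgue_on S) f \<le> Lp_seminorm p (leb_dirac S) f"
    and "norm (f 0) \<le> Lp_seminorm p (leb_dirac S) f"
proof -
  have e: "(LINT x|leb_dirac S. norm (f x) powr p) = (LINT x|lebesgue_on S. norm (f x) powr p) + norm (f 0) powr p"
    by (intro integral_leb_dirac S LpD(2)[OF f]) auto
  have n: "0 \<le> (LINT x|lebesgue_on S. norm (f x) powr p)" by (intro integral_nonneg_AE) auto
  show "Lp_seminorm p (lebesgue_on S) f \<le> Lp_seminorm p (leb_dirac S) f"
    unfolding Lp_seminorm_def e using n p by (intro powr_mono2) auto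
  have "norm (f 0) = (norm (f 0) powr p) powr (1/p)" using p by (simp add: powr_powr)
  also have "\<dots> \<le> Lp_seminorm p (leb_dirac S) f"
    unfolding Lp_seminorm_def e using n p by (intro powr_mono2) auto
  finally show "norm (f 0) \<le> Lp_seminorm p (leb_dirac S) f" .
qed

section \<open>Density of the continuous functions\<close>

lemma bounded_measurable_Lp:
  fixes f :: "real \<Rightarrow> 'a::euclidean_space"
  assumes M: "finite_measure M" and f: "f \<in> borel_measurable M" and p: "0 \<le> p"
    and K: "\<And>x. x \<in> space M \<Longrightarrow> norm (f x) \<le> K"
  shows "f \<in> Lp p M"
proof (rule LpI[OF f])
  have "norm (norm (f x) powr p) \<le> K powr p" if "x \<in> space M" for x
    using p K[OF that] by (simp add: powr_mono2)
  then show "integrable M (\<lambda>x. norm (f x) powr p)"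
    using f by (intro finite_measure.integrable_const_bound[OF M, of _ "K powr p"]) auto
qed

lemma finite_measure_lebesgue_on_Icc: "finite_measure (lebesgue_on {a..b::real})"
  by (rule finite_measure_lebesgue_on) auto

lemma finite_measure_leb_dirac:
  assumes "0 \<in> {a..b}" shows "finite_measure (leb_dirac {a..b})"
proof (rule finite_measureI)
  have "emeasure (lebesgue_on {a..b}) {a..b} \<noteq> \<infinity>"
    using finite_measure.emeasure_finite[OF finite_measure_lebesgue_on_Icc[of a b], of "{a..b}"] by simp
  then show "emeasure (leb_dirac {a..b}) (space (leb_dirac {a..b})) \<noteq> \<infinity>"
    by (simp add: emeasure_leb_dirac indicator_def)
qed

lemma continuous_on_imp_Lp:
  fixes f :: "real \<Rightarrow> 'a::euclidean_space"
  assumes f: "continuous_on {a..b} f" and "0 \<in> {a..b}" and p: "0 \<le> p"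
  shows "f \<in> Lp p (leb_dirac {a..b})"
proof -
  obtain K where K: "\<And>x. x \<in> {a..b} \<Longrightarrow> norm (f x) \<le> K"
    using compact_imp_bounded[OF compact_continuous_image[OF f compact_Icc]] unfolding bounded_iff by blast
  have "f \<in> borel_measurable (lebesgue_on {a..b})"
    by (rule continuous_imp_measurable_on_sets_lebesgue[OF f]) auto
  then show ?thesis
    using K p by (intro bounded_measurable_Lp[OF finite_measure_leb_dirac[OF assms(2)], of _ _ K])
      (simp_all cong: measurable_cong_sets)
qed

text \<open>A measurable function is almost everywhere a limit of continuous functions. Clipping them to the
bound of \<open>f\<close> permits dominated convergence for the Lebesgue part of the measure; a correction by a
hat function of shrinking support enforces the exact value at \<open>0\<close>, where the Dirac part sits.\<close>

lemma continuous_dense_bounded: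
  fixes f :: "real \<Rightarrow> 'a::euclidean_space"
  assumes f: "f \<in> borel_measurable (lebesgue_on {a..b})" and 0: "0 \<in> {a..b}" and p: "0 < p"
    and K: "K > 0" "\<And>x. x \<in> {a..b} \<Longrightarrow> norm (f x) \<le> K"
  obtains g where "\<And>n. continuous_on UNIV (g n)"
    "(\<lambda>n::nat. LINT x|leb_dirac {a..b}. norm (g n x - f x) powr p) \<longlonglongrightarrow> 0"
proof -
  let ?S = "{a..b}"
  have S: "?S \<in> sets lebesgue" by simp
  obtain N h where N: "negligible N" and h: "\<And>n. continuous_on UNIV (h n)"
    and lim: "\<And>x. x \<notin> N \<Longrightarrow> (\<lambda>n. h n x) \<longlonglongrightarrow> (if x \<in> ?S then f x else 0)"
    using f measurable_on_iff_borel_measurable[OF S, of f] unfolding measurable_on_def by metis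
  define c where "c y = (K / max K (norm y)) *\<^sub>R y" for y :: 'a
  have c_cont: "continuous_on A c" for A
    unfolding c_def using K(1) by (intro continuous_intros) auto
  have c_le: "norm (c y) \<le> K" for y
    using K(1) by (cases "norm y \<le> K") (auto simp: c_def max_def)
  have c_id: "c y = y" if "norm y \<le> K" for y
    using that K(1) by (auto simp: c_def max_def)
  define g where "g n x = c (h n x) + max 0 (1 - real n * \<bar>x\<bar>) *\<^sub>R (f 0 - c (h n 0))" for n x
  have g_cont: "continuous_on UNIV (g n)" for n
    unfolding g_def using h
    by (intro continuous_intros continuous_on_compose2[OF c_cont[of UNIV] h]) auto
  have g0: "g n 0 = f 0" for n by (simp add: g_def)
  have g_le: "norm (g n x) \<le> 3 * K" for n x
  proof -
    have "max 0 (1 - real n * \<bar>x\<bar>) * norm (f 0 - c (h n 0)) \<le> 1 * (K + K)"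
      using c_le[of "h n 0"] K(2)[OF 0]
      by (intro mult_mono order_trans[OF norm_triangle_ineq4]) auto
    then show ?thesis
      unfolding g_def using c_le[of "h n x"] by (intro order_trans[OF norm_triangle_ineq]) auto
  qed
  have g_lim: "(\<lambda>n. g n x) \<longlonglongrightarrow> f x" if "x \<in> ?S - N" "x \<noteq> 0" for x
  proof -
    have "(\<lambda>n. h n x) \<longlonglongrightarrow> f x" using lim[of x] that by simp
    then have "(\<lambda>n. c (h n x)) \<longlonglongrightarrow> c (f x)"
      using c_cont[of UNIV] by (simp add: continuous_on_def isCont_tendsto_compose[of _ c] continuous_at)
    moreover have "c (f x) = f x" using K(2) that by (intro c_id) auto
    moreover obtain m :: nat where m: "1 / \<bar>x\<bar> < real m" using reals_Archimedean2 by blast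
    have "\<forall>\<^sub>F n in sequentially. c (h n x) = g n x"
      using eventually_ge_at_top[of m]
    proof eventually_elim
      case (elim n)
      then have "1 / \<bar>x\<bar> < real n" using m by linarith
      then have "1 - real n * \<bar>x\<bar> < 0" using that by (simp add: field_simps)
      then show ?case by (simp add: g_def)
    qed
    ultimately show ?thesis by (auto intro: Lim_transform_eventually)
  qed
  have g_m: "g n \<in> borel_measurable (lebesgue_on ?S)" for n
    by (rule continuous_imp_measurable_on_sets_lebesgue[OF continuous_on_subset[OF g_cont]]) auto
  have d_le: "norm (g n x - f x) powr p \<le> (4 * K) powr p" if "x \<in> ?S" for n x
    using p g_le[of n x] K(2)[OF that] by (intro powr_mono2 order_trans[OF norm_triangle_ineq4]) auto
  have d_m: "(\<lambda>x. norm (g n x - f x) powr p) \<in> borel_measurable (lebesgue_on ?S)" for n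
    using g_m f by measurable
  have d_i: "integrable (lebesgue_on ?S) (\<lambda>x. norm (g n x - f x) powr p)" for n
    using d_m d_le by (intro finite_measure.integrable_const_bound[OF finite_measure_lebesgue_on_Icc, of _ "(4*K) powr p"]) auto
  have "(\<lambda>n. LINT x|lebesgue_on ?S. norm (g n x - f x) powr p) \<longlonglongrightarrow> (LINT x|lebesgue_on ?S. 0)"
  proof (rule integral_dominated_convergence[where w="\<lambda>_. (4*K) powr p"])
    show "integrable (lebesgue_on ?S) (\<lambda>_. (4*K) powr p)"
      using finite_measure.integrable_const[OF finite_measure_lebesgue_on_Icc] by blast
    have "N \<union> {0} \<in> null_sets lebesgue" using N by (simp add: negligible_iff_null_sets[symmetric])
    then have "AE x in lebesgue. x \<notin> N \<union> {0}" by (rule AE_not_in)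
    then have "AE x in lebesgue_on ?S. x \<notin> N \<union> {0}"
      by (subst AE_restrict_space_iff) (auto elim: eventually_mono)
    then show "AE x in lebesgue_on ?S. (\<lambda>n. norm (g n x - f x) powr p) \<longlonglongrightarrow> 0"
    proof (rule AE_mp, intro AE_I2 impI)
      fix x assume "x \<in> space (lebesgue_on ?S)" "x \<notin> N \<union> {0}"
      then have "(\<lambda>n. g n x - f x) \<longlonglongrightarrow> 0" using g_lim[of x] by (simp add: LIM_zero)
      then show "(\<lambda>n. norm (g n x - f x) powr p) \<longlonglongrightarrow> 0"
        using p by (intro tendsto_zero_powrI[of _ _ _ p] tendsto_norm_zero tendsto_const) auto
    qed
    show "AE x in lebesgue_on ?S. norm (norm (g n x - f x) powr p) \<le> (4*K) powr p" for n
      using d_le by (intro AE_I2) auto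
  qed (use d_m in auto)
  moreover have "(LINT x|leb_dirac ?S. norm (g n x - f x) powr p) = (LINT x|lebesgue_on ?S. norm (g n x - f x) powr p)" for n
    using p by (subst integral_leb_dirac[OF S 0 _ d_i]) (auto simp: g0)
  ultimately show ?thesis using g_cont by (intro that[of g]) auto
qed

text \<open>Truncation of \<open>f\<close> at a high level reduces this to bounded functions.\<close>

lemma continuous_dense_Lp:
  fixes f :: "real \<Rightarrow> 'a::euclidean_space"
  assumes f: "f \<in> Lp p (leb_dirac {a..b})" and 0: "0 \<in> {a..b}" and p: "0 < p" and e: "0 < e"
  obtains g where "continuous_on UNIV g"
    "(LINT x|leb_dirac {a..b}. norm (g x - f x) powr p) < e"
proof -
  let ?M = "leb_dirac {a..b}"
  note [measurable] = LpD(1)[OF f]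
  define t where "t k x = (if norm (f x) \<le> real k then f x else 0)" for k x
  have t_m: "t k \<in> borel_measurable ?M" for k unfolding t_def by measurable
  have "(\<lambda>k. LINT x|?M. norm (t k x - f x) powr p) \<longlonglongrightarrow> (LINT x|?M. 0)"
  proof (rule integral_dominated_convergence[where w="\<lambda>x. norm (f x) powr p"])
    show "AE x in ?M. (\<lambda>k. norm (t k x - f x) powr p) \<longlonglongrightarrow> 0"
    proof (intro AE_I2)
      fix x
      obtain m :: nat where m: "norm (f x) \<le> real m" using real_arch_simple by blast
      have "\<forall>\<^sub>F k in sequentially. norm (t k x - f x) powr p = 0"
        using eventually_ge_at_top[of m] by eventually_elim (use m p in \<open>auto simp: t_def\<close>)
      then show "(\<lambda>k. norm (t k x - f x) powr p) \<longlonglongrightarrow> 0" by (rule tendsto_eventually)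
    qed
    show "AE x in ?M. norm (norm (t k x - f x) powr p) \<le> norm (f x) powr p" for k
      by (intro AE_I2) (auto simp: t_def)
  qed (use LpD(2)[OF f] t_m in auto)
  then have "\<forall>\<^sub>F k in sequentially. (LINT x|?M. norm (t k x - f x) powr p) < e / (2 * 2 powr p)"
    using e by (intro order_tendstoD) auto
  then obtain k where k: "(LINT x|?M. norm (t k x - f x) powr p) < e / (2 * 2 powr p)"
    by (auto simp: eventually_sequentially)
  have tl: "t k \<in> borel_measurable (lebesgue_on {a..b})" using t_m[of k] by (simp cong: measurable_cong_sets)
  obtain g where g: "\<And>n. continuous_on UNIV (g n)"
    "(\<lambda>n::nat. LINT x|?M. norm (g n x - t k x) powr p) \<longlonglongrightarrow> 0"
    by (rule continuous_dense_bounded[OF tl 0 p, of "real k + 1"]) (auto simp: t_def)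
  then have "\<forall>\<^sub>F n in sequentially. (LINT x|?M. norm (g n x - t k x) powr p) < e / (2 * 2 powr p)"
    using e by (intro order_tendstoD) auto
  then obtain n where n: "(LINT x|?M. norm (g n x - t k x) powr p) < e / (2 * 2 powr p)"
    by (auto simp: eventually_sequentially)
  have p0: "0 \<le> p" using p by simp
  have tL: "t k \<in> Lp p ?M" by (rule Lp_dominated(1)[OF f t_m p0]) (auto simp: t_def)
  have gL: "g n \<in> Lp p ?M" by (rule continuous_on_imp_Lp[OF continuous_on_subset[OF g(1)] 0 p0]) auto
  have "(LINT x|?M. norm (g n x - f x) powr p) = (LINT x|?M. norm ((g n x - t k x) + (t k x - f x)) powr p)" by simp
  also have "\<dots> \<le> 2 powr p * ((LINT x|?M. norm (g n x - t k x) powr p) + (LINT x|?M. norm (t k x - f x) powr p))"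
    by (rule Lp_add(2)[OF Lp_diff[OF gL tL p0] Lp_diff[OF tL f p0] p0])
  also have "\<dots> < 2 powr p * (e / (2 * 2 powr p) + e / (2 * 2 powr p))"
    using n k by (intro mult_strict_left_mono add_strict_mono) auto
  also have "\<dots> = e" by (simp add: field_simps)
  finally show ?thesis using g(1) that by blast
qed

lemma continuous_dense_Lp_seq:
  fixes f :: "real \<Rightarrow> 'a::euclidean_space"
  assumes f: "f \<in> Lp p (leb_dirac {a..b})" and 0: "0 \<in> {a..b}" and p: "0 < p"
  obtains g where "\<And>n. continuous_on UNIV (g n)"
    "(\<lambda>n::nat. Lp_seminorm p (leb_dirac {a..b}) (\<lambda>x. g n x - f x)) \<longlonglongrightarrow> 0"
proof -
  have "\<exists>g. continuous_on UNIV g \<and> Lp_seminorm p (leb_dirac {a..b}) (\<lambda>x. g x - f x) < inverse (real (Suc n))" for n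
  proof -
    obtain g where g: "continuous_on UNIV g"
      "(LINT x|leb_dirac {a..b}. norm (g x - f x) powr p) < inverse (real (Suc n)) powr p"
      by (rule continuous_dense_Lp[OF f 0 p, of "inverse (real (Suc n)) powr p"]) auto
    have "Lp_seminorm p (leb_dirac {a..b}) (\<lambda>x. g x - f x) < (inverse (real (Suc n)) powr p) powr (1/p)"
      unfolding Lp_seminorm_def using g(2) p by (intro powr_less_mono2) (auto intro!: integral_nonneg_AE)
    then show ?thesis using g(1) p by (auto simp: powr_powr)
  qed
  then obtain g where g: "\<And>n. continuous_on UNIV (g n)"
    "\<And>n. Lp_seminorm p (leb_dirac {a..b}) (\<lambda>x. g n x - f x) < inverse (real (Suc n))" by metis
  show ?thesis
  proof (rule that[OF g(1)])
    show "(\<lambda>n. Lp_seminorm p (leb_dirac {a..b}) (\<lambda>x. g n x - f x)) \<longlonglongrightarrow> 0"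
      by (rule tendsto_sandwich[OF _ _ tendsto_const LIMSEQ_inverse_real_of_nat])
         (use g(2) in \<open>auto intro!: always_eventually less_imp_le simp del: of_nat_Suc\<close>)
  qed
qed

section \<open>Cross-correlations\<close>

text \<open>The cross-correlation of \<open>w\<close> and \<open>h\<close>, without conjugation.\<close>

definition corr :: "(real \<Rightarrow> complex) \<Rightarrow> (real \<Rightarrow> complex) \<Rightarrow> real \<Rightarrow> complex" where
  "corr w h \<theta> = (LINT s|lebesgue. w (s - \<theta>) * h s)"

lemma Lp_shift:
  fixes w :: "real \<Rightarrow> 'a::euclidean_space"
  assumes "w \<in> Lp q lebesgue"
  shows "(\<lambda>s. w (s - \<theta>)) \<in> Lp q lebesgue"
    and "Lp_seminorm q lebesgue (\<lambda>s. w (s - \<theta>)) = Lp_seminorm q lebesgue w"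
  using Lp_affine[OF assms, of 1 "- \<theta>"] by simp_all

locale conjugate_exponents =
  fixes p q :: real
  assumes p: "1 < p" and q: "1 < q" and pq: "1 / p + 1 / q = 1"
begin

lemma qp: "1 / q + 1 / p = 1" using pq by simp

lemma exponents_pos: "0 < p" "0 < q" "0 \<le> p" "0 \<le> q" using p q by auto

lemma corr_integrable:
  fixes w h :: "real \<Rightarrow> complex"
  assumes "w \<in> Lp q lebesgue" "h \<in> Lp p lebesgue"
  shows "integrable lebesgue (\<lambda>s. w (s - \<theta>) * h s)"
  by (rule Holder_inequality(1)[OF q p qp Lp_shift(1)[OF assms(1)] assms(2)])

lemma corr_bound:
  assumes "w \<in> Lp q lebesgue" "h \<in> Lp p lebesgue"
  shows "norm (corr w h \<theta>) \<le> Lp_seminorm q lebesgue w * Lp_seminorm p lebesgue h"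
  unfolding corr_def
  using Holder_inequality(2)[OF q p qp Lp_shift(1)[OF assms(1)] assms(2), of \<theta>] Lp_shift(2)[OF assms(1), of \<theta>] by simp

lemma corr_add_left:
  assumes "w \<in> Lp q lebesgue" "w' \<in> Lp q lebesgue" "h \<in> Lp p lebesgue"
  shows "corr (\<lambda>s. w s + w' s) h \<theta> = corr w h \<theta> + corr w' h \<theta>"
  unfolding corr_def using corr_integrable[OF assms(1,3)] corr_integrable[OF assms(2,3)]
  by (simp add: distrib_right)

lemma corr_diff_left:
  assumes "w \<in> Lp q lebesgue" "w' \<in> Lp q lebesgue" "h \<in> Lp p lebesgue"
  shows "corr (\<lambda>s. w s - w' s) h \<theta> = corr w h \<theta> - corr w' h \<theta>"
  unfolding corr_def using corr_integrable[OF assms(1,3)] corr_integrable[OF assms(2,3)]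
  by (simp add: left_diff_distrib)

lemma corr_add_right:
  assumes "w \<in> Lp q lebesgue" "h \<in> Lp p lebesgue" "h' \<in> Lp p lebesgue"
  shows "corr w (\<lambda>s. h s + h' s) \<theta> = corr w h \<theta> + corr w h' \<theta>"
  unfolding corr_def using corr_integrable[OF assms(1,2)] corr_integrable[OF assms(1,3)]
  by (simp add: distrib_left)

lemma corr_cmult_left: "corr (\<lambda>s. c * w s) h \<theta> = c * corr w h \<theta>"
  unfolding corr_def by (simp add: mult.assoc)

lemma corr_cmult_right: "corr w (\<lambda>s. c * h s) \<theta> = c * corr w h \<theta>"
  unfolding corr_def by (simp add: mult.left_commute)

lemma bounded_support_integrable:
  assumes h: "h \<in> Lp p lebesgue" and supp: "\<And>s. s \<notin> {-R..R} \<Longrightarrow> h s = 0"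
  shows "integrable lebesgue (h :: real \<Rightarrow> complex)"
proof -
  have "(\<lambda>_. 1 :: complex) \<in> Lp q (lebesgue_on {-R..R})"
    by (rule bounded_measurable_Lp[OF finite_measure_lebesgue_on_Icc, where K = 1]) (use exponents_pos in auto)
  then have "zero_ext {-R..R} (\<lambda>_. 1 :: complex) \<in> Lp q lebesgue" by (intro Lp_zero_ext) auto
  then have "integrable lebesgue (\<lambda>s. h s * zero_ext {-R..R} (\<lambda>_. 1) s)"
    by (rule Holder_inequality(1)[OF p q pq h])
  moreover have "h s * zero_ext {-R..R} (\<lambda>_. 1) s = h s" for s
    using supp[of s] by (auto simp: zero_ext_def)
  ultimately show ?thesis by simp
qed

text \<open>The extension by zero of a continuous function has at most the two jumps at \<open>\<plusminus> R\<close>, which are invisible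
to the integral, so dominated convergence applies.\<close>

lemma corr_continuous_of_continuous:
  assumes g: "continuous_on {-R..R} g" and h: "h \<in> Lp p lebesgue"
    and supp: "\<And>s. s \<notin> {-R..R} \<Longrightarrow> h s = 0"
  shows "continuous_on UNIV (corr (zero_ext {-R..R} g) h)"
proof -
  let ?g = "zero_ext {-R..R} g"
  obtain K0 where "\<And>x. x \<in> {-R..R} \<Longrightarrow> norm (g x) \<le> K0"
    using compact_imp_bounded[OF compact_continuous_image[OF g compact_Icc]] unfolding bounded_iff by blast
  then have K: "norm (?g x) \<le> max 0 K0" for x by (auto simp: zero_ext_def le_max_iff_disj)
  have "g \<in> borel_measurable (lebesgue_on {-R..R})"
    by (rule continuous_imp_measurable_on_sets_lebesgue[OF g]) auto
  then have gm: "?g \<in> borel_measurable lebesgue"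
    using borel_measurable_if_I[of g "{-R..R}"] by (simp add: zero_ext_def[abs_def])
  have gs: "(\<lambda>s. ?g (s - \<theta>)) \<in> borel_measurable lebesgue" for \<theta>
    using borel_measurable_affine[OF gm, of 1 "- \<theta>"] by simp
  note hm = LpD(1)[OF h]
  have hi: "integrable lebesgue h" by (rule bounded_support_integrable[OF h supp])
  have g_cont: "isCont ?g x" if "x \<notin> {-R, R}" for x
  proof -
    have "x \<noteq> -R" "x \<noteq> R" using that by auto
    then consider "x < -R" | "-R < x" "x < R" | "R < x" by linarith
    then show ?thesis
    proof cases
      case 1
      have "\<forall>\<^sub>F y in nhds x. 0 = ?g y"
        using eventually_nhds_in_open[of "{..<-R}" x] 1 by (auto simp: zero_ext_def elim!: eventually_mono)
      then show ?thesis by (subst isCont_cong[of _ "\<lambda>_. 0"]) (auto elim: eventually_mono)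
    next
      case 2
      have "isCont g x" using continuous_on_interior[OF g, of x] 2 by (simp add: interior_atLeastAtMost_real)
      moreover have "\<forall>\<^sub>F y in nhds x. ?g y = g y"
        using eventually_nhds_in_open[of "{-R<..<R}" x] 2 by (auto simp: zero_ext_def elim!: eventually_mono)
      ultimately show ?thesis by (subst isCont_cong[of _ g]) auto
    next
      case 3
      have "\<forall>\<^sub>F y in nhds x. 0 = ?g y"
        using eventually_nhds_in_open[of "{R<..}" x] 3 by (auto simp: zero_ext_def elim!: eventually_mono)
      then show ?thesis by (subst isCont_cong[of _ "\<lambda>_. 0"]) (auto elim: eventually_mono)
    qed
  qed
  show ?thesis
    unfolding continuous_on_sequentially
  proof (intro allI ballI impI, elim conjE)
    fix x :: "nat \<Rightarrow> real" and \<theta> assume x: "x \<longlonglongrightarrow> \<theta>"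
    show "(corr ?g h \<circ> x) \<longlonglongrightarrow> corr ?g h \<theta>"
      unfolding corr_def o_def
    proof (rule integral_dominated_convergence[where w="\<lambda>s. max 0 K0 * norm (h s)"])
      show "(\<lambda>s. ?g (s - \<theta>) * h s) \<in> borel_measurable lebesgue"
        by (intro borel_measurable_times gs hm)
      show "(\<lambda>s. ?g (s - x n) * h s) \<in> borel_measurable lebesgue" for n
        by (intro borel_measurable_times gs hm)
      show "integrable lebesgue (\<lambda>s. max 0 K0 * norm (h s))"
        using hi by simp
      show "AE s in lebesgue. norm (?g (s - x n) * h s) \<le> max 0 K0 * norm (h s)" for n
        using K by (intro AE_I2) (auto simp: norm_mult intro!: mult_right_mono)
      have "{\<theta> - R, \<theta> + R} \<in> null_sets lebesgue" by (simp flip: negligible_iff_null_sets)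
      then have "AE s in lebesgue. s \<notin> {\<theta> - R, \<theta> + R}" by (rule AE_not_in)
      then show "AE s in lebesgue. (\<lambda>n. ?g (s - x n) * h s) \<longlonglongrightarrow> ?g (s - \<theta>) * h s"
      proof (rule AE_mp, intro AE_I2 impI)
        fix s assume "s \<notin> {\<theta> - R, \<theta> + R}"
        then have "s - \<theta> \<notin> {-R, R}" by (auto simp: algebra_simps)
        then show "(\<lambda>n. ?g (s - x n) * h s) \<longlonglongrightarrow> ?g (s - \<theta>) * h s"
          by (intro tendsto_intros isCont_tendsto_compose[OF g_cont] x)
      qed
    qed
  qed
qed

text \<open>Approximating \<open>w\<close> by continuous functions, the bound by the product of the norms gives uniform
convergence of the correlations.\<close>

lemma corr_continuous:
  assumes w: "w \<in> Lp q lebesgue" and h: "h \<in> Lp p lebesgue"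
    and suppw: "\<And>s. s \<notin> {-R..R} \<Longrightarrow> w s = 0" and supph: "\<And>s. s \<notin> {-R..R} \<Longrightarrow> h s = 0"
  shows "continuous_on A (corr w h)"
proof (cases "0 \<le> R")
  case True
  let ?S = "{-R..R}"
  have S: "?S \<in> sets lebesgue" "0 \<in> ?S" using True by auto
  have ze: "zero_ext ?S w = w" using suppw by (auto simp: zero_ext_def)
  have wS: "w \<in> Lp q (lebesgue_on ?S)" using w Lp_zero_ext_iff[OF S(1), of w q] ze by simp
  then have wd: "w \<in> Lp q (leb_dirac ?S)" by (simp only: Lp_leb_dirac_iff[OF S])
  obtain g where g: "\<And>n. continuous_on UNIV (g n)"
    "(\<lambda>n::nat. Lp_seminorm q (leb_dirac ?S) (\<lambda>x. g n x - w x)) \<longlonglongrightarrow> 0"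
    using continuous_dense_Lp_seq[OF wd S(2) exponents_pos(2)] by blast
  have gS: "g n \<in> Lp q (lebesgue_on ?S)" for n
    using continuous_on_imp_Lp[OF continuous_on_subset[OF g(1) subset_UNIV] S(2) exponents_pos(4), of n]
    by (simp only: Lp_leb_dirac_iff[OF S])
  define C where "C = Lp_seminorm p lebesgue h"
  have bd: "norm (corr (zero_ext ?S (g n)) h \<theta> - corr w h \<theta>) \<le> Lp_seminorm q (leb_dirac ?S) (\<lambda>x. g n x - w x) * C" for n \<theta>
  proof -
    have d: "(\<lambda>x. g n x - w x) \<in> Lp q (lebesgue_on ?S)" using gS wS exponents_pos by (intro Lp_diff) auto
    have "zero_ext ?S (\<lambda>x. g n x - w x) = (\<lambda>s. zero_ext ?S (g n) s - w s)"
      using suppw by (auto simp: zero_ext_def)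
    then have "corr (zero_ext ?S (g n)) h \<theta> - corr w h \<theta> = corr (zero_ext ?S (\<lambda>x. g n x - w x)) h \<theta>"
      using corr_diff_left[OF Lp_zero_ext(1)[OF S(1) gS] w h] by simp
    also have "norm \<dots> \<le> Lp_seminorm q lebesgue (zero_ext ?S (\<lambda>x. g n x - w x)) * C"
      unfolding C_def by (rule corr_bound[OF Lp_zero_ext(1)[OF S(1) d] h])
    also have "\<dots> \<le> Lp_seminorm q (leb_dirac ?S) (\<lambda>x. g n x - w x) * C"
      using Lp_seminorm_leb_dirac(1)[OF S exponents_pos(2) d] Lp_zero_ext(2)[OF S(1) d]
      by (intro mult_right_mono) (auto simp: C_def)
    finally show ?thesis .
  qed
  have "uniform_limit UNIV (\<lambda>n. corr (zero_ext ?S (g n)) h) (corr w h) sequentially"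
  proof (rule uniform_limitI)
    fix e :: real assume "e > 0"
    have "(\<lambda>n. Lp_seminorm q (leb_dirac ?S) (\<lambda>x. g n x - w x) * C) \<longlonglongrightarrow> 0"
      using tendsto_mult_right[OF g(2), of C] by simp
    then have "\<forall>\<^sub>F n in sequentially. Lp_seminorm q (leb_dirac ?S) (\<lambda>x. g n x - w x) * C < e"
      using \<open>e > 0\<close> by (rule order_tendstoD)
    then show "\<forall>\<^sub>F n in sequentially. \<forall>\<theta>\<in>UNIV. dist (corr (zero_ext ?S (g n)) h \<theta>) (corr w h \<theta>) < e"
      by eventually_elim (auto simp: dist_norm intro: le_less_trans[OF bd])
  qed
  moreover have "\<forall>\<^sub>F n in sequentially. continuous_on UNIV (corr (zero_ext ?S (g n)) h)"
    by (intro always_eventually allI corr_continuous_of_continuous[OF continuous_on_subset[OF g(1)] h supph]) auto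
  ultimately have "continuous_on UNIV (corr w h)"
    using uniform_limit_theorem by (metis trivial_limit_sequentially)
  then show ?thesis by (rule continuous_on_subset) auto
next
  case False
  then have "w = (\<lambda>_. 0)" using suppw by auto
  then show ?thesis by (simp add: corr_def continuous_on_const)
qed

end

section \<open>The extended bilinear form\<close>

text \<open>The real and imaginary parts of \<open>g\<close> are differences of the monotone functions \<open>T\<close> and \<open>T - Re g\<close>,
respectively \<open>T\<close> and \<open>T - Im g\<close>.\<close>

lemma variation_majorant_measurable:
  fixes g :: "real \<Rightarrow> complex"
  assumes g: "variation_majorant T g a b"
  shows "g \<in> borel_measurable (lebesgue_on {a..b})"
proof -
  have m: "(\<lambda>x. F (g x) :: real) \<in> borel_measurable (lebesgue_on {a..b})"
    if F: "\<And>x y. \<bar>F y - F x\<bar> \<le> norm (y - x)" for F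
  proof -
    have "mono_on {a..b} T"
      by (rule mono_onI) (auto intro: variation_majorant_mono[OF g])
    moreover have "mono_on {a..b} (\<lambda>x. T x - F (g x))"
    proof (rule mono_onI)
      fix x y assume "x \<in> {a..b}" "y \<in> {a..b}" "x \<le> y"
      then show "T x - F (g x) \<le> T y - F (g y)"
        using variation_majorantD[OF g, of x y] F[of "g y" "g x"] by (auto simp: abs_le_iff)
    qed
    ultimately have "integrable (lebesgue_on {a..b}) (\<lambda>x. T x - (T x - F (g x)))"
      by (intro Bochner_Integration.integrable_diff integrable_mono_on)
    then show ?thesis by simp
  qed
  have "(\<lambda>x. Re (g x)) \<in> borel_measurable (lebesgue_on {a..b})"
    by (rule m) (metis abs_Re_le_cmod minus_complex.sel(1))
  moreover have "(\<lambda>x. Im (g x)) \<in> borel_measurable (lebesgue_on {a..b})"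
    by (rule m) (metis abs_Im_le_cmod minus_complex.sel(2))
  ultimately show ?thesis by (simp add: borel_measurable_complex_iff)
qed

lemma variation_majorant_min:
  assumes g: "variation_majorant T g a b" and t: "a \<le> t" "t \<le> b"
  shows "variation_majorant (\<lambda>x. T (min x t)) (\<lambda>x. g (min x t)) a b"
  unfolding variation_majorant_def
  using t by (intro allI impI variation_majorantD[OF g]) auto

lemma partial_rs_sum_bound:
  assumes g: "variation_majorant T g a b" and x: "x \<in> {a..b}" and K: "0 \<le> K"
    and f: "\<And>y. y \<in> {a..b} \<Longrightarrow> norm (f y) \<le> K"
  shows "norm (partial_rs_sum f g a b N x) \<le> K * (T b - T a)"
proof (cases "N = 0")
  case True
  then show ?thesis using variation_majorant_mono[OF g, of a b] x K by (simp add: partial_rs_sum_def)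
next
  case False
  have ab: "a \<le> b" using x by simp
  let ?m = "\<lambda>k. min x (grid a b N k)"
  have "norm (partial_rs_sum f g a b N x) \<le> (\<Sum>k<N. K * (T (?m (Suc k)) - T (?m k)))"
    unfolding partial_rs_sum_def
  proof (rule sum_norm_le)
    fix k assume k: "k \<in> {..<N}"
    then have "grid a b N k \<in> {a..b}" using ab by (auto simp: grid_ge grid_le)
    moreover have "norm (g (?m (Suc k)) - g (?m k)) \<le> T (?m (Suc k)) - T (?m k)"
      using x k ab by (intro variation_majorantD[OF g] min.mono) (auto simp: grid_ge grid_le grid_mono min_le_iff_disj)
    ultimately show "norm (f (grid a b N k) * (g (?m (Suc k)) - g (?m k))) \<le> K * (T (?m (Suc k)) - T (?m k))"
      unfolding norm_mult using K by (intro mult_mono f) auto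
  qed
  also have "\<dots> = K * (T x - T a)"
    using grid_telescope[of N "\<lambda>y. T (min x y)" a b] False x by (simp add: min_absorb1 min_absorb2 flip: sum_distrib_left)
  also have "\<dots> \<le> K * (T b - T a)"
    using K variation_majorant_mono[OF g, of x b] x by (intro mult_left_mono) auto
  finally show ?thesis .
qed

text \<open>The inner integral of the bilinear form extends over \<open>[-r, \<xi>]\<close>, the exchanged one over \<open>[-r, 0]\<close> with
the integrand cut off at \<open>\<theta> = \<xi>\<close>. Both are limits of sums over the same equidistant partition, and
these differ only in the cell that contains \<open>\<xi>\<close>. The difference is not small for each \<open>\<xi>\<close>, as \<open>g\<close> may
jump, but its integral over \<open>\<xi>\<close> is at most the length of a cell times the total increment of the
majorant.\<close>

context
  fixes r :: real and \<psi> \<phi> g :: "real \<Rightarrow> complex" and T :: "real \<Rightarrow> real" and K M :: real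
  assumes r: "0 < r" and \<psi>: "continuous_on {0..r} \<psi>" and \<phi>: "continuous_on {-r..0} \<phi>"
    and g: "variation_majorant T g (-r) 0"
    and K: "0 \<le> K" "\<And>x. x \<in> {0..r} \<Longrightarrow> norm (\<psi> x) \<le> K"
    and M: "0 \<le> M" "\<And>x. x \<in> {-r..0} \<Longrightarrow> norm (\<phi> x) \<le> M"
begin

private abbreviation "t \<equiv> grid (-r) 0"

text \<open>
The maximum continues \<open>\<psi>\<close> constantly to the left of \<open>0\<close>, so that the integrand is a continuous function
on the whole of \<open>[-r, 0]\<close>; the values at \<open>\<theta> > \<xi>\<close> do not enter the sum stopped at \<open>\<xi>\<close>.\<close>

private definition kernel_sum :: "nat \<Rightarrow> real \<Rightarrow> complex" where
  "kernel_sum N \<xi> = partial_rs_sum (\<lambda>\<theta>. \<psi> (max 0 (\<xi> - \<theta>))) g (-r) 0 N \<xi>"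

private lemma t_in: "t N k \<in> {-r..0}" if "k \<le> N"
  using r that by (auto simp: grid_ge grid_le)

private lemma kernel_sum_tendsto:
  assumes "\<xi> \<in> {-r..0}"
  shows "(\<lambda>N. kernel_sum N \<xi>) \<longlonglongrightarrow> rs_integral (-r) \<xi> (\<lambda>\<theta>. \<psi> (\<xi> - \<theta>)) g"
proof -
  have "continuous_on {-r..0} (\<lambda>\<theta>. \<psi> (max 0 (\<xi> - \<theta>)))"
    by (rule continuous_on_compose2[OF \<psi>]) (use assms r in \<open>auto intro!: continuous_intros\<close>)
  from partial_rs_sum_tendsto[OF this g assms]
  have "(\<lambda>N. kernel_sum N \<xi>) \<longlonglongrightarrow> rs_integral (-r) \<xi> (\<lambda>\<theta>. \<psi> (max 0 (\<xi> - \<theta>))) g" by (simp add: kernel_sum_def)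
  also have "rs_integral (-r) \<xi> (\<lambda>\<theta>. \<psi> (max 0 (\<xi> - \<theta>))) g = rs_integral (-r) \<xi> (\<lambda>\<theta>. \<psi> (\<xi> - \<theta>)) g"
    by (rule rs_integral_cong) simp
  finally show ?thesis .
qed

private lemma kernel_sum_bound: "\<xi> \<in> {-r..0} \<Longrightarrow> norm (kernel_sum N \<xi>) \<le> K * (T 0 - T (-r))"
  unfolding kernel_sum_def by (rule partial_rs_sum_bound[OF g _ K(1)]) (auto intro!: K(2) simp: r less_imp_le)

private lemma kernel_sum_measurable: "kernel_sum N \<in> borel_measurable (lebesgue_on {-r..0})"
proof -
  have "(\<lambda>\<xi>. \<psi> (max 0 (\<xi> - t N k)) * (g (min \<xi> (t N (Suc k))) - g (min \<xi> (t N k)))) \<in> borel_measurable (lebesgue_on {-r..0})"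
    if "k < N" for k
  proof -
    have k: "t N k \<in> {-r..0}" "t N (Suc k) \<in> {-r..0}" using t_in that by auto
    have "continuous_on {-r..0} (\<lambda>\<xi>. \<psi> (max 0 (\<xi> - t N k)))"
      by (rule continuous_on_compose2[OF \<psi>]) (use k r in \<open>auto intro!: continuous_intros\<close>)
    then have "(\<lambda>\<xi>. \<psi> (max 0 (\<xi> - t N k))) \<in> borel_measurable (lebesgue_on {-r..0})"
      by (rule continuous_imp_measurable_on_sets_lebesgue) auto
    then show ?thesis
      using k by (intro borel_measurable_times borel_measurable_diff
          variation_majorant_measurable[OF variation_majorant_min[OF g]]) auto
  qed
  then show ?thesis unfolding kernel_sum_def[abs_def] partial_rs_sum_def by (intro borel_measurable_sum) auto
qed

private lemma \<phi>_measurable: "\<phi> \<in> borel_measurable (lebesgue_on {-r..0})"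
  by (rule continuous_imp_measurable_on_sets_lebesgue[OF \<phi>]) auto

private lemma bounded_integrable:
  assumes "f \<in> borel_measurable (lebesgue_on {-r..0})" "\<And>x. x \<in> {-r..0} \<Longrightarrow> norm (f x) \<le> C"
  shows "integrable (lebesgue_on {-r..0}) (f :: real \<Rightarrow> complex)"
  by (rule finite_measure.integrable_const_bound[OF finite_measure_lebesgue_on_Icc, of _ C])
     (use assms in auto)

private lemma kernel_integrable:
  "integrable (lebesgue_on {-r..0}) (\<lambda>\<xi>. rs_integral (-r) \<xi> (\<lambda>\<theta>. \<psi> (\<xi> - \<theta>)) g * \<phi> \<xi>)"
  and kernel_sum_integral_tendsto:
  "(\<lambda>N. LINT \<xi>|lebesgue_on {-r..0}. kernel_sum N \<xi> * \<phi> \<xi>) \<longlonglongrightarrow>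
     (LINT \<xi>|lebesgue_on {-r..0}. rs_integral (-r) \<xi> (\<lambda>\<theta>. \<psi> (\<xi> - \<theta>)) g * \<phi> \<xi>)"
proof -
  let ?L = "lebesgue_on {-r..0}" and ?R = "\<lambda>\<xi>. rs_integral (-r) \<xi> (\<lambda>\<theta>. \<psi> (\<xi> - \<theta>)) g * \<phi> \<xi>"
  let ?C = "K * (T 0 - T (-r)) * M"
  have C: "norm (kernel_sum N \<xi> * \<phi> \<xi>) \<le> ?C" if "\<xi> \<in> {-r..0}" for N \<xi>
    unfolding norm_mult using kernel_sum_bound[OF that, of N] M(2)[OF that] order_trans[OF norm_ge_zero kernel_sum_bound[OF that, of N]]
    by (intro mult_mono) auto
  have lim: "(\<lambda>N. kernel_sum N \<xi> * \<phi> \<xi>) \<longlonglongrightarrow> ?R \<xi>" if "\<xi> \<in> {-r..0}" for \<xi>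
    by (intro tendsto_intros kernel_sum_tendsto[OF that])
  have m: "(\<lambda>\<xi>. kernel_sum N \<xi> * \<phi> \<xi>) \<in> borel_measurable ?L" for N
    by (intro borel_measurable_times kernel_sum_measurable \<phi>_measurable)
  have mR: "?R \<in> borel_measurable ?L"
    by (rule borel_measurable_LIMSEQ_metric[where f="\<lambda>N \<xi>. kernel_sum N \<xi> * \<phi> \<xi>", OF m]) (use lim in auto)
  show "integrable ?L ?R"
    by (rule bounded_integrable[OF mR, of ?C]) (use C lim in \<open>auto intro!: Lim_bounded[OF tendsto_norm[OF lim], of _ 0 ?C]\<close>)
  show "(\<lambda>N. LINT \<xi>|?L. kernel_sum N \<xi> * \<phi> \<xi>) \<longlonglongrightarrow> (LINT \<xi>|?L. ?R \<xi>)"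
  proof (rule integral_dominated_convergence[where w="\<lambda>_. ?C"])
    show "integrable ?L (\<lambda>_. ?C)" by (rule finite_measure.integrable_const[OF finite_measure_lebesgue_on_Icc])
  qed (use m mR lim C in auto)
qed

private lemma cell_defect:
  assumes k: "k < N" and \<xi>: "\<xi> \<in> {-r..0}"
  shows "norm (\<psi> (max 0 (\<xi> - t N k)) * (g (min \<xi> (t N (Suc k))) - g (min \<xi> (t N k)))
      - zero_ext {0..r} \<psi> (\<xi> - t N k) * (g (t N (Suc k)) - g (t N k)))
    \<le> K * (T (t N (Suc k)) - T (t N k)) * indicator {t N k..t N (Suc k)} \<xi>"
proof -
  have tk: "-r \<le> t N k" "t N k \<le> t N (Suc k)" "t N (Suc k) \<le> 0"
    using t_in[of "Suc k" N] t_in[of k N] k r by (auto simp: grid_mono)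
  have Tk: "T (t N k) \<le> T (t N (Suc k))" using tk by (intro variation_majorant_mono[OF g]) auto
  consider "\<xi> < t N k" | "t N k \<le> \<xi>" "\<xi> \<le> t N (Suc k)" | "t N (Suc k) < \<xi>" by linarith
  then show ?thesis
  proof cases
    case 1
    then show ?thesis using tk Tk by (simp add: zero_ext_def min_absorb1)
  next
    case 2
    have in': "\<xi> - t N k \<in> {0..r}" using 2 \<xi> tk by auto
    have "\<psi> (max 0 (\<xi> - t N k)) * (g (min \<xi> (t N (Suc k))) - g (min \<xi> (t N k)))
      - zero_ext {0..r} \<psi> (\<xi> - t N k) * (g (t N (Suc k)) - g (t N k)) =
      - (\<psi> (\<xi> - t N k) * (g (t N (Suc k)) - g \<xi>))"
      using 2 in' by (simp add: zero_ext_def min_absorb1 min_absorb2 max_absorb2 algebra_simps)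
    also have "norm \<dots> \<le> K * (T (t N (Suc k)) - T (t N k))"
      unfolding norm_minus_cancel norm_mult
    proof (rule mult_mono[OF K(2)[OF in']])
      have "norm (g (t N (Suc k)) - g \<xi>) \<le> T (t N (Suc k)) - T \<xi>"
        using 2 tk \<xi> by (intro variation_majorantD[OF g]) auto
      also have "\<dots> \<le> T (t N (Suc k)) - T (t N k)"
        using 2 tk \<xi> variation_majorant_mono[OF g, of "t N k" \<xi>] by auto
      finally show "norm (g (t N (Suc k)) - g \<xi>) \<le> T (t N (Suc k)) - T (t N k)" .
    qed (use K in auto)
    finally show ?thesis using 2 by simp
  next
    case 3
    then have "\<xi> - t N k \<in> {0..r}" using \<xi> tk by auto
    then show ?thesis using 3 tk Tk by (simp add: zero_ext_def min_absorb2 max_absorb2)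
  qed
qed

private lemma corr_eq:
  assumes "k \<le> N"
  shows "corr (zero_ext {0..r} \<psi>) (zero_ext {-r..0} \<phi>) (t N k) =
     (LINT \<xi>|lebesgue_on {-r..0}. zero_ext {0..r} \<psi> (\<xi> - t N k) * \<phi> \<xi>)"
proof -
  have "zero_ext {0..r} \<psi> (s - t N k) * zero_ext {-r..0} \<phi> s =
      (if s \<in> {-r..0} then zero_ext {0..r} \<psi> (s - t N k) * \<phi> s else 0)" for s
    by (simp add: zero_ext_def)
  then show ?thesis unfolding corr_def using Lebesgue_Measure.integral_restrict_UNIV[of "{-r..0}"] by simp
qed

private lemma kernel_measurable: "(\<lambda>\<xi>. zero_ext {0..r} \<psi> (\<xi> - c) * \<phi> \<xi>) \<in> borel_measurable (lebesgue_on {-r..0})"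
proof -
  have "\<psi> \<in> borel_measurable (lebesgue_on {0..r})"
    by (rule continuous_imp_measurable_on_sets_lebesgue[OF \<psi>]) auto
  then have "zero_ext {0..r} \<psi> \<in> borel_measurable lebesgue"
    using borel_measurable_if_I[of \<psi> "{0..r}"] by (simp add: zero_ext_def[abs_def])
  from borel_measurable_affine[OF this, of 1 "- c"]
  have "(\<lambda>\<xi>. zero_ext {0..r} \<psi> (\<xi> - c)) \<in> borel_measurable (lebesgue_on {-r..0})"
    by (intro measurable_restrict_space1) simp
  then show ?thesis by (intro borel_measurable_times \<phi>_measurable)
qed

private lemma kernel_sum_integral_close:
  assumes N: "0 < N"
  shows "norm ((LINT \<xi>|lebesgue_on {-r..0}. kernel_sum N \<xi> * \<phi> \<xi>) -
      rs_sum (corr (zero_ext {0..r} \<psi>) (zero_ext {-r..0} \<phi>)) g (-r) 0 N) \<le> K * M * (T 0 - T (-r)) * (r / real N)"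
proof -
  let ?L = "lebesgue_on {-r..0}"
  let ?d = "\<lambda>k. g (t N (Suc k)) - g (t N k)" and ?D = "\<lambda>k. T (t N (Suc k)) - T (t N k)"
  let ?z = "\<lambda>k \<xi>. zero_ext {0..r} \<psi> (\<xi> - t N k)"
  have iP: "integrable ?L (\<lambda>\<xi>. kernel_sum N \<xi> * \<phi> \<xi>)"
  proof (rule bounded_integrable)
    show "norm (kernel_sum N \<xi> * \<phi> \<xi>) \<le> K * (T 0 - T (-r)) * M" if "\<xi> \<in> {-r..0}" for \<xi>
      unfolding norm_mult using kernel_sum_bound[OF that, of N] M(2)[OF that] order_trans[OF norm_ge_zero kernel_sum_bound[OF that, of N]]
      by (intro mult_mono) auto
  qed (intro borel_measurable_times kernel_sum_measurable \<phi>_measurable)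
  have iz: "integrable ?L (\<lambda>\<xi>. ?z k \<xi> * \<phi> \<xi>)" for k
  proof (rule bounded_integrable[OF kernel_measurable])
    show "norm (?z k \<xi> * \<phi> \<xi>) \<le> K * M" if "\<xi> \<in> {-r..0}" for \<xi>
      unfolding norm_mult using K M(2)[OF that] by (intro mult_mono) (auto simp: zero_ext_def)
  qed
  have isum: "integrable ?L (\<lambda>\<xi>. \<Sum>k<N. ?d k * (?z k \<xi> * \<phi> \<xi>))"
    by (intro Bochner_Integration.integrable_sum integrable_mult_right iz)
  have ii: "integrable ?L (\<lambda>\<xi>. C * indicator {t N k..t N (Suc k)} \<xi>)" for C :: real and k
    by (intro integrable_mult_right finite_measure.integrable_const_bound[OF finite_measure_lebesgue_on_Icc, of _ 1]
        measurable_restrict_space1 borel_measurable_indicator) auto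
  have "rs_sum (corr (zero_ext {0..r} \<psi>) (zero_ext {-r..0} \<phi>)) g (-r) 0 N =
      (LINT \<xi>|?L. (\<Sum>k<N. ?d k * (?z k \<xi> * \<phi> \<xi>)))"
    unfolding rs_sum_def
    by (subst Bochner_Integration.integral_sum, rule integrable_mult_right[OF iz])
       (simp add: corr_eq mult.commute)
  then have eq: "(LINT \<xi>|?L. kernel_sum N \<xi> * \<phi> \<xi>) - rs_sum (corr (zero_ext {0..r} \<psi>) (zero_ext {-r..0} \<phi>)) g (-r) 0 N
      = (LINT \<xi>|?L. kernel_sum N \<xi> * \<phi> \<xi> - (\<Sum>k<N. ?d k * (?z k \<xi> * \<phi> \<xi>)))"
    by (simp only: Bochner_Integration.integral_diff[OF iP isum])
  have "norm ((LINT \<xi>|?L. kernel_sum N \<xi> * \<phi> \<xi>) - rs_sum (corr (zero_ext {0..r} \<psi>) (zero_ext {-r..0} \<phi>)) g (-r) 0 N)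
      \<le> (LINT \<xi>|?L. norm (kernel_sum N \<xi> * \<phi> \<xi> - (\<Sum>k<N. ?d k * (?z k \<xi> * \<phi> \<xi>))))"
    unfolding eq by (rule integral_norm_bound)
  also have "\<dots> \<le> (LINT \<xi>|?L. (\<Sum>k<N. K * ?D k * M * indicator {t N k..t N (Suc k)} \<xi>))"
  proof (rule integral_mono)
    show "integrable ?L (\<lambda>\<xi>. norm (kernel_sum N \<xi> * \<phi> \<xi> - (\<Sum>k<N. ?d k * (?z k \<xi> * \<phi> \<xi>))))"
      by (rule integrable_norm[OF Bochner_Integration.integrable_diff[OF iP isum]])
    show "integrable ?L (\<lambda>\<xi>. \<Sum>k<N. K * ?D k * M * indicator {t N k..t N (Suc k)} \<xi>)"
      by (intro Bochner_Integration.integrable_sum ii)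
    fix \<xi> assume "\<xi> \<in> space ?L"
    then have \<xi>: "\<xi> \<in> {-r..0}" by simp
    have eq: "kernel_sum N \<xi> * \<phi> \<xi> - (\<Sum>k<N. ?d k * (?z k \<xi> * \<phi> \<xi>)) =
      (\<Sum>k<N. (\<psi> (max 0 (\<xi> - t N k)) * (g (min \<xi> (t N (Suc k))) - g (min \<xi> (t N k))) - ?z k \<xi> * ?d k) * \<phi> \<xi>)"
      unfolding kernel_sum_def partial_rs_sum_def sum_distrib_right sum_subtractf[symmetric]
      by (intro sum.cong refl) (simp add: algebra_simps)
    have "norm (kernel_sum N \<xi> * \<phi> \<xi> - (\<Sum>k<N. ?d k * (?z k \<xi> * \<phi> \<xi>))) \<le>
        (\<Sum>k<N. K * ?D k * indicator {t N k..t N (Suc k)} \<xi> * M)"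
      unfolding eq
    proof (rule sum_norm_le)
      fix k assume "k \<in> {..<N}"
      then have k: "k < N" by simp
      note cd = cell_defect[OF k \<xi>]
      show "norm ((\<psi> (max 0 (\<xi> - t N k)) * (g (min \<xi> (t N (Suc k))) - g (min \<xi> (t N k))) - ?z k \<xi> * ?d k) * \<phi> \<xi>)
          \<le> K * ?D k * indicator {t N k..t N (Suc k)} \<xi> * M"
        unfolding norm_mult[of _ "\<phi> \<xi>"]
        by (intro mult_mono cd M(2)[OF \<xi>] order_trans[OF norm_ge_zero cd]) auto
    qed
    then show "norm (kernel_sum N \<xi> * \<phi> \<xi> - (\<Sum>k<N. ?d k * (?z k \<xi> * \<phi> \<xi>))) \<le>
        (\<Sum>k<N. K * ?D k * M * indicator {t N k..t N (Suc k)} \<xi>)"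
      by (simp add: mult_ac)
  qed
  also have "\<dots> = (\<Sum>k<N. K * ?D k * M * (r / real N))"
  proof -
    have "(LINT \<xi>|?L. indicator {t N k..t N (Suc k)} \<xi>) = r / real N" if "k < N" for k
    proof -
      have tk: "-r \<le> t N k" "t N k \<le> t N (Suc k)" "t N (Suc k) \<le> 0"
        using t_in[of "Suc k" N] t_in[of k N] that r by (auto simp: grid_mono)
      then have s: "{t N k..t N (Suc k)} \<subseteq> {-r..0}" by auto
      have "(LINT \<xi>|?L. indicator {t N k..t N (Suc k)} \<xi>) = measure ?L {t N k..t N (Suc k)}"
        using tk by (simp add: max_absorb1 min_absorb1)
      also have "\<dots> = measure lebesgue {t N k..t N (Suc k)}"
        using s by (intro measure_restrict_space) auto
      also have "\<dots> = r / real N" using tk(2) by (simp add: grid_Suc)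
      finally show ?thesis .
    qed
    moreover have "integrable ?L (\<lambda>\<xi>. K * ?D k * M * indicator {t N k..t N (Suc k)} \<xi>)" for k
      by (rule ii)
    ultimately show ?thesis by (subst Bochner_Integration.integral_sum) auto
  qed
  also have "\<dots> = K * M * (r / real N) * (\<Sum>k<N. ?D k)"
    by (simp add: sum_distrib_left mult_ac)
  also have "\<dots> = K * M * (T 0 - T (-r)) * (r / real N)"
    using grid_telescope[OF N, of T "-r" 0] by simp
  finally show ?thesis .
qed

lemma rs_integral_Fubini:
  assumes c: "continuous_on {-r..0} (corr (zero_ext {0..r} \<psi>) (zero_ext {-r..0} \<phi>))"
  shows "integrable (lebesgue_on {-r..0}) (\<lambda>\<xi>. rs_integral (-r) \<xi> (\<lambda>\<theta>. \<psi> (\<xi> - \<theta>)) g * \<phi> \<xi>)"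
    and "(LINT \<xi>|lebesgue_on {-r..0}. rs_integral (-r) \<xi> (\<lambda>\<theta>. \<psi> (\<xi> - \<theta>)) g * \<phi> \<xi>) =
      rs_integral (-r) 0 (corr (zero_ext {0..r} \<psi>) (zero_ext {-r..0} \<phi>)) g"
proof -
  show "integrable (lebesgue_on {-r..0}) (\<lambda>\<xi>. rs_integral (-r) \<xi> (\<lambda>\<theta>. \<psi> (\<xi> - \<theta>)) g * \<phi> \<xi>)"
    by (rule kernel_integrable)
  let ?I = "\<lambda>N. LINT \<xi>|lebesgue_on {-r..0}. kernel_sum N \<xi> * \<phi> \<xi>"
  let ?s = "rs_sum (corr (zero_ext {0..r} \<psi>) (zero_ext {-r..0} \<phi>)) g (-r) 0"
  have "(\<lambda>N. r / real N) \<longlonglongrightarrow> 0" by (rule lim_const_over_n)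
  then have "(\<lambda>N. K * M * (T 0 - T (-r)) * (r / real N)) \<longlonglongrightarrow> 0"
    by (rule tendsto_mult_right_zero)
  then have "(\<lambda>N. ?I N - ?s N) \<longlonglongrightarrow> 0"
    by (rule Lim_null_comparison[rotated])
       (rule eventually_mono[OF eventually_gt_at_top[of 0] kernel_sum_integral_close])
  moreover have "?s \<longlonglongrightarrow> rs_integral (-r) 0 (corr (zero_ext {0..r} \<psi>) (zero_ext {-r..0} \<phi>)) g"
    using r by (intro rs_sum_tendsto[OF c g]) auto
  ultimately have "?I \<longlonglongrightarrow> rs_integral (-r) 0 (corr (zero_ext {0..r} \<psi>) (zero_ext {-r..0} \<phi>)) g"
    by (rule Lim_transform[rotated])
  then show "(LINT \<xi>|lebesgue_on {-r..0}. rs_integral (-r) \<xi> (\<lambda>\<theta>. \<psi> (\<xi> - \<theta>)) g * \<phi> \<xi>) =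
      rs_integral (-r) 0 (corr (zero_ext {0..r} \<psi>) (zero_ext {-r..0} \<phi>)) g"
    by (rule LIMSEQ_unique[OF kernel_sum_integral_tendsto])
qed

end

lemma
  assumes F: "is_B_extension p q r \<eta> F"
  shows is_B_extension_add_left: "\<psi>1 \<in> Mq_star q r \<Longrightarrow> \<psi>2 \<in> Mq_star q r \<Longrightarrow> \<phi> \<in> Mp p r \<Longrightarrow>
      F (\<lambda>x. \<psi>1 x + \<psi>2 x) \<phi> = F \<psi>1 \<phi> + F \<psi>2 \<phi>"
    and is_B_extension_add_right: "\<psi> \<in> Mq_star q r \<Longrightarrow> \<phi>1 \<in> Mp p r \<Longrightarrow> \<phi>2 \<in> Mp p r \<Longrightarrow>
      F \<psi> (\<lambda>x. \<phi>1 x + \<phi>2 x) = F \<psi> \<phi>1 + F \<psi> \<phi>2"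
    and is_B_extension_bounded: "\<exists>K. \<forall>\<psi>\<in>Mq_star q r. \<forall>\<phi>\<in>Mp p r. norm (F \<psi> \<phi>) \<le>
        K * Lp_seminorm q (leb_dirac {0..r}) \<psi> * Lp_seminorm p (leb_dirac {-r..0}) \<phi>"
    and is_B_extension_continuous: "continuous_on {0..r} \<psi> \<Longrightarrow> continuous_on {-r..0} \<phi> \<Longrightarrow>
      F \<psi> \<phi> = B_form r \<eta> \<psi> \<phi>"
    and is_B_extension_outside: "\<psi> \<notin> Mq_star q r \<or> \<phi> \<notin> Mp p r \<Longrightarrow> F \<psi> \<phi> = 0"
proof -
  note conjs = F[unfolded is_B_extension_def]
  show "\<psi>1 \<in> Mq_star q r \<Longrightarrow> \<psi>2 \<in> Mq_star q r \<Longrightarrow> \<phi> \<in> Mp p r \<Longrightarrow>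
      F (\<lambda>x. \<psi>1 x + \<psi>2 x) \<phi> = F \<psi>1 \<phi> + F \<psi>2 \<phi>"
    by (rule conjs[THEN conjunct1, rule_format])
  show "\<psi> \<in> Mq_star q r \<Longrightarrow> \<phi>1 \<in> Mp p r \<Longrightarrow> \<phi>2 \<in> Mp p r \<Longrightarrow>
      F \<psi> (\<lambda>x. \<phi>1 x + \<phi>2 x) = F \<psi> \<phi>1 + F \<psi> \<phi>2"
    by (rule conjs[THEN conjunct2, THEN conjunct2, THEN conjunct1, rule_format])
  show "\<exists>K. \<forall>\<psi>\<in>Mq_star q r. \<forall>\<phi>\<in>Mp p r. norm (F \<psi> \<phi>) \<le>
        K * Lp_seminorm q (leb_dirac {0..r}) \<psi> * Lp_seminorm p (leb_dirac {-r..0}) \<phi>"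
    by (rule conjs[THEN conjunct2, THEN conjunct2, THEN conjunct2, THEN conjunct2, THEN conjunct1])
  show "continuous_on {0..r} \<psi> \<Longrightarrow> continuous_on {-r..0} \<phi> \<Longrightarrow> F \<psi> \<phi> = B_form r \<eta> \<psi> \<phi>"
    by (rule conjs[THEN conjunct2, THEN conjunct2, THEN conjunct2, THEN conjunct2, THEN conjunct2, THEN conjunct1, rule_format])
  show "\<psi> \<notin> Mq_star q r \<or> \<phi> \<notin> Mp p r \<Longrightarrow> F \<psi> \<phi> = 0"
    by (rule conjs[THEN conjunct2, THEN conjunct2, THEN conjunct2, THEN conjunct2, THEN conjunct2, THEN conjunct2, rule_format])
qed

lemma is_B_extension_tendsto_right:
  assumes F: "is_B_extension p q r \<eta> F" and p: "0 < p"
    and \<psi>: "\<psi> \<in> Mq_star q r" and \<phi>: "\<phi> \<in> Mp p r" and \<phi>n: "\<And>n. \<phi>n n \<in> Mp p r"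
    and lim: "(\<lambda>n::nat. Lp_seminorm p (leb_dirac {-r..0}) (\<lambda>x. \<phi>n n x - \<phi> x)) \<longlonglongrightarrow> 0"
  shows "(\<lambda>n. F \<psi> (\<phi>n n)) \<longlonglongrightarrow> F \<psi> \<phi>"
proof -
  obtain K where K: "\<And>\<phi>. \<phi> \<in> Mp p r \<Longrightarrow>
      norm (F \<psi> \<phi>) \<le> K * Lp_seminorm q (leb_dirac {0..r}) \<psi> * Lp_seminorm p (leb_dirac {-r..0}) \<phi>"
    using is_B_extension_bounded[OF F] \<psi> by blast
  have d: "(\<lambda>x. \<phi>n n x - \<phi> x) \<in> Mp p r" for n
    using p by (intro Lp_diff \<phi>n \<phi>) auto
  have "F \<psi> (\<phi>n n) - F \<psi> \<phi> = F \<psi> (\<lambda>x. \<phi>n n x - \<phi> x)" for n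
  proof -
    have "F \<psi> (\<lambda>x. (\<phi>n n x - \<phi> x) + \<phi> x) = F \<psi> (\<lambda>x. \<phi>n n x - \<phi> x) + F \<psi> \<phi>"
      by (rule is_B_extension_add_right[OF F \<psi> d \<phi>])
    then show ?thesis by simp
  qed
  then have b: "norm (F \<psi> (\<phi>n n) - F \<psi> \<phi>) \<le> K * Lp_seminorm q (leb_dirac {0..r}) \<psi> *
      Lp_seminorm p (leb_dirac {-r..0}) (\<lambda>x. \<phi>n n x - \<phi> x)" for n
    using K[OF d[of n]] by simp
  have "(\<lambda>n. F \<psi> (\<phi>n n) - F \<psi> \<phi>) \<longlonglongrightarrow> 0"
    by (rule Lim_null_comparison[OF always_eventually tendsto_mult_right_zero[OF lim]]) (use b in blast)
  then show ?thesis by (rule LIM_zero_cancel)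
qed

lemma is_B_extension_tendsto_left:
  assumes F: "is_B_extension p q r \<eta> F" and q: "0 < q"
    and \<phi>: "\<phi> \<in> Mp p r" and \<psi>: "\<psi> \<in> Mq_star q r" and \<psi>n: "\<And>n. \<psi>n n \<in> Mq_star q r"
    and lim: "(\<lambda>n::nat. Lp_seminorm q (leb_dirac {0..r}) (\<lambda>x. \<psi>n n x - \<psi> x)) \<longlonglongrightarrow> 0"
  shows "(\<lambda>n. F (\<psi>n n) \<phi>) \<longlonglongrightarrow> F \<psi> \<phi>"
proof -
  obtain K where K: "\<And>\<psi>. \<psi> \<in> Mq_star q r \<Longrightarrow>
      norm (F \<psi> \<phi>) \<le> K * Lp_seminorm q (leb_dirac {0..r}) \<psi> * Lp_seminorm p (leb_dirac {-r..0}) \<phi>"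
    using is_B_extension_bounded[OF F] \<phi> by blast
  have d: "(\<lambda>x. \<psi>n n x - \<psi> x) \<in> Mq_star q r" for n
    using q by (intro Lp_diff \<psi>n \<psi>) auto
  have "F (\<psi>n n) \<phi> - F \<psi> \<phi> = F (\<lambda>x. \<psi>n n x - \<psi> x) \<phi>" for n
  proof -
    have "F (\<lambda>x. (\<psi>n n x - \<psi> x) + \<psi> x) \<phi> = F (\<lambda>x. \<psi>n n x - \<psi> x) \<phi> + F \<psi> \<phi>"
      by (rule is_B_extension_add_left[OF F d \<psi> \<phi>])
    then show ?thesis by simp
  qed
  then have b: "norm (F (\<psi>n n) \<phi> - F \<psi> \<phi>) \<le> K * Lp_seminorm p (leb_dirac {-r..0}) \<phi> *
      Lp_seminorm q (leb_dirac {0..r}) (\<lambda>x. \<psi>n n x - \<psi> x)" for n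
    using K[OF d[of n]] by (simp add: mult_ac)
  have "(\<lambda>n. F (\<psi>n n) \<phi> - F \<psi> \<phi>) \<longlonglongrightarrow> 0"
    by (rule Lim_null_comparison[OF always_eventually tendsto_mult_right_zero[OF lim]]) (use b in blast)
  then show ?thesis by (rule LIM_zero_cancel)
qed

text \<open>By boundedness an extension is continuous in each argument separately, so it is determined first
for continuous \<open>\<psi>\<close> and arbitrary \<open>\<phi>\<close>, then for arbitrary \<open>\<psi>\<close>.\<close>

lemma is_B_extension_unique:
  fixes \<eta> :: "real \<Rightarrow> complex ^ 'n ^ 'n"
  assumes F: "is_B_extension p q r \<eta> F" and G: "is_B_extension p q r \<eta> G"
    and p: "0 < p" and q: "0 < q" and r: "0 < r"
  shows "F = G"
proof (intro ext)
  fix \<psi> \<phi> :: "real \<Rightarrow> complex ^ 'n"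
  have r0: "0 \<in> {-r..0}" "0 \<in> {0..r}" using r by auto
  show "F \<psi> \<phi> = G \<psi> \<phi>"
  proof (cases "\<psi> \<in> Mq_star q r \<and> \<phi> \<in> Mp p r")
    case True
    then have \<psi>: "\<psi> \<in> Mq_star q r" and \<phi>: "\<phi> \<in> Mp p r" by auto
    have cont_in: "\<omega> \<in> Mq_star q r" "\<omega> \<in> Mp p r" if "continuous_on UNIV \<omega>" for \<omega> :: "real \<Rightarrow> complex ^ 'n"
      using continuous_on_subset[OF that subset_UNIV] p q r0 by (auto intro!: continuous_on_imp_Lp)
    have one: "F \<omega> \<phi> = G \<omega> \<phi>" if \<omega>: "continuous_on UNIV \<omega>" for \<omega> :: "real \<Rightarrow> complex ^ 'n"
    proof -
      obtain \<phi>n where \<phi>n: "\<And>n. continuous_on UNIV (\<phi>n n)"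
        "(\<lambda>n::nat. Lp_seminorm p (leb_dirac {-r..0}) (\<lambda>x. \<phi>n n x - \<phi> x)) \<longlonglongrightarrow> 0"
        using continuous_dense_Lp_seq[OF \<phi> r0(1) p] by blast
      have "F \<omega> (\<phi>n n) = B_form r \<eta> \<omega> (\<phi>n n)" "G \<omega> (\<phi>n n) = B_form r \<eta> \<omega> (\<phi>n n)" for n
        using continuous_on_subset[OF \<omega> subset_UNIV] continuous_on_subset[OF \<phi>n(1) subset_UNIV]
        by (auto intro!: is_B_extension_continuous[OF F] is_B_extension_continuous[OF G])
      then show ?thesis
        using is_B_extension_tendsto_right[OF F p cont_in(1)[OF \<omega>] \<phi> cont_in(2)[OF \<phi>n(1)] \<phi>n(2)]
          is_B_extension_tendsto_right[OF G p cont_in(1)[OF \<omega>] \<phi> cont_in(2)[OF \<phi>n(1)] \<phi>n(2)]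
        by (auto intro: LIMSEQ_unique)
    qed
    obtain \<psi>n where \<psi>n: "\<And>n. continuous_on UNIV (\<psi>n n)"
      "(\<lambda>n::nat. Lp_seminorm q (leb_dirac {0..r}) (\<lambda>x. \<psi>n n x - \<psi> x)) \<longlonglongrightarrow> 0"
      using continuous_dense_Lp_seq[OF \<psi> r0(2) q] by blast
    show ?thesis
      using is_B_extension_tendsto_left[OF F q \<phi> \<psi> cont_in(1)[OF \<psi>n(1)] \<psi>n(2)]
        is_B_extension_tendsto_left[OF G q \<phi> \<psi> cont_in(1)[OF \<psi>n(1)] \<psi>n(2)] one[OF \<psi>n(1)]
      by (auto intro: LIMSEQ_unique)
  next
    case False
    then show ?thesis using is_B_extension_outside[OF F] is_B_extension_outside[OF G] by auto
  qed
qed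

lemma Icc_sets_lebesgue: "{a..b::real} \<in> sets lebesgue" by simp

lemma component_Lp:
  fixes f :: "real \<Rightarrow> complex ^ 'n"
  assumes f: "f \<in> Lp p (leb_dirac {a..b})" and 0: "0 \<in> {a..b}" and p: "0 < p"
  shows "zero_ext {a..b} (\<lambda>x. f x $ i) \<in> Lp p lebesgue"
    and "Lp_seminorm p lebesgue (zero_ext {a..b} (\<lambda>x. f x $ i)) \<le> Lp_seminorm p (leb_dirac {a..b}) f"
proof -
  have S: "{a..b} \<in> sets lebesgue" by simp
  have fS: "f \<in> Lp p (lebesgue_on {a..b})" using f by (simp only: Lp_leb_dirac_iff[OF S 0])
  have c: "continuous_on UNIV (\<lambda>x :: complex ^ 'n. x $ i)" by (intro continuous_intros)
  have "(\<lambda>x. f x $ i) \<in> borel_measurable (lebesgue_on {a..b})"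
    by (rule borel_measurable_continuous_on[OF c LpD(1)[OF fS]])
  then have *: "(\<lambda>x. f x $ i) \<in> Lp p (lebesgue_on {a..b})"
      "Lp_seminorm p (lebesgue_on {a..b}) (\<lambda>x. f x $ i) \<le> Lp_seminorm p (lebesgue_on {a..b}) f"
    using p by (auto intro!: Lp_dominated[OF fS] component_le_norm_cart Finite_Cartesian_Product.norm_nth_le)
  show "zero_ext {a..b} (\<lambda>x. f x $ i) \<in> Lp p lebesgue" by (rule Lp_zero_ext(1)[OF S *(1)])
  show "Lp_seminorm p lebesgue (zero_ext {a..b} (\<lambda>x. f x $ i)) \<le> Lp_seminorm p (leb_dirac {a..b}) f"
    unfolding Lp_zero_ext(2)[OF S *(1)]
    by (rule order_trans[OF *(2) Lp_seminorm_leb_dirac(1)[OF S 0 p fS]])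
qed

lemma linear_vector_scalar_mult: "linear (\<lambda>x :: complex ^ 'n. c *s x)"
  by (rule linearI) (auto simp: vec_eq_iff algebra_simps)

text \<open>The supports lie in compact intervals, where higher integrability implies integrability.\<close>

definition bounded_support :: "(real \<Rightarrow> complex) \<Rightarrow> bool" where
  "bounded_support w \<longleftrightarrow> (\<exists>R. \<forall>s. s \<notin> {-R..R} \<longrightarrow> w s = 0)"

lemma bounded_support_zero_ext: "bounded_support (zero_ext {a..b} f)"
  unfolding bounded_support_def zero_ext_def by (intro exI[of _ "max \<bar>a\<bar> \<bar>b\<bar>"]) auto

text \<open>The data of the delay equation, with a majorant in place of the hypothesis of bounded variation.\<close>

locale delay_form = conjugate_exponents +
  fixes r :: real and \<eta> :: "real \<Rightarrow> complex ^ 'n ^ 'n" and T :: "real \<Rightarrow> real"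
  assumes r: "0 < r" and majorant: "variation_majorant T \<eta> (-r) 0"
begin

lemma entry_majorant: "variation_majorant T (\<lambda>\<theta>. \<eta> \<theta> $ i $ j) (-r) 0"
  unfolding variation_majorant_def
proof (intro allI impI)
  fix x y assume "-r \<le> x" "x \<le> y" "y \<le> 0"
  then have "norm (\<eta> y - \<eta> x) \<le> T y - T x" by (rule variation_majorantD[OF majorant])
  moreover have "norm ((\<eta> y - \<eta> x) $ i $ j) \<le> norm (\<eta> y - \<eta> x)"
    by (rule order_trans[OF Finite_Cartesian_Product.norm_nth_le Finite_Cartesian_Product.norm_nth_le])
  ultimately show "norm (\<eta> y $ i $ j - \<eta> x $ i $ j) \<le> T y - T x" by simp
qed

lemma zero_in: "0 \<in> {-r..0}" "0 \<in> {0..r}" using r by auto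

text \<open>The contribution of one entry of \<open>\<eta>\<close> to the bilinear form, after the exchange of the integrals. It
is defined for arbitrary \<open>q\<close>- and \<open>p\<close>-integrable functions of bounded support.\<close>

definition pairing :: "'n \<Rightarrow> 'n \<Rightarrow> (real \<Rightarrow> complex) \<Rightarrow> (real \<Rightarrow> complex) \<Rightarrow> complex" where
  "pairing i j w h = rs_integral (-r) 0 (corr w h) (\<lambda>\<theta>. \<eta> \<theta> $ i $ j)"

lemma corr_continuous_bounded_support:
  assumes w: "w \<in> Lp q lebesgue" "bounded_support w" and h: "h \<in> Lp p lebesgue" "bounded_support h"
  shows "continuous_on A (corr w h)"
proof -
  obtain R1 where R1: "\<And>s. s \<notin> {-R1..R1} \<Longrightarrow> w s = 0" using w(2) unfolding bounded_support_def by blast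
  obtain R2 where R2: "\<And>s. s \<notin> {-R2..R2} \<Longrightarrow> h s = 0" using h(2) unfolding bounded_support_def by blast
  show ?thesis
    by (rule corr_continuous[OF w(1) h(1), of "max R1 R2"]) (use R1 R2 in \<open>auto simp: not_le max_def split: if_splits\<close>)
qed

lemma pairing_bound:
  assumes w: "w \<in> Lp q lebesgue" "bounded_support w" and h: "h \<in> Lp p lebesgue" "bounded_support h"
  shows "norm (pairing i j w h) \<le> Lp_seminorm q lebesgue w * Lp_seminorm p lebesgue h * (T 0 - T (-r))"
  unfolding pairing_def
  using r by (intro rs_integral_bound[OF corr_continuous_bounded_support[OF w h] entry_majorant] corr_bound w(1) h(1)) auto

lemma pairing_add_left:
  assumes w: "w \<in> Lp q lebesgue" "bounded_support w" and w': "w' \<in> Lp q lebesgue" "bounded_support w'"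
    and h: "h \<in> Lp p lebesgue" "bounded_support h"
  shows "pairing i j (\<lambda>s. w s + w' s) h = pairing i j w h + pairing i j w' h"
proof -
  have "corr (\<lambda>s. w s + w' s) h = (\<lambda>\<theta>. corr w h \<theta> + corr w' h \<theta>)"
    using corr_add_left[OF w(1) w'(1) h(1)] by auto
  then show ?thesis unfolding pairing_def
    using r rs_integral_add[OF corr_continuous_bounded_support[OF w h] corr_continuous_bounded_support[OF w' h] entry_majorant] by simp
qed

lemma pairing_add_right:
  assumes w: "w \<in> Lp q lebesgue" "bounded_support w" and h: "h \<in> Lp p lebesgue" "bounded_support h"
    and h': "h' \<in> Lp p lebesgue" "bounded_support h'"
  shows "pairing i j w (\<lambda>s. h s + h' s) = pairing i j w h + pairing i j w h'"
proof -
  have "corr w (\<lambda>s. h s + h' s) = (\<lambda>\<theta>. corr w h \<theta> + corr w h' \<theta>)"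
    using corr_add_right[OF w(1) h(1) h'(1)] by auto
  then show ?thesis unfolding pairing_def
    using r rs_integral_add[OF corr_continuous_bounded_support[OF w h] corr_continuous_bounded_support[OF w h'] entry_majorant] by simp
qed

lemma pairing_cmult:
  assumes w: "w \<in> Lp q lebesgue" "bounded_support w" and h: "h \<in> Lp p lebesgue" "bounded_support h"
  shows "pairing i j (\<lambda>s. c * w s) h = c * pairing i j w h" "pairing i j w (\<lambda>s. c * h s) = c * pairing i j w h"
proof -
  have "corr (\<lambda>s. c * w s) h = (\<lambda>\<theta>. c * corr w h \<theta>)" "corr w (\<lambda>s. c * h s) = (\<lambda>\<theta>. c * corr w h \<theta>)"
    using corr_cmult_left corr_cmult_right by auto
  then show "pairing i j (\<lambda>s. c * w s) h = c * pairing i j w h" "pairing i j w (\<lambda>s. c * h s) = c * pairing i j w h"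
    unfolding pairing_def using r rs_integral_cmult[OF corr_continuous_bounded_support[OF w h] entry_majorant] by simp_all
qed

definition B_formula :: "(real \<Rightarrow> complex ^ 'n) \<Rightarrow> (real \<Rightarrow> complex ^ 'n) \<Rightarrow> complex" where
  "B_formula \<psi> \<phi> = scalar_product (\<psi> 0) (\<phi> 0) +
     (\<Sum>i\<in>UNIV. \<Sum>j\<in>UNIV. pairing i j (zero_ext {0..r} (\<lambda>x. \<psi> x $ i)) (zero_ext {-r..0} (\<lambda>x. \<phi> x $ j)))"

lemma B_formula_continuous:
  assumes \<psi>: "continuous_on {0..r} \<psi>" and \<phi>: "continuous_on {-r..0} \<phi>"
  shows "B_formula \<psi> \<phi> = B_form r \<eta> \<psi> \<phi>"
proof -
  let ?z = "\<lambda>i. zero_ext {0..r} (\<lambda>x. \<psi> x $ i)" and ?y = "\<lambda>j. zero_ext {-r..0} (\<lambda>x. \<phi> x $ j)"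
  have z: "?z i \<in> Lp q lebesgue" for i
    using continuous_on_imp_Lp[OF \<psi> zero_in(2) exponents_pos(4)] zero_in(2) exponents_pos(2) by (rule component_Lp)
  have y: "?y j \<in> Lp p lebesgue" for j
    using continuous_on_imp_Lp[OF \<phi> zero_in(1) exponents_pos(3)] zero_in(1) exponents_pos(1) by (rule component_Lp)
  obtain K where K: "\<And>x. x \<in> {0..r} \<Longrightarrow> norm (\<psi> x) \<le> K"
    using compact_imp_bounded[OF compact_continuous_image[OF \<psi> compact_Icc]] unfolding bounded_iff by blast
  obtain M where M: "\<And>x. x \<in> {-r..0} \<Longrightarrow> norm (\<phi> x) \<le> M"
    using compact_imp_bounded[OF compact_continuous_image[OF \<phi> compact_Icc]] unfolding bounded_iff by blast
  have K0: "0 \<le> K" and M0: "0 \<le> M"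
    using order_trans[OF norm_ge_zero K[of 0]] order_trans[OF norm_ge_zero M[of 0]] r by auto
  let ?k = "\<lambda>i j \<xi>. rs_integral (-r) \<xi> (\<lambda>\<theta>. \<psi> (\<xi> - \<theta>) $ i) (\<lambda>\<theta>. \<eta> \<theta> $ i $ j) * \<phi> \<xi> $ j"
  have pc: "pairing i j (?z i) (?y j) = integral {-r..0} (?k i j)" "?k i j integrable_on {-r..0}" for i j
  proof -
    have c: "continuous_on {0..r} (\<lambda>x. \<psi> x $ i)" "continuous_on {-r..0} (\<lambda>x. \<phi> x $ j)"
      using \<psi> \<phi> by (auto intro!: continuous_intros)
    have b: "x \<in> {0..r} \<Longrightarrow> norm (\<psi> x $ i) \<le> K" "x \<in> {-r..0} \<Longrightarrow> norm (\<phi> x $ j) \<le> M" for x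
      using K[of x] M[of x] Finite_Cartesian_Product.norm_nth_le[of "\<psi> x" i] Finite_Cartesian_Product.norm_nth_le[of "\<phi> x" j]
      by auto
    note F = rs_integral_Fubini[OF r c entry_majorant[of i j] K0 b(1) M0 b(2)
        corr_continuous_bounded_support[OF z bounded_support_zero_ext y bounded_support_zero_ext]]
    show "?k i j integrable_on {-r..0}"
      by (rule integrable_on_lebesgue_on[OF F(1) Icc_sets_lebesgue])
    show "pairing i j (?z i) (?y j) = integral {-r..0} (?k i j)"
      using F(2) lebesgue_integral_eq_integral[OF F(1) Icc_sets_lebesgue] by (simp add: pairing_def)
  qed
  have "integral {-r..0} (\<lambda>\<xi>. scalar_product (rs_integral_row (-r) \<xi> (\<lambda>\<theta>. \<psi> (\<xi> - \<theta>)) \<eta>) (\<phi> \<xi>)) =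
      integral {-r..0} (\<lambda>\<xi>. \<Sum>j\<in>UNIV. \<Sum>i\<in>UNIV. ?k i j \<xi>)"
    by (simp add: scalar_product_def rs_integral_row_def sum_distrib_right)
  also have "\<dots> = (\<Sum>j\<in>UNIV. \<Sum>i\<in>UNIV. integral {-r..0} (?k i j))"
    by (subst integral_sum, simp, intro integrable_sum pc(2), simp, intro sum.cong refl integral_sum pc(2) finite)
  also have "\<dots> = (\<Sum>i\<in>UNIV. \<Sum>j\<in>UNIV. pairing i j (?z i) (?y j))"
    unfolding pc(1) by (rule sum.swap)
  finally show ?thesis by (simp add: B_formula_def B_form_def)
qed

definition B_ext :: "(real \<Rightarrow> complex ^ 'n) \<Rightarrow> (real \<Rightarrow> complex ^ 'n) \<Rightarrow> complex" where
  "B_ext \<psi> \<phi> = (if \<psi> \<in> Mq_star q r \<and> \<phi> \<in> Mp p r then B_formula \<psi> \<phi> else 0)"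

lemmas component_q = component_Lp[OF _ zero_in(2) exponents_pos(2)]
lemmas component_p = component_Lp[OF _ zero_in(1) exponents_pos(1)]

lemma B_formula_bound:
  assumes \<psi>: "\<psi> \<in> Mq_star q r" and \<phi>: "\<phi> \<in> Mp p r"
  shows "norm (B_formula \<psi> \<phi>) \<le> (real CARD('n) + real CARD('n) * real CARD('n) * (T 0 - T (-r))) *
    Lp_seminorm q (leb_dirac {0..r}) \<psi> * Lp_seminorm p (leb_dirac {-r..0}) \<phi>"
proof -
  let ?A = "Lp_seminorm q (leb_dirac {0..r}) \<psi>" and ?B = "Lp_seminorm p (leb_dirac {-r..0}) \<phi>"
  have V: "0 \<le> T 0 - T (-r)" using variation_majorant_mono[OF majorant, of "-r" 0] r by simp
  have S: "{0..r} \<in> sets lebesgue" "{-r..0} \<in> sets lebesgue" by (rule Icc_sets_lebesgue)+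
  have p0: "norm (\<psi> 0) \<le> ?A" "norm (\<phi> 0) \<le> ?B"
    using Lp_seminorm_leb_dirac(2)[OF S(1) zero_in(2) exponents_pos(2), of \<psi>]
      Lp_seminorm_leb_dirac(2)[OF S(2) zero_in(1) exponents_pos(1), of \<phi>]
      \<psi>[unfolded Lp_leb_dirac_iff[OF S(1) zero_in(2)]] \<phi>[unfolded Lp_leb_dirac_iff[OF S(2) zero_in(1)]]
    by blast+
  have c: "norm (pairing i j (zero_ext {0..r} (\<lambda>x. \<psi> x $ i)) (zero_ext {-r..0} (\<lambda>x. \<phi> x $ j))) \<le> ?A * ?B * (T 0 - T (-r))" for i j
    using V by (intro order_trans[OF pairing_bound[OF component_q(1)[OF \<psi>] bounded_support_zero_ext component_p(1)[OF \<phi>] bounded_support_zero_ext]]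
        mult_right_mono mult_mono component_q(2)[OF \<psi>] component_p(2)[OF \<phi>]) auto
  have "norm (\<Sum>i\<in>UNIV. \<Sum>j\<in>UNIV. pairing i j (zero_ext {0..r} (\<lambda>x. \<psi> x $ i)) (zero_ext {-r..0} (\<lambda>x. \<phi> x $ j)))
      \<le> (\<Sum>i\<in>(UNIV::'n set). \<Sum>j\<in>(UNIV::'n set). ?A * ?B * (T 0 - T (-r)))"
    by (intro sum_norm_le c)
  moreover have "norm (scalar_product (\<psi> 0) (\<phi> 0)) \<le> (\<Sum>i\<in>(UNIV::'n set). ?A * ?B)"
    unfolding scalar_product_def
  proof (intro sum_norm_le)
    fix i
    show "norm (\<psi> 0 $ i * \<phi> 0 $ i) \<le> ?A * ?B"
      unfolding norm_mult
      by (intro mult_mono order_trans[OF Finite_Cartesian_Product.norm_nth_le p0(1)] order_trans[OF Finite_Cartesian_Product.norm_nth_le p0(2)]) auto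
  qed
  ultimately show ?thesis
    unfolding B_formula_def
    by (intro order_trans[OF norm_triangle_ineq]) (simp add: algebra_simps)
qed

lemma B_ext_is_extension: "is_B_extension p q r \<eta> B_ext"
  unfolding is_B_extension_def
proof (intro conjI ballI allI impI)
  note bs = bounded_support_zero_ext
  note sp = scalar_product_def
  fix \<psi>1 \<psi>2 \<phi> :: "real \<Rightarrow> complex ^ 'n"
  assume \<psi>1: "\<psi>1 \<in> Mq_star q r" and \<psi>2: "\<psi>2 \<in> Mq_star q r" and \<phi>: "\<phi> \<in> Mp p r"
  have "(\<lambda>x. \<psi>1 x + \<psi>2 x) \<in> Mq_star q r" by (rule Lp_add(1)[OF \<psi>1 \<psi>2 exponents_pos(4)])
  moreover have "zero_ext {0..r} (\<lambda>x. (\<psi>1 x + \<psi>2 x) $ i) =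
      (\<lambda>s. zero_ext {0..r} (\<lambda>x. \<psi>1 x $ i) s + zero_ext {0..r} (\<lambda>x. \<psi>2 x $ i) s)" for i
    by (auto simp: zero_ext_def)
  ultimately show "B_ext (\<lambda>x. \<psi>1 x + \<psi>2 x) \<phi> = B_ext \<psi>1 \<phi> + B_ext \<psi>2 \<phi>"
    using \<psi>1 \<psi>2 \<phi>
    by (simp add: B_ext_def B_formula_def sp pairing_add_left[OF component_q(1)[OF \<psi>1] bs component_q(1)[OF \<psi>2] bs component_p(1)[OF \<phi>] bs]
        sum.distrib distrib_right)
next
  note bs = bounded_support_zero_ext
  fix c and \<psi> \<phi> :: "real \<Rightarrow> complex ^ 'n"
  assume \<psi>: "\<psi> \<in> Mq_star q r" and \<phi>: "\<phi> \<in> Mp p r"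
  have c: "(\<lambda>x. c *s \<psi> x) \<in> Mq_star q r" "(\<lambda>x. c *s \<phi> x) \<in> Mp p r"
    by (rule Lp_linear_image[OF \<psi> exponents_pos(4) linear_vector_scalar_mult],
        rule Lp_linear_image[OF \<phi> exponents_pos(3) linear_vector_scalar_mult])
  have *: "zero_ext {0..r} (\<lambda>x. (c *s \<psi> x) $ i) = (\<lambda>s. c * zero_ext {0..r} (\<lambda>x. \<psi> x $ i) s)"
    "zero_ext {-r..0} (\<lambda>x. (c *s \<phi> x) $ i) = (\<lambda>s. c * zero_ext {-r..0} (\<lambda>x. \<phi> x $ i) s)" for i
    by (auto simp: zero_ext_def)
  note pc = pairing_cmult[OF component_q(1)[OF \<psi>] bs component_p(1)[OF \<phi>] bs]
  have "B_formula (\<lambda>x. c *s \<psi> x) \<phi> = c * B_formula \<psi> \<phi>"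
    unfolding B_formula_def scalar_product_def * pc by (simp add: sum_distrib_left distrib_left mult.assoc)
  then show "B_ext (\<lambda>x. c *s \<psi> x) \<phi> = c * B_ext \<psi> \<phi>"
    using \<psi> \<phi> c by (simp add: B_ext_def)
  have "B_formula \<psi> (\<lambda>x. c *s \<phi> x) = c * B_formula \<psi> \<phi>"
    unfolding B_formula_def scalar_product_def * pc by (simp add: sum_distrib_left distrib_left mult.left_commute)
  then show "B_ext \<psi> (\<lambda>x. c *s \<phi> x) = c * B_ext \<psi> \<phi>"
    using \<psi> \<phi> c by (simp add: B_ext_def)
next
  note bs = bounded_support_zero_ext
  fix \<psi> \<phi>1 \<phi>2 :: "real \<Rightarrow> complex ^ 'n"
  assume \<psi>: "\<psi> \<in> Mq_star q r" and \<phi>1: "\<phi>1 \<in> Mp p r" and \<phi>2: "\<phi>2 \<in> Mp p r"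
  have "(\<lambda>x. \<phi>1 x + \<phi>2 x) \<in> Mp p r" by (rule Lp_add(1)[OF \<phi>1 \<phi>2 exponents_pos(3)])
  moreover have "zero_ext {-r..0} (\<lambda>x. (\<phi>1 x + \<phi>2 x) $ i) =
      (\<lambda>s. zero_ext {-r..0} (\<lambda>x. \<phi>1 x $ i) s + zero_ext {-r..0} (\<lambda>x. \<phi>2 x $ i) s)" for i
    by (auto simp: zero_ext_def)
  ultimately show "B_ext \<psi> (\<lambda>x. \<phi>1 x + \<phi>2 x) = B_ext \<psi> \<phi>1 + B_ext \<psi> \<phi>2"
    using \<psi> \<phi>1 \<phi>2
    by (simp add: B_ext_def B_formula_def scalar_product_def
        pairing_add_right[OF component_q(1)[OF \<psi>] bs component_p(1)[OF \<phi>1] bs component_p(1)[OF \<phi>2] bs]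
        sum.distrib distrib_left)
next
  show "\<exists>K. \<forall>\<psi>\<in>Mq_star q r. \<forall>\<phi>\<in>Mp p r. norm (B_ext \<psi> \<phi>) \<le>
        K * Lp_seminorm q (leb_dirac {0..r}) \<psi> * Lp_seminorm p (leb_dirac {-r..0}) \<phi>"
    using B_formula_bound by (auto simp: B_ext_def)
next
  fix \<psi> \<phi> :: "real \<Rightarrow> complex ^ 'n"
  assume c: "continuous_on {0..r} \<psi>" "continuous_on {-r..0} \<phi>"
  then have "\<psi> \<in> Mq_star q r" "\<phi> \<in> Mp p r"
    using exponents_pos zero_in by (auto intro!: continuous_on_imp_Lp)
  then show "B_ext \<psi> \<phi> = B_form r \<eta> \<psi> \<phi>"
    using B_formula_continuous[OF c] by (simp add: B_ext_def)
qed (auto simp: B_ext_def)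

lemma B_tilde_eq:
  assumes "\<psi> \<in> Mq_star q r" "\<phi> \<in> Mp p r"
  shows "B_tilde p q r \<eta> \<psi> \<phi> = B_formula \<psi> \<phi>"
proof -
  have "B_tilde p q r \<eta> = B_ext"
    unfolding B_tilde_def
    by (rule the_equality[where P="is_B_extension p q r \<eta>", OF B_ext_is_extension])
       (rule is_B_extension_unique[OF _ B_ext_is_extension exponents_pos(1,2) r])
  then show ?thesis using assms by (simp add: B_ext_def)
qed

end

section \<open>Stieltjes sums against absolutely continuous functions\<close>

text \<open>Stieltjes sums over the equidistant partition with tags \<open>\<tau>\<close> that are prescribed for every \<open>N\<close>, since
integration by parts needs left tags and right tags at the same time.\<close>

definition tagged_sum :: "(nat \<Rightarrow> nat \<Rightarrow> real) \<Rightarrow> (real \<Rightarrow> complex) \<Rightarrow> (real \<Rightarrow> complex) \<Rightarrow> real \<Rightarrow> real \<Rightarrow> nat \<Rightarrow> complex" where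
  "tagged_sum \<tau> h F a b N = (\<Sum>k<N. h (\<tau> N k) * (F (grid a b N (Suc k)) - F (grid a b N k)))"

definition grid_tags :: "real \<Rightarrow> real \<Rightarrow> (nat \<Rightarrow> nat \<Rightarrow> real) \<Rightarrow> bool" where
  "grid_tags a b \<tau> \<longleftrightarrow> (\<forall>N k. k < N \<longrightarrow> grid a b N k \<le> \<tau> N k \<and> \<tau> N k \<le> grid a b N (Suc k))"

lemma grid_tagsD:
  assumes "grid_tags a b \<tau>" "k < N" "a \<le> b"
  shows "grid a b N k \<le> \<tau> N k" "\<tau> N k \<le> grid a b N (Suc k)" "\<tau> N k \<in> {a..b}"
proof -
  show *: "grid a b N k \<le> \<tau> N k" "\<tau> N k \<le> grid a b N (Suc k)"
    using assms unfolding grid_tags_def by auto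
  show "\<tau> N k \<in> {a..b}"
    using * grid_ge[of a b N k] grid_le[of a b "Suc k" N] assms by auto
qed

lemma grid_tags_left: "a \<le> b \<Longrightarrow> grid_tags a b (grid a b)"
  unfolding grid_tags_def by (auto intro: grid_mono)

lemma grid_tags_right: "a \<le> b \<Longrightarrow> grid_tags a b (\<lambda>N k. grid a b N (Suc k))"
  unfolding grid_tags_def by (auto intro: grid_mono)

lemma grid_tags_close:
  assumes h: "continuous_on {a..b} h" and \<tau>: "grid_tags a b \<tau>" and ab: "a \<le> b" and e: "0 < \<epsilon>"
  obtains N0 where "\<And>N k x. N0 \<le> N \<Longrightarrow> 0 < N \<and> (k < N \<longrightarrow> x \<in> {grid a b N k..grid a b N (Suc k)} \<longrightarrow>
     norm (h (\<tau> N k) - h x) \<le> \<epsilon>)"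
proof -
  have "uniformly_continuous_on {a..b} h" using h by (intro compact_uniformly_continuous) auto
  then obtain d where d: "d > 0"
    "\<And>x y. x \<in> {a..b} \<Longrightarrow> y \<in> {a..b} \<Longrightarrow> dist y x < d \<Longrightarrow> dist (h y) (h x) < \<epsilon>"
    using e unfolding uniformly_continuous_on_def by blast
  obtain N0 where N0: "\<And>N. N \<ge> N0 \<Longrightarrow> 0 < N \<and> (b - a) / real N < d"
    using mesh_small[OF d(1), of b a] by blast
  show ?thesis
  proof (rule that[of N0], intro conjI impI)
    fix N k x assume "N0 \<le> N"
    then have N: "0 < N" "(b - a) / real N < d" using N0 by auto
    then show "0 < N" by simp
    assume k: "k < N" and x: "x \<in> {grid a b N k..grid a b N (Suc k)}"
    have "x \<in> {a..b}"
      using x grid_ge[OF ab, of N k] grid_le[OF ab, of "Suc k" N] k by auto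
    moreover have "dist (\<tau> N k) x < d"
      using grid_tagsD(1,2)[OF \<tau> k ab] x N(2) unfolding dist_real_def grid_Suc atLeastAtMost_iff by linarith
    ultimately show "norm (h (\<tau> N k) - h x) \<le> \<epsilon>"
      using d(2)[of x "\<tau> N k"] grid_tagsD(3)[OF \<tau> k ab] by (simp add: dist_norm)
  qed
qed

lemma continuous_times_integrable:
  fixes h f :: "real \<Rightarrow> complex"
  assumes h: "continuous_on {a..b} h" and f: "integrable lebesgue f"
  shows "(\<lambda>x. h x * f x) absolutely_integrable_on {a..b}"
proof (rule absolutely_integrable_bounded_measurable_product[OF bilinear_times])
  show "h \<in> borel_measurable (lebesgue_on {a..b})"
    by (rule continuous_imp_measurable_on_sets_lebesgue[OF h]) auto
  show "bounded (h ` {a..b})" using compact_imp_bounded[OF compact_continuous_image[OF h compact_Icc]] .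
  show "f absolutely_integrable_on {a..b}" by (rule integrable_lebesgue_imp_HK[OF f])
qed auto

text \<open>On each cell, \<open>h\<close> is uniformly close to its value at the tag, and the errors add up to at most
\<open>\<epsilon>\<close> times the integral of the norm of \<open>f\<close>.\<close>

lemma tagged_sum_tendsto_integral:
  fixes h F f :: "real \<Rightarrow> complex"
  assumes h: "continuous_on {a..b} h" and \<tau>: "grid_tags a b \<tau>" and ab: "a \<le> b"
    and f: "integrable lebesgue f"
    and F: "\<And>c d. a \<le> c \<Longrightarrow> c \<le> d \<Longrightarrow> d \<le> b \<Longrightarrow> F d - F c = integral {c..d} f"
  shows "tagged_sum \<tau> h F a b \<longlonglongrightarrow> integral {a..b} (\<lambda>x. h x * f x)"
proof (rule metric_LIMSEQ_I)
  fix e :: real assume "e > 0"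
  define V where "V = integral {a..b} (\<lambda>x. norm (f x))"
  have fn: "(\<lambda>x. norm (f x)) integrable_on {c..d}" for c d
    by (rule integrable_lebesgue_imp_HK[OF integrable_norm[OF f]])
  have V: "0 \<le> V" unfolding V_def by (rule integral_nonneg[OF fn]) auto
  define \<epsilon> where "\<epsilon> = e / (V + 1)"
  have \<epsilon>: "\<epsilon> > 0" "\<epsilon> * V < e" using \<open>e > 0\<close> V by (auto simp: \<epsilon>_def field_simps)
  obtain N0 where N0: "\<And>N k x. N0 \<le> N \<Longrightarrow> 0 < N \<and> (k < N \<longrightarrow> x \<in> {grid a b N k..grid a b N (Suc k)} \<longrightarrow>
     norm (h (\<tau> N k) - h x) \<le> \<epsilon>)" using grid_tags_close[OF h \<tau> ab \<epsilon>(1)] by blast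
  have split: "(\<Sum>k<N. integral {grid a b N k..grid a b N (Suc k)} k') = integral {a..b} k'"
    if N: "0 < N" and i: "k' integrable_on {a..b}" for N and k' :: "real \<Rightarrow> 'z::euclidean_space"
  proof -
    have "integral {grid a b N k..grid a b N (Suc k)} k' = integral {a..grid a b N (Suc k)} k' - integral {a..grid a b N k} k'"
      if "k < N" for k
    proof -
      have "k' integrable_on {a..grid a b N (Suc k)}"
        using that ab by (intro integrable_on_subinterval[OF i]) (auto simp: grid_le)
      then show ?thesis
        using Henstock_Kurzweil_Integration.integral_combine[of a "grid a b N k" "grid a b N (Suc k)" k'] ab
        by (simp add: grid_ge grid_mono algebra_simps)
    qed
    then have "(\<Sum>k<N. integral {grid a b N k..grid a b N (Suc k)} k') =
        (\<Sum>k<N. integral {a..grid a b N (Suc k)} k' - integral {a..grid a b N k} k')" by simp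
    then show ?thesis using grid_telescope[OF N, of "\<lambda>x. integral {a..x} k'" a b] by simp
  qed
  have hf: "(\<lambda>x. h x * f x) integrable_on {a..b}"
    by (rule set_lebesgue_integral_eq_integral(1)[OF continuous_times_integrable[OF h f]])
  show "\<exists>no. \<forall>N\<ge>no. dist (tagged_sum \<tau> h F a b N) (integral {a..b} (\<lambda>x. h x * f x)) < e"
  proof (intro exI allI impI)
    fix N assume N: "N \<ge> N0"
    then have N0': "0 < N" using N0 by blast
    let ?J = "\<lambda>k. {grid a b N k..grid a b N (Suc k)}"
    have cell: "norm (h (\<tau> N k) * (F (grid a b N (Suc k)) - F (grid a b N k)) - integral (?J k) (\<lambda>x. h x * f x))
        \<le> \<epsilon> * integral (?J k) (\<lambda>x. norm (f x))" if k: "k < N" for k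
    proof -
      have g: "a \<le> grid a b N k" "grid a b N k \<le> grid a b N (Suc k)" "grid a b N (Suc k) \<le> b"
        using ab k by (auto simp: grid_ge grid_mono grid_le)
      have i1: "f integrable_on ?J k" by (rule integrable_lebesgue_imp_HK[OF f])
      have i2: "(\<lambda>x. h x * f x) integrable_on ?J k" by (rule integrable_on_subinterval[OF hf]) (use g in auto)
      have i3: "(\<lambda>x. h (\<tau> N k) * f x) integrable_on ?J k" by (rule integrable_on_mult_right[OF i1])
      have eq: "h (\<tau> N k) * (F (grid a b N (Suc k)) - F (grid a b N k)) - integral (?J k) (\<lambda>x. h x * f x) =
          integral (?J k) (\<lambda>x. h (\<tau> N k) * f x - h x * f x)"
        using F[OF g] Henstock_Kurzweil_Integration.integral_diff[OF i3 i2] by simp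
      have "norm (integral (?J k) (\<lambda>x. h (\<tau> N k) * f x - h x * f x)) \<le> integral (?J k) (\<lambda>x. \<epsilon> * norm (f x))"
      proof (rule integral_norm_bound_integral)
        show "(\<lambda>x. h (\<tau> N k) * f x - h x * f x) integrable_on ?J k" by (rule integrable_diff[OF i3 i2])
        show "(\<lambda>x. \<epsilon> * norm (f x)) integrable_on ?J k" by (rule integrable_on_mult_right[OF fn])
        fix x assume "x \<in> ?J k"
        then have "norm (h (\<tau> N k) - h x) \<le> \<epsilon>" using N0[OF N] k by blast
        then show "norm (h (\<tau> N k) * f x - h x * f x) \<le> \<epsilon> * norm (f x)"
          by (simp add: norm_mult mult_right_mono flip: left_diff_distrib)
      qed
      then show ?thesis unfolding eq by simp
    qed
    have "dist (tagged_sum \<tau> h F a b N) (integral {a..b} (\<lambda>x. h x * f x)) =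
      norm (\<Sum>k<N. h (\<tau> N k) * (F (grid a b N (Suc k)) - F (grid a b N k)) - integral (?J k) (\<lambda>x. h x * f x))"
      unfolding dist_norm tagged_sum_def split[OF N0' hf, symmetric] by (simp add: sum_subtractf)
    also have "\<dots> \<le> (\<Sum>k<N. \<epsilon> * integral (?J k) (\<lambda>x. norm (f x)))"
      by (rule sum_norm_le) (use cell in auto)
    also have "\<dots> = \<epsilon> * V"
      using split[OF N0' fn] by (simp add: V_def flip: sum_distrib_left)
    also note \<epsilon>(2)
    finally show "dist (tagged_sum \<tau> h F a b N) (integral {a..b} (\<lambda>x. h x * f x)) < e" .
  qed
qed

section \<open>Bounded functionals on p-integrable functions\<close>

definition Lp_bs :: "real \<Rightarrow> (real \<Rightarrow> complex) set" where
  "Lp_bs p = {h. h \<in> Lp p lebesgue \<and> bounded_support h}"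

lemma bounded_support_subset:
  assumes "bounded_support h" "\<And>s. h s = 0 \<Longrightarrow> h' s = 0"
  shows "bounded_support h'"
  using assms unfolding bounded_support_def by blast

lemma bounded_support_add:
  assumes "bounded_support h" "bounded_support h'"
  shows "bounded_support (\<lambda>s. h s + h' s)"
proof -
  obtain R1 where R1: "\<And>s. s \<notin> {-R1..R1} \<Longrightarrow> h s = 0" using assms(1) unfolding bounded_support_def by blast
  obtain R2 where R2: "\<And>s. s \<notin> {-R2..R2} \<Longrightarrow> h' s = 0" using assms(2) unfolding bounded_support_def by blast
  show ?thesis unfolding bounded_support_def
    by (rule exI[of _ "max R1 R2"]) (use R1 R2 in \<open>auto simp: not_le max_def split: if_splits\<close>)
qed

lemma linear_complex_mult: "linear (\<lambda>z. c * z :: complex)"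
  using bounded_linear.linear[OF bounded_linear_mult_right] by auto

lemma Lp_bs_add: "0 \<le> p \<Longrightarrow> h \<in> Lp_bs p \<Longrightarrow> h' \<in> Lp_bs p \<Longrightarrow> (\<lambda>s. h s + h' s) \<in> Lp_bs p"
  by (auto simp: Lp_bs_def intro: Lp_add bounded_support_add)

lemma Lp_bs_cmult:
  assumes "0 \<le> p" "h \<in> Lp_bs p" shows "(\<lambda>s. c * h s) \<in> Lp_bs p"
  using assms Lp_linear_image[OF _ assms(1) linear_complex_mult[of c], of h lebesgue]
    bounded_support_subset[of h "\<lambda>s. c * h s"] by (auto simp: Lp_bs_def)

lemma Lp_bs_zero: "(\<lambda>_. 0) \<in> Lp_bs p"
  by (auto simp: Lp_bs_def Lp_def bounded_support_def)

lemma Lp_bs_sum: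
  assumes p: "0 \<le> p" and "\<And>i. i \<in> I \<Longrightarrow> h i \<in> Lp_bs p"
  shows "(\<lambda>s. \<Sum>i\<in>I. h i s) \<in> Lp_bs p"
  using assms(2)
proof (induction I rule: infinite_finite_induct)
  case (insert x F)
  then show ?case using Lp_bs_add[OF p, of "h x" "\<lambda>s. \<Sum>i\<in>F. h i s"] by simp
qed (simp_all add: Lp_bs_zero)

lemma Lp_bs_zero_ext:
  assumes "continuous_on {a..b} h" "0 \<le> p"
  shows "zero_ext {a<..b} h \<in> Lp_bs p"
proof -
  obtain K where K: "\<And>x. x \<in> {a..b} \<Longrightarrow> norm (h x) \<le> K"
    using compact_imp_bounded[OF compact_continuous_image[OF assms(1) compact_Icc]] unfolding bounded_iff by blast
  have S: "{a<..b} \<in> sets lebesgue" by simp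
  have m: "h \<in> borel_measurable (lebesgue_on {a<..b})"
    by (rule continuous_imp_measurable_on_sets_lebesgue[OF continuous_on_subset[OF assms(1)]]) auto
  have fin: "finite_measure (lebesgue_on {a<..b})"
    by (rule Lebesgue_Measure.finite_measure_lebesgue_on) (auto intro!: bounded_set_imp_lmeasurable)
  have "h \<in> Lp p (lebesgue_on {a<..b})"
    using K by (intro bounded_measurable_Lp[OF fin m assms(2), of K]) auto
  then have "zero_ext {a<..b} h \<in> Lp p lebesgue" by (rule Lp_zero_ext(1)[OF S])
  moreover have "bounded_support (zero_ext {a<..b} h)"
    by (rule bounded_support_subset[OF bounded_support_zero_ext[of a b "\<lambda>_. 1"]]) (auto simp: zero_ext_def split: if_splits)
  ultimately show ?thesis by (simp add: Lp_bs_def)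
qed

text \<open>Half-open intervals make indicator functions exactly additive, without exceptional points.\<close>

abbreviation Ioc_ind :: "real \<Rightarrow> real \<Rightarrow> real \<Rightarrow> complex" where
  "Ioc_ind c d \<equiv> zero_ext {c<..d} (\<lambda>_. 1)"

lemma Ioc_ind_Lp_bs: "0 \<le> p \<Longrightarrow> Ioc_ind c d \<in> Lp_bs p"
  by (intro Lp_bs_zero_ext) auto

lemma Ioc_ind_split: "a \<le> c \<Longrightarrow> c \<le> d \<Longrightarrow> Ioc_ind a d s = Ioc_ind a c s + Ioc_ind c d s"
  by (auto simp: zero_ext_def)

text \<open>A bounded linear functional on the \<open>p\<close>-integrable functions of bounded support is represented by a
density, the derivative of \<open>t \<mapsto> \<Psi> (1\<^bsub>(a, t]\<^esub>)\<close>. What is needed of this representation is that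
this primitive is absolutely continuous and reproduces \<open>\<Psi>\<close> on continuous functions through
Stieltjes sums.\<close>

locale Lp_functional =
  fixes p C :: real and \<Psi> :: "(real \<Rightarrow> complex) \<Rightarrow> complex"
  assumes p: "1 < p" and C: "0 \<le> C"
    and add: "h \<in> Lp_bs p \<Longrightarrow> h' \<in> Lp_bs p \<Longrightarrow> \<Psi> (\<lambda>s. h s + h' s) = \<Psi> h + \<Psi> h'"
    and cmult: "h \<in> Lp_bs p \<Longrightarrow> \<Psi> (\<lambda>s. c * h s) = c * \<Psi> h"
    and bound: "h \<in> Lp_bs p \<Longrightarrow> norm (\<Psi> h) \<le> C * Lp_seminorm p lebesgue h"
begin

lemma p0: "0 \<le> p" "0 < p" using p by auto

lemma zero: "\<Psi> (\<lambda>_. 0) = 0"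
  using cmult[OF Lp_bs_zero, of 0] by simp

lemma sum:
  assumes "\<And>i. i \<in> I \<Longrightarrow> h i \<in> Lp_bs p"
  shows "\<Psi> (\<lambda>s. \<Sum>i\<in>I. h i s) = (\<Sum>i\<in>I. \<Psi> (h i))"
  using assms
proof (induction I rule: infinite_finite_induct)
  case (insert x F)
  then show ?case using add[of "h x" "\<lambda>s. \<Sum>i\<in>F. h i s"] Lp_bs_sum[OF p0(1), of F h] by simp
qed (simp_all add: zero)

definition primitive :: "real \<Rightarrow> real \<Rightarrow> complex" where
  "primitive a t = \<Psi> (Ioc_ind a t)"

lemma primitive_diff:
  assumes "a \<le> c" "c \<le> d"
  shows "primitive a d - primitive a c = \<Psi> (Ioc_ind c d)"
proof -
  have "Ioc_ind a d = (\<lambda>s. Ioc_ind a c s + Ioc_ind c d s)"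
    using Ioc_ind_split[OF assms] by auto
  then show ?thesis
    unfolding primitive_def using add[OF Ioc_ind_Lp_bs[OF p0(1)] Ioc_ind_Lp_bs[OF p0(1)], of a c c d] by simp
qed

text \<open>At every point at most one of the indicator functions is different from \<open>0\<close>.\<close>

lemma step_function_norm:
  assumes D: "D division_of \<Union>D" and c: "\<And>K. K \<in> D \<Longrightarrow> norm (c K) \<le> 1"
  shows "Lp_seminorm p lebesgue (\<lambda>s. \<Sum>K\<in>D. c K * Ioc_ind (Inf K) (Sup K) s) \<le> (\<Sum>K\<in>D. Sup K - Inf K) powr (1 / p)"
proof -
  let ?h = "\<lambda>s. \<Sum>K\<in>D. c K * Ioc_ind (Inf K) (Sup K) s"
  have fin: "finite D" using D by blast
  have K: "K = {Inf K..Sup K} \<and> Inf K \<le> Sup K" if K: "K \<in> D" for K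
  proof -
    obtain x y where "K = cbox x y" "K \<noteq> {}" using division_ofD(3,4)[OF D K] by blast
    then show ?thesis by auto
  qed
  have one: "K = L" if "K \<in> D" "L \<in> D" "s \<in> {Inf K<..Sup K}" "s \<in> {Inf L<..Sup L}" for K L s
  proof (rule ccontr)
    assume "K \<noteq> L"
    then have "interior K \<inter> interior L = {}" using division_ofD(5)[OF D that(1,2)] by simp
    moreover have "interior K = {Inf K<..<Sup K}" "interior L = {Inf L<..<Sup L}"
      using K[OF that(1), THEN conjunct1, THEN arg_cong[where f=interior]]
        K[OF that(2), THEN conjunct1, THEN arg_cong[where f=interior]]
      by (simp_all only: interior_atLeastAtMost_real)
    moreover have "max (Inf K) (Inf L) < s" using that by simp
    then obtain x where "max (Inf K) (Inf L) < x" "x < s"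
      using dense by blast
    ultimately show False using that(3,4) by auto
  qed
  have pt: "norm (?h s) powr p \<le> (\<Sum>K\<in>D. indicator {Inf K<..Sup K} s)" for s
  proof (cases "\<exists>K\<in>D. s \<in> {Inf K<..Sup K}")
    case True
    then obtain L where L: "L \<in> D" "s \<in> {Inf L<..Sup L}" by blast
    have "?h s = (\<Sum>K\<in>D. if K = L then c L else 0)"
    proof (intro sum.cong refl)
      fix K assume KD: "K \<in> D"
      show "c K * Ioc_ind (Inf K) (Sup K) s = (if K = L then c L else 0)"
      proof (cases "K = L")
        case True
        then show ?thesis using L(2) by (simp add: zero_ext_def)
      next
        case False
        then have "s \<notin> {Inf K<..Sup K}" using one[OF KD L(1) _ L(2)] by blast
        then have "Ioc_ind (Inf K) (Sup K) s = 0" unfolding zero_ext_def by (rule if_not_P)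
        then show ?thesis using False by simp
      qed
    qed
    then have "?h s = c L" using fin L by simp
    then have "norm (?h s) powr p \<le> 1" using c[OF L(1)] p0 by (simp add: powr_le1)
    moreover have "indicator {Inf L<..Sup L} s \<le> (\<Sum>K\<in>D. indicator {Inf K<..Sup K} s :: real)"
      by (rule member_le_sum[OF L(1) _ fin]) auto
    ultimately show ?thesis using L(2) by simp
  next
    case False
    then have "?h s = 0" by (intro sum.neutral) (auto simp: zero_ext_def)
    then show ?thesis using p0 by (simp add: sum_nonneg)
  qed
  have hL: "?h \<in> Lp_bs p"
    by (intro Lp_bs_sum Lp_bs_cmult Ioc_ind_Lp_bs p0)
  have ii: "integrable lebesgue (indicator {Inf K<..Sup K} :: real \<Rightarrow> real)" for K :: "real set"
    by (intro lmeasurable_iff_integrable[THEN iffD1] bounded_set_imp_lmeasurable) auto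
  have "(LINT s|lebesgue. norm (?h s) powr p) \<le> (LINT s|lebesgue. (\<Sum>K\<in>D. indicator {Inf K<..Sup K} s))"
    using hL ii pt by (intro integral_mono Bochner_Integration.integrable_sum) (auto simp: Lp_bs_def LpD)
  also have "\<dots> = (\<Sum>K\<in>D. measure lebesgue {Inf K<..Sup K})"
    using ii by (subst Bochner_Integration.integral_sum) auto
  also have "\<dots> = (\<Sum>K\<in>D. Sup K - Inf K)"
    using K[THEN conjunct2] by (intro sum.cong refl) simp
  finally show ?thesis
    unfolding Lp_seminorm_def using p0 by (intro powr_mono2) (auto intro!: integral_nonneg_AE)
qed

text \<open>Unimodular coefficients turn the sum of the norms of the increments into the value of \<open>\<Psi>\<close> at one
step function, whose norm is at most a power of the total length of the intervals.\<close>

lemma primitive_abs_continuous: "abs_continuous_on (primitive a) a b"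
  unfolding abs_continuous_on_def
proof (intro allI impI)
  fix \<epsilon> :: real assume e: "\<epsilon> > 0"
  define \<delta> where "\<delta> = (\<epsilon> / (C + 1)) powr p"
  have d: "\<delta> > 0" using e C by (simp add: \<delta>_def)
  show "\<exists>\<delta>>0. \<forall>D. D division_of \<Union>D \<longrightarrow> \<Union>D \<subseteq> {a..b} \<longrightarrow> (\<Sum>K\<in>D. Sup K - Inf K) < \<delta> \<longrightarrow>
        (\<Sum>K\<in>D. norm (primitive a (Sup K) - primitive a (Inf K))) < \<epsilon>"
  proof (intro exI[of _ \<delta>] conjI allI impI d)
    fix D assume D: "D division_of \<Union>D" and sub: "\<Union>D \<subseteq> {a..b}" and len: "(\<Sum>K\<in>D. Sup K - Inf K) < \<delta>"
    have K: "a \<le> Inf K" "Inf K \<le> Sup K" if K: "K \<in> D" for K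
    proof -
      obtain x y where xy: "K = cbox x y" "K \<noteq> {}" using division_ofD(3,4)[OF D K] by blast
      moreover from this have "x \<in> K" by auto
      then have "x \<in> {a..b}" using sub K by blast
      ultimately show "a \<le> Inf K" "Inf K \<le> Sup K" by auto
    qed
    define c where "c K = cnj (sgn (\<Psi> (Ioc_ind (Inf K) (Sup K))))" for K
    have c1: "norm (c K) \<le> 1" for K by (simp add: c_def norm_sgn)
    have cz: "cnj (sgn z) * z = of_real (norm z)" for z :: complex
    proof -
      have "cnj (sgn z) * z = z * cnj z / of_real (norm z)"
        by (simp add: sgn_eq complex_cnj_divide)
      also have "\<dots> = of_real (norm z)"
        by (cases "z = 0") (simp_all add: complex_norm_square[symmetric] power2_eq_square)
      finally show ?thesis .
    qed
    have "complex_of_real (\<Sum>K\<in>D. norm (primitive a (Sup K) - primitive a (Inf K))) =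
        (\<Sum>K\<in>D. c K * \<Psi> (Ioc_ind (Inf K) (Sup K)))"
      unfolding of_real_sum
      by (intro sum.cong refl) (simp add: primitive_diff[OF K] c_def cz)
    also have "\<dots> = \<Psi> (\<lambda>s. \<Sum>K\<in>D. c K * Ioc_ind (Inf K) (Sup K) s)"
      by (simp add: sum cmult Lp_bs_cmult Ioc_ind_Lp_bs p0)
    finally have "complex_of_real (\<Sum>K\<in>D. norm (primitive a (Sup K) - primitive a (Inf K))) =
        \<Psi> (\<lambda>s. \<Sum>K\<in>D. c K * Ioc_ind (Inf K) (Sup K) s)" .
    from arg_cong[OF this, of norm]
    have eq: "(\<Sum>K\<in>D. norm (primitive a (Sup K) - primitive a (Inf K))) =
        norm (\<Psi> (\<lambda>s. \<Sum>K\<in>D. c K * Ioc_ind (Inf K) (Sup K) s))"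
      by (simp only: norm_of_real abs_of_nonneg[OF sum_nonneg[OF norm_ge_zero]])
    have "norm (\<Psi> (\<lambda>s. \<Sum>K\<in>D. c K * Ioc_ind (Inf K) (Sup K) s)) \<le>
        C * Lp_seminorm p lebesgue (\<lambda>s. \<Sum>K\<in>D. c K * Ioc_ind (Inf K) (Sup K) s)"
      by (intro bound Lp_bs_sum Lp_bs_cmult Ioc_ind_Lp_bs p0)
    also have "\<dots> \<le> C * (\<Sum>K\<in>D. Sup K - Inf K) powr (1 / p)"
      using C c1 by (intro mult_left_mono step_function_norm[OF D]) auto
    also have "\<dots> \<le> C * \<delta> powr (1 / p)"
      using C len K p0 by (intro mult_left_mono powr_mono2) (auto intro!: sum_nonneg)
    also have "\<delta> powr (1 / p) = \<epsilon> / (C + 1)"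
      using e C p0 by (simp add: \<delta>_def powr_powr)
    also have "C * (\<epsilon> / (C + 1)) < \<epsilon>" using e C by (simp add: field_simps)
    finally show "(\<Sum>K\<in>D. norm (primitive a (Sup K) - primitive a (Inf K))) < \<epsilon>" unfolding eq .
  qed
qed

text \<open>The Stieltjes sum is the value of \<open>\<Psi>\<close> at a step function that approximates \<open>h\<close> uniformly
on \<open>(a, b]\<close>.\<close>

lemma tagged_sum_tendsto:
  assumes h: "continuous_on {a..b} h" and \<tau>: "grid_tags a b \<tau>" and ab: "a \<le> b"
  shows "tagged_sum \<tau> h (primitive a) a b \<longlonglongrightarrow> \<Psi> (zero_ext {a<..b} h)"
proof (rule metric_LIMSEQ_I)
  fix e :: real assume "e > 0"
  define V where "V = C * Lp_seminorm p lebesgue (Ioc_ind a b)"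
  have V: "0 \<le> V" using C by (simp add: V_def)
  define \<epsilon> where "\<epsilon> = e / (V + 1)"
  have \<epsilon>: "\<epsilon> > 0" "\<epsilon> * V < e" using \<open>e > 0\<close> V by (auto simp: \<epsilon>_def field_simps)
  obtain N0 where N0: "\<And>N k x. N0 \<le> N \<Longrightarrow> 0 < N \<and> (k < N \<longrightarrow> x \<in> {grid a b N k..grid a b N (Suc k)} \<longrightarrow>
     norm (h (\<tau> N k) - h x) \<le> \<epsilon>)" using grid_tags_close[OF h \<tau> ab \<epsilon>(1)] by blast
  let ?z = "zero_ext {a<..b} h"
  have zL: "?z \<in> Lp_bs p" by (rule Lp_bs_zero_ext[OF h p0(1)])
  show "\<exists>no. \<forall>N\<ge>no. dist (tagged_sum \<tau> h (primitive a) a b N) (\<Psi> ?z) < e"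
  proof (intro exI allI impI)
    fix N assume N: "N \<ge> N0"
    then have N': "0 < N" using N0 by blast
    let ?I = "\<lambda>k. Ioc_ind (grid a b N k) (grid a b N (Suc k))"
    define s where "s x = (\<Sum>k<N. h (\<tau> N k) * ?I k x)" for x
    have sL: "s \<in> Lp_bs p" unfolding s_def[abs_def] by (intro Lp_bs_sum Lp_bs_cmult Ioc_ind_Lp_bs p0)
    have "tagged_sum \<tau> h (primitive a) a b N = (\<Sum>k<N. h (\<tau> N k) * \<Psi> (?I k))"
      unfolding tagged_sum_def using ab by (intro sum.cong refl) (simp add: primitive_diff grid_ge grid_mono)
    also have "\<dots> = \<Psi> s"
      unfolding s_def[abs_def] by (simp add: sum cmult Lp_bs_cmult Ioc_ind_Lp_bs p0)
    finally have eq1: "tagged_sum \<tau> h (primitive a) a b N = \<Psi> s" .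
    have dL: "(\<lambda>x. s x + (- 1) * ?z x) \<in> Lp_bs p"
      by (rule Lp_bs_add[OF p0(1) sL Lp_bs_cmult[OF p0(1) zL]])
    have eq2: "\<Psi> s - \<Psi> ?z = \<Psi> (\<lambda>x. s x + (- 1) * ?z x)"
      using add[OF sL Lp_bs_cmult[OF p0(1) zL, of "- 1"]] cmult[OF zL, of "- 1"] by simp
    have pt: "norm (s x + (- 1) * ?z x) \<le> norm (complex_of_real \<epsilon> * Ioc_ind a b x)" for x
    proof -
      have tel: "(\<Sum>k<N. ?I k x) = Ioc_ind a b x"
      proof -
        have "(\<Sum>k<N. ?I k x) = (\<Sum>k<N. Ioc_ind a (grid a b N (Suc k)) x - Ioc_ind a (grid a b N k) x)"
        proof (intro sum.cong refl)
          fix k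
          show "?I k x = Ioc_ind a (grid a b N (Suc k)) x - Ioc_ind a (grid a b N k) x"
            using Ioc_ind_split[OF grid_ge[OF ab] grid_mono[OF ab, of k "Suc k"], of N x] by simp
        qed
        then show ?thesis using grid_telescope[OF N', of "\<lambda>y. Ioc_ind a y x" a b] by (simp add: zero_ext_def)
      qed
      have z: "?z x = Ioc_ind a b x * h x" by (simp add: zero_ext_def)
      have eq: "s x + (- 1) * ?z x = (\<Sum>k<N. ?I k x * (h (\<tau> N k) - h x))"
      proof -
        have "(\<Sum>k<N. ?I k x * (h (\<tau> N k) - h x)) = (\<Sum>k<N. h (\<tau> N k) * ?I k x - ?I k x * h x)"
          by (intro sum.cong refl) (simp add: algebra_simps)
        then show ?thesis
          unfolding s_def z tel[symmetric] sum_distrib_right by (simp add: sum_subtractf)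
      qed
      have "norm (\<Sum>k<N. ?I k x * (h (\<tau> N k) - h x)) \<le> (\<Sum>k<N. Re (?I k x) * \<epsilon>)"
      proof (rule sum_norm_le)
        fix k assume "k \<in> {..<N}"
        then have "x \<in> {grid a b N k<..grid a b N (Suc k)} \<Longrightarrow> norm (h (\<tau> N k) - h x) \<le> \<epsilon>"
          using N0[OF N, of k x] by auto
        then show "norm (?I k x * (h (\<tau> N k) - h x)) \<le> Re (?I k x) * \<epsilon>"
          by (simp add: zero_ext_def)
      qed
      also have "\<dots> = Re (Ioc_ind a b x) * \<epsilon>" by (simp flip: sum_distrib_right Re_sum tel)
      also have "\<dots> = norm (complex_of_real \<epsilon> * Ioc_ind a b x)" using \<epsilon>(1) by (simp add: zero_ext_def)
      finally show ?thesis unfolding eq .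
    qed
    have cI: "(\<lambda>x. complex_of_real \<epsilon> * Ioc_ind a b x) \<in> Lp p lebesgue"
      using Lp_bs_cmult[OF p0(1) Ioc_ind_Lp_bs[OF p0(1)]] by (simp add: Lp_bs_def)
    have "norm (\<Psi> s - \<Psi> ?z) \<le> C * Lp_seminorm p lebesgue (\<lambda>x. s x + (- 1) * ?z x)"
      unfolding eq2 by (rule bound[OF dL])
    also have "\<dots> \<le> C * Lp_seminorm p lebesgue (\<lambda>x. complex_of_real \<epsilon> * Ioc_ind a b x)"
    proof (rule mult_left_mono[OF _ C], rule Lp_dominated(2)[OF cI _ p0(1) pt])
      show "(\<lambda>x. s x + (- 1) * ?z x) \<in> borel_measurable lebesgue"
        using dL by (auto simp: Lp_bs_def dest: LpD(1))
    qed
    also have "Lp_seminorm p lebesgue (\<lambda>x. complex_of_real \<epsilon> * Ioc_ind a b x) = \<epsilon> * Lp_seminorm p lebesgue (Ioc_ind a b)"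
      unfolding Lp_seminorm_def using \<epsilon>(1) p0 by (simp add: norm_mult powr_mult powr_powr)
    also have "C * (\<epsilon> * Lp_seminorm p lebesgue (Ioc_ind a b)) < e"
      using \<epsilon>(2) by (simp add: V_def mult_ac)
    finally show "dist (tagged_sum \<tau> h (primitive a) a b N) (\<Psi> ?z) < e"
      unfolding dist_norm eq1 .
  qed
qed

end

section \<open>Translates\<close>

lemma Lp_imp_integrable:
  fixes f :: "real \<Rightarrow> 'a::euclidean_space"
  assumes M: "finite_measure M" and f: "f \<in> Lp p M" and p: "1 \<le> p"
  shows "integrable M f"
proof (rule Bochner_Integration.integrable_bound[where f="\<lambda>x. 1 + norm (f x) powr p"])
  show "integrable M (\<lambda>x. 1 + norm (f x) powr p)"
    using LpD(2)[OF f] finite_measure.integrable_const[OF M] by (intro Bochner_Integration.integrable_add)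
  show "f \<in> borel_measurable M" by (rule LpD(1)[OF f])
  have "norm (f x) \<le> 1 + norm (f x) powr p" for x
  proof (cases "norm (f x) \<le> 1")
    case True
    then show ?thesis using powr_ge_zero[of "norm (f x)" p] by linarith
  next
    case False
    then have "norm (f x) powr 1 \<le> norm (f x) powr p" using p by (intro powr_mono) auto
    then show ?thesis using False by simp
  qed
  then show "AE x in M. norm (f x) \<le> norm (1 + norm (f x) powr p)"
    by (intro AE_I2) (simp add: add_nonneg_nonneg)
qed

lemma translate_Lp:
  fixes w :: "real \<Rightarrow> 'a::euclidean_space"
  assumes w: "w \<in> Lp p (lebesgue_on {a..b})" and p: "0 \<le> p" and ct: "a \<le> t + c" "t + d \<le> b"
  shows "translate w t \<in> Lp p (lebesgue_on {c..d})"
proof -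
  let ?w = "\<lambda>s. zero_ext {a..b} w (t + 1 * s)"
  have wL: "?w \<in> Lp p lebesgue"
    by (rule Lp_affine(1)[OF Lp_zero_ext(1)[OF Icc_sets_lebesgue w]]) simp
  have eq: "zero_ext {c..d} (translate w t) = (\<lambda>s. if s \<in> {c..d} then ?w s else 0)"
    using ct by (auto simp: zero_ext_def translate_def fun_eq_iff)
  have "?w \<in> borel_measurable (lebesgue_on {c..d})"
    using LpD(1)[OF wL] by (rule measurable_restrict_space1)
  then have "zero_ext {c..d} (translate w t) \<in> borel_measurable lebesgue"
    unfolding eq by (rule borel_measurable_if_I) (rule Icc_sets_lebesgue)
  then have "zero_ext {c..d} (translate w t) \<in> Lp p lebesgue"
    by (rule Lp_dominated(1)[OF wL _ p]) (auto simp: eq)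
  then show ?thesis by (simp only: Lp_zero_ext_iff[OF Icc_sets_lebesgue])
qed

text \<open>The integrals of the histories enter as correlations with an indicator function, with \<open>w\<close> extended
by zero; replacing \<open>[\<alpha>, t]\<close> by \<open>(\<alpha>, t]\<close> changes the integrand at one point only.\<close>

lemma integral_translate_component:
  fixes w :: "real \<Rightarrow> complex ^ 'n"
  assumes w: "w \<in> Lp p (lebesgue_on {a..b})" and p: "1 \<le> p" and r: "a \<le> \<alpha> + \<theta>" "t + \<theta> \<le> b"
  shows "integral_translate \<alpha> t w \<theta> $ i =
    (LINT s|lebesgue. Ioc_ind \<alpha> t s * zero_ext {a..b} (\<lambda>x. w x $ i) (s + \<theta>))"
proof -
  let ?f = "\<lambda>s. indicat_real {\<alpha>..t} s *\<^sub>R w (s + \<theta>)"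
  have "integrable (lebesgue_on {a..b}) w"
    by (rule Lp_imp_integrable[OF finite_measure_lebesgue_on_Icc w p])
  then have "integrable lebesgue (zero_ext {a..b} w)"
    unfolding zero_ext_def[abs_def] by (subst Lebesgue_Measure.integrable_restrict_UNIV[OF Icc_sets_lebesgue])
  from lebesgue_integrable_real_affine[OF this, of 1 \<theta>]
  have "integrable lebesgue (\<lambda>s. indicat_real {\<alpha>..t} s *\<^sub>R zero_ext {a..b} w (\<theta> + 1 * s))"
    by (intro integrable_mult_indicator) auto
  moreover have "(\<lambda>s. indicat_real {\<alpha>..t} s *\<^sub>R zero_ext {a..b} w (\<theta> + 1 * s)) = ?f"
    using r by (auto simp: indicator_def zero_ext_def add.commute fun_eq_iff)
  ultimately have i: "integrable lebesgue ?f" by (simp only:)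
  have "integral_translate \<alpha> t w \<theta> $ i = (LINT s|lebesgue. ?f s $ i)"
    unfolding integral_translate_def set_lebesgue_integral_def
    by (rule integral_bounded_linear[OF bounded_linear_vec_nth i, symmetric])
  also have "\<dots> = (LINT s|lebesgue. Ioc_ind \<alpha> t s * zero_ext {a..b} (\<lambda>x. w x $ i) (s + \<theta>))"
  proof (rule integral_cong_AE)
    show 1: "(\<lambda>s. ?f s $ i) \<in> borel_measurable lebesgue"
      using borel_measurable_integrable[OF integrable_bounded_linear[OF bounded_linear_vec_nth i]] .
    have "{\<alpha>} \<in> null_sets lebesgue" by (simp flip: negligible_iff_null_sets)
    then have "AE s in lebesgue. s \<notin> {\<alpha>}" by (rule AE_not_in)
    then show 2: "AE s in lebesgue. ?f s $ i = Ioc_ind \<alpha> t s * zero_ext {a..b} (\<lambda>x. w x $ i) (s + \<theta>)"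
      by (rule AE_mp) (use r in \<open>auto intro!: AE_I2 simp: indicator_def zero_ext_def\<close>)
    show "(\<lambda>s. Ioc_ind \<alpha> t s * zero_ext {a..b} (\<lambda>x. w x $ i) (s + \<theta>)) \<in> borel_measurable lebesgue"
      by (rule borel_measurable_AE[OF 1 2])
  qed
  finally show ?thesis .
qed

section \<open>The functions U and V\<close>

context delay_form
begin

lemma T_le: "0 \<le> T 0 - T (-r)"
  using variation_majorant_mono[OF majorant, of "-r" 0] r by simp

lemma pairing_left_functional:
  assumes w: "w \<in> Lp_bs q"
  shows "Lp_functional p (Lp_seminorm q lebesgue w * (T 0 - T (-r))) (pairing i j w)"
proof
  fix h h' :: "real \<Rightarrow> complex" and c
  assume h: "h \<in> Lp_bs p" and h': "h' \<in> Lp_bs p"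
  show "pairing i j w (\<lambda>s. h s + h' s) = pairing i j w h + pairing i j w h'"
    using w h h' by (intro pairing_add_right) (auto simp: Lp_bs_def)
next
  fix h :: "real \<Rightarrow> complex" and c
  assume h: "h \<in> Lp_bs p"
  show "pairing i j w (\<lambda>s. c * h s) = c * pairing i j w h"
    using w h by (intro pairing_cmult) (auto simp: Lp_bs_def)
  show "norm (pairing i j w h) \<le> Lp_seminorm q lebesgue w * (T 0 - T (-r)) * Lp_seminorm p lebesgue h"
    using w h pairing_bound[of w h i j] by (simp add: Lp_bs_def mult_ac)
qed (use p T_le in auto)

lemma pairing_right_functional:
  assumes h: "h \<in> Lp_bs p"
  shows "Lp_functional q (Lp_seminorm p lebesgue h * (T 0 - T (-r))) (\<lambda>w. pairing i j w h)"
proof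
  fix w w' :: "real \<Rightarrow> complex" and c
  assume w: "w \<in> Lp_bs q" and w': "w' \<in> Lp_bs q"
  show "pairing i j (\<lambda>s. w s + w' s) h = pairing i j w h + pairing i j w' h"
    using w h w' by (intro pairing_add_left) (auto simp: Lp_bs_def)
next
  fix w :: "real \<Rightarrow> complex" and c
  assume w: "w \<in> Lp_bs q"
  show "pairing i j (\<lambda>s. c * w s) h = c * pairing i j w h"
    using w h by (intro pairing_cmult) (auto simp: Lp_bs_def)
  show "norm (pairing i j w h) \<le> Lp_seminorm p lebesgue h * (T 0 - T (-r)) * Lp_seminorm q lebesgue w"
    using w h pairing_bound[of w h i j] by (simp add: Lp_bs_def mult_ac)
qed (use q T_le in auto)

text \<open>The integral against \<open>d\<eta>\<^sub>i\<^sub>j\<close> only sees the sums of the correlations on \<open>[-r, 0]\<close>.\<close>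

lemma pairing_identity:
  assumes w: "w1 \<in> Lp_bs q" "w2 \<in> Lp_bs q" "w3 \<in> Lp_bs q" "w4 \<in> Lp_bs q"
    and h: "h1 \<in> Lp_bs p" "h2 \<in> Lp_bs p" "h3 \<in> Lp_bs p" "h4 \<in> Lp_bs p"
    and eq: "\<And>\<theta>. \<theta> \<in> {-r..0} \<Longrightarrow> corr w1 h1 \<theta> + corr w2 h2 \<theta> = corr w3 h3 \<theta> + corr w4 h4 \<theta>"
  shows "pairing i j w1 h1 + pairing i j w2 h2 = pairing i j w3 h3 + pairing i j w4 h4"
proof -
  have c: "continuous_on {-r..0} (corr w h)" if "w \<in> Lp_bs q" "h \<in> Lp_bs p" for w h
    using that by (intro corr_continuous_bounded_support) (auto simp: Lp_bs_def)
  have s: "pairing i j w h + pairing i j w' h' =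
      rs_integral (-r) 0 (\<lambda>\<theta>. corr w h \<theta> + corr w' h' \<theta>) (\<lambda>\<theta>. \<eta> \<theta> $ i $ j)"
    if "w \<in> Lp_bs q" "h \<in> Lp_bs p" "w' \<in> Lp_bs q" "h' \<in> Lp_bs p" for w h w' h'
    unfolding pairing_def using r that
    by (intro rs_integral_add[OF c c entry_majorant, symmetric]) auto
  show ?thesis
    unfolding s[OF w(1) h(1) w(2) h(2)] s[OF w(3) h(3) w(4) h(4)] by (rule rs_integral_cong[OF eq])
qed

end

text \<open>Substitution of \<open>s = t + \<xi>\<close>. For \<open>\<theta>\<close> in \<open>[-r, 0]\<close>, the four constraints that come from the supports
amount to \<open>t + \<theta> \<le> s \<le> t\<close>.\<close>

lemma corr_Icc_translate:
  fixes v u :: "real \<Rightarrow> complex"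
  assumes t: "\<alpha> \<le> t" "t \<le> \<beta>" and \<theta>: "\<theta> \<in> {-r..0}"
  shows "corr (zero_ext {0..r} (\<lambda>x. v (t + x))) (zero_ext {-r..0} (\<lambda>x. u (t + x))) \<theta> =
    (LINT s|lebesgue. zero_ext {t + \<theta>..t} (\<lambda>_. 1) s *
       (zero_ext {\<alpha>..\<beta> + r} v (s - \<theta>) * zero_ext {\<alpha> - r..\<beta>} u s))"
proof -
  let ?f = "\<lambda>s. zero_ext {t + \<theta>..t} (\<lambda>_. 1) s * (zero_ext {\<alpha>..\<beta> + r} v (s - \<theta>) * zero_ext {\<alpha> - r..\<beta>} u s)"
  have "(LINT s|lebesgue. ?f s) = (LINT s|lebesgue. ?f (t + s))"
    using lebesgue_integral_real_affine[of 1 ?f t] by simp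
  moreover have "?f (t + s) = zero_ext {0..r} (\<lambda>x. v (t + x)) (s - \<theta>) * zero_ext {-r..0} (\<lambda>x. u (t + x)) s" for s
    using t \<theta> by (auto simp: zero_ext_def add_diff_eq)
  ultimately show ?thesis unfolding corr_def by simp
qed

text \<open>All four terms are integrals of the same function \<open>s \<mapsto> v (s - \<theta>) * u s\<close>: those on the left over
\<open>[\<beta> + \<theta>, \<beta>]\<close> and \<open>(\<alpha> + \<theta>, \<beta> + \<theta>]\<close>, those on the right over \<open>(\<alpha>, \<beta>]\<close> and \<open>[\<alpha> + \<theta>, \<alpha>]\<close>. Up to end
points, either pair makes up \<open>[\<alpha> + \<theta>, \<beta>]\<close>.\<close>

lemma (in conjugate_exponents) corr_increment:
  fixes v u :: "real \<Rightarrow> complex"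
  assumes \<alpha>\<beta>: "\<alpha> \<le> \<beta>" and \<theta>: "\<theta> \<in> {-r..0}"
    and v: "zero_ext {\<alpha>..\<beta> + r} v \<in> Lp q lebesgue" and u: "zero_ext {\<alpha> - r..\<beta>} u \<in> Lp p lebesgue"
  shows "corr (zero_ext {0..r} (\<lambda>x. v (\<beta> + x))) (zero_ext {-r..0} (\<lambda>x. u (\<beta> + x))) \<theta> +
      corr (zero_ext {\<alpha><..\<beta>} v) (zero_ext {\<alpha> - r..\<beta>} u) \<theta> =
    corr (zero_ext {\<alpha>..\<beta> + r} v) (zero_ext {\<alpha><..\<beta>} u) \<theta> +
      corr (zero_ext {0..r} (\<lambda>x. v (\<alpha> + x))) (zero_ext {-r..0} (\<lambda>x. u (\<alpha> + x))) \<theta>"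
proof -
  let ?V = "\<lambda>s. zero_ext {\<alpha>..\<beta> + r} v (s - \<theta>) * zero_ext {\<alpha> - r..\<beta>} u s"
  let ?i = "\<lambda>S. zero_ext S (\<lambda>_. 1 :: complex)"
  have V: "integrable lebesgue ?V" by (rule corr_integrable[OF v u])
  have int: "integrable lebesgue (\<lambda>s. ?i S s * ?V s)" if "S \<in> sets lebesgue" for S
  proof -
    have "?i S s * ?V s = indicat_real S s *\<^sub>R ?V s" for s by (simp add: zero_ext_def)
    then show ?thesis using integrable_mult_indicator[OF that V] by simp
  qed
  have c1: "corr (zero_ext {0..r} (\<lambda>x. v (t + x))) (zero_ext {-r..0} (\<lambda>x. u (t + x))) \<theta> =
      (LINT s|lebesgue. ?i {t + \<theta>..t} s * ?V s)" if "\<alpha> \<le> t" "t \<le> \<beta>" for t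
    by (rule corr_Icc_translate[OF that \<theta>])
  have c2: "corr (zero_ext {\<alpha><..\<beta>} v) (zero_ext {\<alpha> - r..\<beta>} u) \<theta> =
      (LINT s|lebesgue. ?i {\<alpha> + \<theta><..\<beta> + \<theta>} s * ?V s)"
    unfolding corr_def using \<theta> by (intro Bochner_Integration.integral_cong refl) (auto simp: zero_ext_def)
  have c3: "corr (zero_ext {\<alpha>..\<beta> + r} v) (zero_ext {\<alpha><..\<beta>} u) \<theta> = (LINT s|lebesgue. ?i {\<alpha><..\<beta>} s * ?V s)"
    unfolding corr_def using \<theta> by (intro Bochner_Integration.integral_cong refl) (auto simp: zero_ext_def)
  have S: "{x..y::real} \<in> sets lebesgue" "{x<..y::real} \<in> sets lebesgue" for x y by auto
  have "(LINT s|lebesgue. ?i {\<beta> + \<theta>..\<beta>} s * ?V s + ?i {\<alpha> + \<theta><..\<beta> + \<theta>} s * ?V s) =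
      (LINT s|lebesgue. ?i {\<alpha><..\<beta>} s * ?V s + ?i {\<alpha> + \<theta>..\<alpha>} s * ?V s)"
  proof (rule integral_cong_AE)
    show "(\<lambda>s. ?i {\<beta> + \<theta>..\<beta>} s * ?V s + ?i {\<alpha> + \<theta><..\<beta> + \<theta>} s * ?V s) \<in> borel_measurable lebesgue"
      "(\<lambda>s. ?i {\<alpha><..\<beta>} s * ?V s + ?i {\<alpha> + \<theta>..\<alpha>} s * ?V s) \<in> borel_measurable lebesgue"
      by (intro borel_measurable_add borel_measurable_integrable int S)+
    have "{\<alpha> + \<theta>, \<beta> + \<theta>} \<in> null_sets lebesgue" by (simp flip: negligible_iff_null_sets)
    then have "AE s in lebesgue. s \<notin> {\<alpha> + \<theta>, \<beta> + \<theta>}" by (rule AE_not_in)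
    then show "AE s in lebesgue. ?i {\<beta> + \<theta>..\<beta>} s * ?V s + ?i {\<alpha> + \<theta><..\<beta> + \<theta>} s * ?V s =
        ?i {\<alpha><..\<beta>} s * ?V s + ?i {\<alpha> + \<theta>..\<alpha>} s * ?V s"
    proof (rule AE_mp, intro AE_I2 impI)
      fix s assume s: "s \<notin> {\<alpha> + \<theta>, \<beta> + \<theta>}"
      have "?i {\<beta> + \<theta>..\<beta>} s + ?i {\<alpha> + \<theta><..\<beta> + \<theta>} s = ?i {\<alpha><..\<beta>} s + ?i {\<alpha> + \<theta>..\<alpha>} s"
        using s \<theta> \<alpha>\<beta> by (auto simp: zero_ext_def)
      then show "?i {\<beta> + \<theta>..\<beta>} s * ?V s + ?i {\<alpha> + \<theta><..\<beta> + \<theta>} s * ?V s =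
          ?i {\<alpha><..\<beta>} s * ?V s + ?i {\<alpha> + \<theta>..\<alpha>} s * ?V s"
        by (simp only: distrib_right[symmetric])
    qed
  qed
  then show ?thesis
    unfolding c1[OF \<alpha>\<beta> order_refl] c1[OF order_refl \<alpha>\<beta>] c2 c3
    unfolding Bochner_Integration.integral_add[OF int[OF S(1)] int[OF S(2)]]
      Bochner_Integration.integral_add[OF int[OF S(2)] int[OF S(1)]] .
qed

lemma abs_continuous_on_cong:
  assumes "\<And>t. t \<in> {a..b} \<Longrightarrow> f t = g t" and f: "abs_continuous_on f a b"
  shows "abs_continuous_on g a b"
proof -
  have eq: "(\<Sum>K\<in>D. norm (f (Sup K) - f (Inf K))) = (\<Sum>K\<in>D. norm (g (Sup K) - g (Inf K)))"
    if D: "D division_of \<Union>D" "\<Union>D \<subseteq> {a..b}" for D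
  proof (intro sum.cong refl)
    fix K assume K: "K \<in> D"
    obtain x y where xy: "K = cbox x y" "K \<noteq> {}" using division_ofD(3,4)[OF D(1) K] by blast
    then have "x \<le> y" by simp
    moreover have "x \<in> K" "y \<in> K" using xy by auto
    then have "x \<in> {a..b}" "y \<in> {a..b}" using D(2) K by blast+
    ultimately show "norm (f (Sup K) - f (Inf K)) = norm (g (Sup K) - g (Inf K))"
      using assms(1) xy(1) by simp
  qed
  show ?thesis
    unfolding abs_continuous_on_def
  proof (intro allI impI)
    fix \<epsilon> :: real assume "\<epsilon> > 0"
    then obtain \<delta> where \<delta>: "\<delta> > 0" "\<And>D. D division_of \<Union>D \<Longrightarrow> \<Union>D \<subseteq> {a..b} \<Longrightarrow>
        (\<Sum>K\<in>D. Sup K - Inf K) < \<delta> \<Longrightarrow> (\<Sum>K\<in>D. norm (f (Sup K) - f (Inf K))) < \<epsilon>"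
      using f unfolding abs_continuous_on_def by blast
    show "\<exists>\<delta>>0. \<forall>D. D division_of \<Union>D \<longrightarrow> \<Union>D \<subseteq> {a..b} \<longrightarrow> (\<Sum>K\<in>D. Sup K - Inf K) < \<delta> \<longrightarrow>
        (\<Sum>K\<in>D. norm (g (Sup K) - g (Inf K))) < \<epsilon>"
      using \<delta> by (intro exI[of _ \<delta>]) (simp add: eq[symmetric])
  qed
qed

lemma abs_continuous_on_component:
  fixes f :: "real \<Rightarrow> complex ^ 'n"
  assumes "abs_continuous_on f a b" shows "abs_continuous_on (\<lambda>t. f t $ i) a b"
proof (rule abs_continuous_on_bound[OF assms abs_continuous_on_const[of "0::real"]])
  fix x y show "norm (f y $ i - f x $ i) \<le> norm (f y - f x) + norm (0 - 0 :: real)"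
    using Finite_Cartesian_Product.norm_nth_le[of "f y - f x" i] by simp
qed

lemma norm_axis_eq: "norm (axis i x :: complex ^ 'n) = norm x"
proof -
  have "(\<Sum>j\<in>UNIV. (norm (axis i x $ j :: complex))\<^sup>2) = (\<Sum>j\<in>UNIV. if j = i then (norm x)\<^sup>2 else 0)"
    by (intro sum.cong) (auto simp: axis_def)
  then show ?thesis by (simp add: norm_vec_def L2_set_def)
qed

lemma axis_minus: "axis i x - axis i y = (axis i (x - y) :: complex ^ 'n)"
  by (simp add: vec_eq_iff axis_def)

lemma abs_continuous_on_vec:
  fixes f :: "real \<Rightarrow> complex ^ 'n"
  assumes "\<And>i. abs_continuous_on (\<lambda>t. f t $ i) a b" shows "abs_continuous_on f a b"
proof -
  have "abs_continuous_on (\<lambda>t. axis i (f t $ i) :: complex ^ 'n) a b" for i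
    by (rule abs_continuous_on_bound[OF assms[of i] abs_continuous_on_const[of "0::real"]])
       (simp add: axis_minus norm_axis_eq)
  then have "abs_continuous_on (\<lambda>t. \<Sum>i\<in>UNIV. axis i (f t $ i) :: complex ^ 'n) a b"
    by (intro abs_continuous_on_sum)
  moreover have "(\<Sum>i\<in>UNIV. axis i (f t $ i)) = f t" for t
    by (simp add: vec_eq_iff axis_def if_distrib cong: if_cong)
  ultimately show ?thesis by simp
qed

lemma component_Lp_on:
  fixes f :: "real \<Rightarrow> complex ^ 'n"
  assumes "f \<in> Lp p M" "0 \<le> p" shows "(\<lambda>x. f x $ i) \<in> Lp p M"
  by (rule Lp_linear_image[OF assms bounded_linear.linear[OF bounded_linear_vec_nth]])

lemma integral_of_component:
  fixes f f' :: "real \<Rightarrow> complex ^ 'n"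
  assumes f': "integrable lebesgue f'"
    and f: "\<And>c d. a \<le> c \<Longrightarrow> c \<le> d \<Longrightarrow> d \<le> b \<Longrightarrow> f d - f c = integral {c..d} f'"
    and cd: "a \<le> c" "c \<le> d" "d \<le> b"
  shows "f d $ i - f c $ i = integral {c..d} (\<lambda>t. f' t $ i)"
proof -
  have "integral {c..d} ((\<lambda>x. x $ i) \<circ> f') = integral {c..d} f' $ i"
    by (rule integral_linear[OF integrable_lebesgue_imp_HK(2)[OF f'] bounded_linear_vec_nth])
  then show ?thesis using arg_cong[OF f[OF cd], of "\<lambda>x. x $ i"] by (simp add: o_def)
qed

lemma tagged_sum_linear:
  assumes "\<And>t. t \<in> {a..b} \<Longrightarrow> F t = G t + c * (\<Sum>i\<in>I. H i t)" "a \<le> b"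
  shows "tagged_sum \<tau> h F a b N = tagged_sum \<tau> h G a b N + c * (\<Sum>i\<in>I. tagged_sum \<tau> h (H i) a b N)"
proof -
  have "h (\<tau> N k) * (F (grid a b N (Suc k)) - F (grid a b N k)) =
      h (\<tau> N k) * (G (grid a b N (Suc k)) - G (grid a b N k)) +
      c * (\<Sum>i\<in>I. h (\<tau> N k) * (H i (grid a b N (Suc k)) - H i (grid a b N k)))" if "k < N" for k
  proof -
    have "grid a b N (Suc k) \<in> {a..b}" "grid a b N k \<in> {a..b}"
      using that assms(2) by (auto simp: grid_ge grid_le)
    then show ?thesis
      by (simp add: assms(1) algebra_simps sum_distrib_left sum_subtractf)
  qed
  then have "tagged_sum \<tau> h F a b N = (\<Sum>k<N. h (\<tau> N k) * (G (grid a b N (Suc k)) - G (grid a b N k)) +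
      c * (\<Sum>i\<in>I. h (\<tau> N k) * (H i (grid a b N (Suc k)) - H i (grid a b N k))))"
    unfolding tagged_sum_def by simp
  also have "\<dots> = tagged_sum \<tau> h G a b N + c * (\<Sum>k<N. \<Sum>i\<in>I. h (\<tau> N k) * (H i (grid a b N (Suc k)) - H i (grid a b N k)))"
    unfolding tagged_sum_def sum.distrib sum_distrib_left ..
  also have "\<dots> = tagged_sum \<tau> h G a b N + c * (\<Sum>i\<in>I. tagged_sum \<tau> h (H i) a b N)"
    unfolding tagged_sum_def by (subst sum.swap) (rule refl)
  finally show ?thesis .
qed

text \<open>Summation by parts is exact when left tags are combined with right tags.\<close>

lemma tagged_sum_by_parts:
  assumes "0 < N"
  shows "tagged_sum (grid a b) f g a b N + tagged_sum (\<lambda>N k. grid a b N (Suc k)) g f a b N = g b * f b - g a * f a"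
proof -
  have "tagged_sum (grid a b) f g a b N + tagged_sum (\<lambda>N k. grid a b N (Suc k)) g f a b N =
      (\<Sum>k<N. g (grid a b N (Suc k)) * f (grid a b N (Suc k)) - g (grid a b N k) * f (grid a b N k))"
    unfolding tagged_sum_def sum.distrib[symmetric] by (intro sum.cong refl) (simp add: algebra_simps)
  also have "\<dots> = g b * f b - g a * f a" using grid_telescope[OF assms, of "\<lambda>x. g x * f x" a b] by simp
  finally show ?thesis .
qed

context delay_form
begin

context
  fixes \<alpha> \<beta> :: real and u v :: "real \<Rightarrow> complex ^ 'n"
  assumes \<alpha>\<beta>: "\<alpha> < \<beta>"
    and u: "u \<in> Lp p (lebesgue_on {\<alpha> - r..\<beta>})" and v: "v \<in> Lp q (lebesgue_on {\<alpha>..\<beta> + r})"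
    and ac_u: "abs_continuous_on u \<alpha> \<beta>" and ac_v: "abs_continuous_on v \<alpha> \<beta>"
begin

definition "V t = v t + L_star r \<eta> (integral_translate \<alpha> t v)"
definition "U t = u t - L_op r \<eta> (integral_translate \<alpha> t u)"

abbreviation "v_ext i \<equiv> zero_ext {\<alpha>..\<beta> + r} (\<lambda>x. v x $ i)"
abbreviation "u_ext j \<equiv> zero_ext {\<alpha> - r..\<beta>} (\<lambda>x. u x $ j)"
abbreviation "v_cut i \<equiv> zero_ext {\<alpha><..\<beta>} (\<lambda>x. v x $ i)"
abbreviation "u_cut j \<equiv> zero_ext {\<alpha><..\<beta>} (\<lambda>x. u x $ j)"

text \<open>The summands of the components of \<open>L\<^sup>* \<integral> v\<^sup>s ds\<close> and \<open>L \<integral> u\<^sub>s ds\<close>, one for each entry of \<open>\<eta>\<close>.\<close>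

definition "V_memory i j t = pairing i j (v_ext i) (Ioc_ind \<alpha> t)"
definition "U_memory i j t = pairing i j (Ioc_ind \<alpha> t) (u_ext j)"

lemma ends_le: "\<alpha> \<le> \<beta>" using \<alpha>\<beta> by simp

lemma v_ext_Lp_bs: "v_ext i \<in> Lp_bs q"
  using Lp_zero_ext(1)[OF Icc_sets_lebesgue component_Lp_on[OF v exponents_pos(4)]]
  by (simp add: Lp_bs_def bounded_support_zero_ext)

lemma u_ext_Lp_bs: "u_ext j \<in> Lp_bs p"
  using Lp_zero_ext(1)[OF Icc_sets_lebesgue component_Lp_on[OF u exponents_pos(3)]]
  by (simp add: Lp_bs_def bounded_support_zero_ext)

lemma components_continuous: "continuous_on {\<alpha>..\<beta>} (\<lambda>x. v x $ i)" "continuous_on {\<alpha>..\<beta>} (\<lambda>x. u x $ i)"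
  using abs_continuous_on_imp_continuous_on[OF abs_continuous_on_component[OF ac_v]]
    abs_continuous_on_imp_continuous_on[OF abs_continuous_on_component[OF ac_u]] by auto

lemma V_memory: "abs_continuous_on (V_memory i j) \<alpha> \<beta>"
  "grid_tags \<alpha> \<beta> \<tau> \<Longrightarrow> tagged_sum \<tau> (\<lambda>x. u x $ k) (V_memory i j) \<alpha> \<beta> \<longlonglongrightarrow> pairing i j (v_ext i) (u_cut k)"
proof -
  interpret Lp_functional p "Lp_seminorm q lebesgue (v_ext i) * (T 0 - T (-r))" "pairing i j (v_ext i)"
    by (rule pairing_left_functional[OF v_ext_Lp_bs])
  have "V_memory i j = primitive \<alpha>" by (simp add: V_memory_def primitive_def fun_eq_iff)
  then show "abs_continuous_on (V_memory i j) \<alpha> \<beta>"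
    "grid_tags \<alpha> \<beta> \<tau> \<Longrightarrow> tagged_sum \<tau> (\<lambda>x. u x $ k) (V_memory i j) \<alpha> \<beta> \<longlonglongrightarrow> pairing i j (v_ext i) (u_cut k)"
    using primitive_abs_continuous[of \<alpha> \<beta>] tagged_sum_tendsto[OF components_continuous(2)[of k] _ ends_le] by simp_all
qed

lemma U_memory: "abs_continuous_on (U_memory i j) \<alpha> \<beta>"
  "grid_tags \<alpha> \<beta> \<tau> \<Longrightarrow> tagged_sum \<tau> (\<lambda>x. v x $ k) (U_memory i j) \<alpha> \<beta> \<longlonglongrightarrow> pairing i j (v_cut k) (u_ext j)"
proof -
  interpret Lp_functional q "Lp_seminorm p lebesgue (u_ext j) * (T 0 - T (-r))" "\<lambda>w. pairing i j w (u_ext j)"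
    by (rule pairing_right_functional[OF u_ext_Lp_bs])
  have "U_memory i j = primitive \<alpha>" by (simp add: U_memory_def primitive_def fun_eq_iff)
  then show "abs_continuous_on (U_memory i j) \<alpha> \<beta>"
    "grid_tags \<alpha> \<beta> \<tau> \<Longrightarrow> tagged_sum \<tau> (\<lambda>x. v x $ k) (U_memory i j) \<alpha> \<beta> \<longlonglongrightarrow> pairing i j (v_cut k) (u_ext j)"
    using primitive_abs_continuous[of \<alpha> \<beta>] tagged_sum_tendsto[OF components_continuous(1)[of k] _ ends_le] by simp_all
qed

lemma V_component:
  assumes t: "t \<in> {\<alpha>..\<beta>}"
  shows "V t $ j = v t $ j + 1 * (\<Sum>i\<in>UNIV. V_memory i j t)"
proof -
  have "rs_integral (-r) 0 (\<lambda>\<theta>. integral_translate \<alpha> t v (- \<theta>) $ i) (\<lambda>\<theta>. \<eta> \<theta> $ i $ j) = V_memory i j t" for i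
    unfolding V_memory_def pairing_def
  proof (rule rs_integral_cong)
    fix \<theta> assume "\<theta> \<in> {-r..0}"
    then show "integral_translate \<alpha> t v (- \<theta>) $ i = corr (v_ext i) (Ioc_ind \<alpha> t) \<theta>"
      using integral_translate_component[OF v, of \<alpha> "- \<theta>" t i] t q
      by (simp add: corr_def mult.commute)
  qed
  then show ?thesis by (simp add: V_def L_star_def rs_integral_row_def)
qed

lemma U_component:
  assumes t: "t \<in> {\<alpha>..\<beta>}"
  shows "U t $ i = u t $ i + (- 1) * (\<Sum>j\<in>UNIV. U_memory i j t)"
proof -
  have "rs_integral (-r) 0 (\<lambda>\<theta>. integral_translate \<alpha> t u \<theta> $ j) (\<lambda>\<theta>. \<eta> \<theta> $ i $ j) = U_memory i j t" for j
    unfolding U_memory_def pairing_def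
  proof (rule rs_integral_cong)
    fix \<theta> assume "\<theta> \<in> {-r..0}"
    moreover have "(LINT s|lebesgue. Ioc_ind \<alpha> t s * u_ext j (s + \<theta>)) = corr (Ioc_ind \<alpha> t) (u_ext j) \<theta>"
      unfolding corr_def
      using lebesgue_integral_real_affine[of 1 "\<lambda>s. Ioc_ind \<alpha> t (s - \<theta>) * u_ext j s" \<theta>] by (simp add: add.commute)
    ultimately show "integral_translate \<alpha> t u \<theta> $ j = corr (Ioc_ind \<alpha> t) (u_ext j) \<theta>"
      using integral_translate_component[OF u, of \<alpha> \<theta> t j] t p by simp
  qed
  then show ?thesis by (simp add: U_def L_op_def rs_integral_col_def)
qed

lemma V_abs_continuous: "abs_continuous_on V \<alpha> \<beta>"
proof (rule abs_continuous_on_vec)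
  fix j
  have "abs_continuous_on (\<lambda>t. v t $ j + (\<Sum>i\<in>UNIV. V_memory i j t)) \<alpha> \<beta>"
    by (intro abs_continuous_on_add abs_continuous_on_sum V_memory abs_continuous_on_component ac_v)
  then show "abs_continuous_on (\<lambda>t. V t $ j) \<alpha> \<beta>"
    by (rule abs_continuous_on_cong[rotated]) (simp add: V_component)
qed

lemma U_abs_continuous: "abs_continuous_on U \<alpha> \<beta>"
proof (rule abs_continuous_on_vec)
  fix i
  have "abs_continuous_on (\<lambda>t. u t $ i - (\<Sum>j\<in>UNIV. U_memory i j t)) \<alpha> \<beta>"
    by (intro abs_continuous_on_diff abs_continuous_on_sum U_memory abs_continuous_on_component ac_u)
  then show "abs_continuous_on (\<lambda>t. U t $ i) \<alpha> \<beta>"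
    by (rule abs_continuous_on_cong[rotated]) (simp add: U_component)
qed

lemma segments_in_M:
  assumes t: "\<alpha> \<le> t" "t \<le> \<beta>"
  shows "translate v t \<in> Mq_star q r" "translate u t \<in> Mp p r"
    "zero_ext {0..r} (\<lambda>x. v (t + x) $ i) \<in> Lp_bs q" "zero_ext {-r..0} (\<lambda>x. u (t + x) $ j) \<in> Lp_bs p"
proof -
  have "translate v t \<in> Lp q (lebesgue_on {0..r})"
    by (rule translate_Lp[OF v exponents_pos(4)]) (use t in auto)
  then show 1: "translate v t \<in> Mq_star q r"
    by (simp only: Lp_leb_dirac_iff[OF Icc_sets_lebesgue zero_in(2)])
  have "translate u t \<in> Lp p (lebesgue_on {-r..0})"
    by (rule translate_Lp[OF u exponents_pos(3)]) (use t in auto)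
  then show 2: "translate u t \<in> Mp p r"
    by (simp only: Lp_leb_dirac_iff[OF Icc_sets_lebesgue zero_in(1)])
  show "zero_ext {0..r} (\<lambda>x. v (t + x) $ i) \<in> Lp_bs q" "zero_ext {-r..0} (\<lambda>x. u (t + x) $ j) \<in> Lp_bs p"
    using component_q(1)[OF 1, of i] component_p(1)[OF 2, of j]
    by (simp_all add: translate_def Lp_bs_def bounded_support_zero_ext)
qed

definition "segment_pairing t i j = pairing i j (zero_ext {0..r} (\<lambda>x. v (t + x) $ i)) (zero_ext {-r..0} (\<lambda>x. u (t + x) $ j))"

lemma B_tilde_segments:
  assumes "\<alpha> \<le> t" "t \<le> \<beta>"
  shows "B_tilde p q r \<eta> (translate v t) (translate u t) =
    (\<Sum>j\<in>UNIV. v t $ j * u t $ j) + (\<Sum>i\<in>UNIV. \<Sum>j\<in>UNIV. segment_pairing t i j)"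
  unfolding B_tilde_eq[OF segments_in_M(1,2)[OF assms]] B_formula_def
  by (simp add: translate_def scalar_product_def segment_pairing_def)

lemma segment_pairing_increment: "segment_pairing \<beta> i j + pairing i j (v_cut i) (u_ext j) = pairing i j (v_ext i) (u_cut j) + segment_pairing \<alpha> i j"
  unfolding segment_pairing_def
proof (rule pairing_identity)
  show "v_cut i \<in> Lp_bs q" "u_cut j \<in> Lp_bs p" by (intro Lp_bs_zero_ext components_continuous exponents_pos)+
qed (use v_ext_Lp_bs u_ext_Lp_bs segments_in_M(3,4) ends_le in \<open>auto intro!: corr_increment simp: Lp_bs_def\<close>)

text \<open>The integral is the limit of the Stieltjes sums \<open>S N\<close>. Since \<open>U\<close> and \<open>V\<close> are \<open>u\<close> and \<open>v\<close> plus memory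
terms, \<open>S N\<close> also splits into a telescoping part and sums against the memory terms, which converge
to pairings.\<close>

lemma delay_Green_formula:
  defines "g \<equiv> \<lambda>t. scalar_product (vector_derivative V (at t within {\<alpha>..\<beta>})) (u t)
                + scalar_product (v t) (vector_derivative U (at t within {\<alpha>..\<beta>}))"
  shows "AE t in lebesgue_on {\<alpha>..\<beta>}. V differentiable (at t within {\<alpha>..\<beta>}) \<and> U differentiable (at t within {\<alpha>..\<beta>})"
    and "set_integrable lebesgue {\<alpha>..\<beta>} g"
    and "(LINT t:{\<alpha>..\<beta>}|lebesgue. g t) = B_tilde p q r \<eta> (translate v \<beta>) (translate u \<beta>)
          - B_tilde p q r \<eta> (translate v \<alpha>) (translate u \<alpha>)"
proof -
  obtain V' where V': "integrable lebesgue V'"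
    "\<And>c d. \<alpha> \<le> c \<Longrightarrow> c \<le> d \<Longrightarrow> d \<le> \<beta> \<Longrightarrow> V d - V c = integral {c..d} V'"
    using abs_continuous_on_integral[OF V_abs_continuous ends_le] by blast
  obtain U' where U': "integrable lebesgue U'"
    "\<And>c d. \<alpha> \<le> c \<Longrightarrow> c \<le> d \<Longrightarrow> d \<le> \<beta> \<Longrightarrow> U d - U c = integral {c..d} U'"
    using abs_continuous_on_integral[OF U_abs_continuous ends_le] by blast
  obtain N1 where N1: "negligible N1" "\<And>x. x \<in> {\<alpha>..\<beta>} - N1 \<Longrightarrow> (V has_vector_derivative V' x) (at x within {\<alpha>..\<beta>})"
    using indefinite_integral_has_vector_derivative_ae[OF V'] by blast
  obtain N2 where N2: "negligible N2" "\<And>x. x \<in> {\<alpha>..\<beta>} - N2 \<Longrightarrow> (U has_vector_derivative U' x) (at x within {\<alpha>..\<beta>})"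
    using indefinite_integral_has_vector_derivative_ae[OF U'] by blast
  define N where "N = N1 \<union> N2"
  have N: "negligible N" using N1 N2 by (simp add: N_def)
  have "AE t in lebesgue. t \<notin> N" using N by (intro AE_not_in) (simp add: negligible_iff_null_sets)
  then have "AE t in lebesgue_on {\<alpha>..\<beta>}. t \<notin> N"
    by (subst AE_restrict_space_iff) (auto elim: eventually_mono)
  then show "AE t in lebesgue_on {\<alpha>..\<beta>}. V differentiable (at t within {\<alpha>..\<beta>}) \<and> U differentiable (at t within {\<alpha>..\<beta>})"
  proof (rule AE_mp, intro AE_I2 impI)
    fix t assume "t \<in> space (lebesgue_on {\<alpha>..\<beta>})" "t \<notin> N"
    then show "V differentiable (at t within {\<alpha>..\<beta>}) \<and> U differentiable (at t within {\<alpha>..\<beta>})"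
      using N1(2)[of t] N2(2)[of t] by (auto simp: N_def intro: differentiableI_vector)
  qed
  define g0 where "g0 t = (\<Sum>j\<in>UNIV. u t $ j * V' t $ j + v t $ j * U' t $ j)" for t
  have gg: "g t = g0 t" if "t \<in> {\<alpha>..\<beta>} - N" for t
  proof -
    have "vector_derivative V (at t within {\<alpha>..\<beta>}) = V' t" "vector_derivative U (at t within {\<alpha>..\<beta>}) = U' t"
      using N1(2)[of t] N2(2)[of t] that \<alpha>\<beta>
      by (auto simp: N_def intro!: vector_derivative_within_cbox[of \<alpha> \<beta> t, simplified])
    then show ?thesis
      by (simp add: g_def g0_def scalar_product_def sum.distrib mult.commute)
  qed
  have V'c: "integrable lebesgue (\<lambda>t. V' t $ j)" and U'c: "integrable lebesgue (\<lambda>t. U' t $ j)" for j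
    using integrable_bounded_linear[OF bounded_linear_vec_nth V'(1)] integrable_bounded_linear[OF bounded_linear_vec_nth U'(1)] by auto
  have iV: "(\<lambda>t. u t $ j * V' t $ j) absolutely_integrable_on {\<alpha>..\<beta>}"
    and iU: "(\<lambda>t. v t $ j * U' t $ j) absolutely_integrable_on {\<alpha>..\<beta>}" for j
    by (intro continuous_times_integrable components_continuous V'c U'c)+
  have g0: "g0 absolutely_integrable_on {\<alpha>..\<beta>}"
    unfolding g0_def[abs_def] by (intro absolutely_integrable_sum set_integral_add(1) iV iU) auto
  show g: "set_integrable lebesgue {\<alpha>..\<beta>} g"
    by (rule absolutely_integrable_spike[OF g0 N gg])
  have "(LINT t:{\<alpha>..\<beta>}|lebesgue. g t) = integral {\<alpha>..\<beta>} g"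
    by (rule set_lebesgue_integral_eq_integral(2)[OF g])
  also have "\<dots> = integral {\<alpha>..\<beta>} g0"
    by (rule integral_spike[OF N]) (use gg in auto)
  also have "\<dots> = (\<Sum>j\<in>UNIV. integral {\<alpha>..\<beta>} (\<lambda>t. u t $ j * V' t $ j) + integral {\<alpha>..\<beta>} (\<lambda>t. v t $ j * U' t $ j))"
    unfolding g0_def[abs_def]
    using set_lebesgue_integral_eq_integral(1)[OF iV] set_lebesgue_integral_eq_integral(1)[OF iU]
    by (subst integral_sum) (auto intro!: integrable_add sum.cong Henstock_Kurzweil_Integration.integral_add)
  finally have LHS: "(LINT t:{\<alpha>..\<beta>}|lebesgue. g t) =
    (\<Sum>j\<in>UNIV. integral {\<alpha>..\<beta>} (\<lambda>t. u t $ j * V' t $ j) + integral {\<alpha>..\<beta>} (\<lambda>t. v t $ j * U' t $ j))" .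
  let ?L = "grid \<alpha> \<beta>" and ?R = "\<lambda>N k. grid \<alpha> \<beta> N (Suc k)"
  define S where "S N = (\<Sum>j\<in>UNIV. tagged_sum ?L (\<lambda>t. u t $ j) (\<lambda>t. V t $ j) \<alpha> \<beta> N +
      tagged_sum ?R (\<lambda>t. v t $ j) (\<lambda>t. U t $ j) \<alpha> \<beta> N)" for N
  have S1: "S \<longlonglongrightarrow> (LINT t:{\<alpha>..\<beta>}|lebesgue. g t)"
    unfolding LHS S_def
  proof (intro tendsto_sum tendsto_add)
    fix j
    show "tagged_sum ?L (\<lambda>t. u t $ j) (\<lambda>t. V t $ j) \<alpha> \<beta> \<longlonglongrightarrow> integral {\<alpha>..\<beta>} (\<lambda>t. u t $ j * V' t $ j)"
      by (rule tagged_sum_tendsto_integral[OF components_continuous(2) grid_tags_left[OF ends_le] ends_le V'c])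
         (rule integral_of_component[OF V'])
    show "tagged_sum ?R (\<lambda>t. v t $ j) (\<lambda>t. U t $ j) \<alpha> \<beta> \<longlonglongrightarrow> integral {\<alpha>..\<beta>} (\<lambda>t. v t $ j * U' t $ j)"
      by (rule tagged_sum_tendsto_integral[OF components_continuous(1) grid_tags_right[OF ends_le] ends_le U'c])
         (rule integral_of_component[OF U'])
  qed
  let ?jump = "\<lambda>j. v \<beta> $ j * u \<beta> $ j - v \<alpha> $ j * u \<alpha> $ j"
  have S_eq: "S N = (\<Sum>j\<in>UNIV. ?jump j + (\<Sum>i\<in>UNIV. tagged_sum ?L (\<lambda>t. u t $ j) (V_memory i j) \<alpha> \<beta> N)
      - (\<Sum>i\<in>UNIV. tagged_sum ?R (\<lambda>t. v t $ j) (U_memory j i) \<alpha> \<beta> N))" if "0 < N" for N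
    unfolding S_def
  proof (intro sum.cong refl)
    fix j
    have "tagged_sum ?L (\<lambda>t. u t $ j) (\<lambda>t. V t $ j) \<alpha> \<beta> N =
        tagged_sum ?L (\<lambda>t. u t $ j) (\<lambda>t. v t $ j) \<alpha> \<beta> N
        + 1 * (\<Sum>i\<in>UNIV. tagged_sum ?L (\<lambda>t. u t $ j) (V_memory i j) \<alpha> \<beta> N)"
      by (rule tagged_sum_linear[OF _ ends_le]) (rule V_component)
    moreover have "tagged_sum ?R (\<lambda>t. v t $ j) (\<lambda>t. U t $ j) \<alpha> \<beta> N =
        tagged_sum ?R (\<lambda>t. v t $ j) (\<lambda>t. u t $ j) \<alpha> \<beta> N
        + (- 1) * (\<Sum>i\<in>UNIV. tagged_sum ?R (\<lambda>t. v t $ j) (U_memory j i) \<alpha> \<beta> N)"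
      by (rule tagged_sum_linear[OF _ ends_le]) (rule U_component)
    ultimately show "tagged_sum ?L (\<lambda>t. u t $ j) (\<lambda>t. V t $ j) \<alpha> \<beta> N + tagged_sum ?R (\<lambda>t. v t $ j) (\<lambda>t. U t $ j) \<alpha> \<beta> N =
        ?jump j + (\<Sum>i\<in>UNIV. tagged_sum ?L (\<lambda>t. u t $ j) (V_memory i j) \<alpha> \<beta> N)
        - (\<Sum>i\<in>UNIV. tagged_sum ?R (\<lambda>t. v t $ j) (U_memory j i) \<alpha> \<beta> N)"
      unfolding tagged_sum_by_parts[OF that, of \<alpha> \<beta> "\<lambda>t. u t $ j" "\<lambda>t. v t $ j", symmetric]
      by simp
  qed
  have "(\<lambda>N. \<Sum>j\<in>UNIV. ?jump j + (\<Sum>i\<in>UNIV. tagged_sum ?L (\<lambda>t. u t $ j) (V_memory i j) \<alpha> \<beta> N)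
      - (\<Sum>i\<in>UNIV. tagged_sum ?R (\<lambda>t. v t $ j) (U_memory j i) \<alpha> \<beta> N)) \<longlonglongrightarrow>
    (\<Sum>j\<in>UNIV. ?jump j + (\<Sum>i\<in>UNIV. pairing i j (v_ext i) (u_cut j)) - (\<Sum>i\<in>UNIV. pairing j i (v_cut j) (u_ext i)))"
    by (intro tendsto_sum tendsto_add tendsto_diff tendsto_const V_memory U_memory grid_tags_left grid_tags_right ends_le)
  then have S2: "S \<longlonglongrightarrow> (\<Sum>j\<in>UNIV. ?jump j + (\<Sum>i\<in>UNIV. pairing i j (v_ext i) (u_cut j)) - (\<Sum>i\<in>UNIV. pairing j i (v_cut j) (u_ext i)))"
    by (rule Lim_transform_eventually) (use S_eq in \<open>auto intro!: eventually_mono[OF eventually_gt_at_top[of 0]]\<close>)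
  have "(LINT t:{\<alpha>..\<beta>}|lebesgue. g t) =
      (\<Sum>j\<in>UNIV. ?jump j + (\<Sum>i\<in>UNIV. pairing i j (v_ext i) (u_cut j)) - (\<Sum>i\<in>UNIV. pairing j i (v_cut j) (u_ext i)))"
    by (rule LIMSEQ_unique[OF S1 S2])
  also have "\<dots> = (\<Sum>j\<in>UNIV. ?jump j) + (\<Sum>i\<in>UNIV. \<Sum>j\<in>UNIV. pairing i j (v_ext i) (u_cut j))
      - (\<Sum>i\<in>UNIV. \<Sum>j\<in>UNIV. pairing i j (v_cut i) (u_ext j))"
    unfolding sum_subtractf sum.distrib
    by (subst sum.swap[of "\<lambda>j i. pairing i j (v_ext i) (u_cut j)"]) simp
  also have "\<dots> = (\<Sum>j\<in>UNIV. ?jump j) + (\<Sum>i\<in>UNIV. \<Sum>j\<in>UNIV. pairing i j (v_ext i) (u_cut j) - pairing i j (v_cut i) (u_ext j))"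
    by (simp add: sum_subtractf)
  also have "(\<Sum>i\<in>UNIV. \<Sum>j\<in>UNIV. pairing i j (v_ext i) (u_cut j) - pairing i j (v_cut i) (u_ext j)) =
      (\<Sum>i\<in>UNIV. \<Sum>j\<in>UNIV. segment_pairing \<beta> i j - segment_pairing \<alpha> i j)"
  proof (intro sum.cong refl)
    fix i j :: 'n
    show "pairing i j (v_ext i) (u_cut j) - pairing i j (v_cut i) (u_ext j) = segment_pairing \<beta> i j - segment_pairing \<alpha> i j"
      using segment_pairing_increment[of i j] by (simp add: algebra_simps)
  qed
  also have "(\<Sum>j\<in>UNIV. ?jump j) + (\<Sum>i\<in>UNIV. \<Sum>j\<in>UNIV. segment_pairing \<beta> i j - segment_pairing \<alpha> i j) =
      B_tilde p q r \<eta> (translate v \<beta>) (translate u \<beta>) - B_tilde p q r \<eta> (translate v \<alpha>) (translate u \<alpha>)"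
    unfolding B_tilde_segments[OF ends_le order_refl] B_tilde_segments[OF order_refl ends_le] by (simp add: sum_subtractf)
  finally show "(LINT t:{\<alpha>..\<beta>}|lebesgue. g t) = B_tilde p q r \<eta> (translate v \<beta>) (translate u \<beta>)
          - B_tilde p q r \<eta> (translate v \<alpha>) (translate u \<alpha>)" .
qed

end

end

theorem corollary5p14:
  fixes r p q \<alpha> \<beta> :: real
    and \<eta> :: "real \<Rightarrow> complex ^ 'n ^ 'n"
    and u v :: "real \<Rightarrow> complex ^ 'n"
  assumes "r > 0"
    and "bounded_variation_on \<eta> (-r) 0"
    and "1 < p" and "1 / p + 1 / q = 1"
    and "\<alpha> \<le> \<beta>"
    and "u \<in> Lp p (lebesgue_on {\<alpha> - r..\<beta>})"
    and "v \<in> Lp q (lebesgue_on {\<alpha>..\<beta> + r})"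
    and "abs_continuous_on u \<alpha> \<beta>"
    and "abs_continuous_on v \<alpha> \<beta>"
  shows
    "let V = (\<lambda>t. v t + L_star r \<eta> (integral_translate \<alpha> t v));
         U = (\<lambda>t. u t - L_op r \<eta> (integral_translate \<alpha> t u));
         g = (\<lambda>t. scalar_product (vector_derivative V (at t within {\<alpha>..\<beta>})) (u t)
                + scalar_product (v t) (vector_derivative U (at t within {\<alpha>..\<beta>})))
     in (AE t in lebesgue_on {\<alpha>..\<beta>}. V differentiable (at t within {\<alpha>..\<beta>}) \<and>
                                     U differentiable (at t within {\<alpha>..\<beta>})) \<and>
        set_integrable lebesgue {\<alpha>..\<beta>} g \<and>
        (LINT t:{\<alpha>..\<beta>}|lebesgue. g t) =
          B_tilde p q r \<eta> (translate v \<beta>) (translate u \<beta>)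
          - B_tilde p q r \<eta> (translate v \<alpha>) (translate u \<alpha>)"
proof (cases "\<alpha> = \<beta>")
  case False
  obtain T where T: "variation_majorant T \<eta> (-r) 0"
    using bounded_variation_on_imp_majorant[OF assms(2)] by blast
  have "1 / q = 1 - 1 / p" "0 < 1 / p" "1 / p < 1" using assms(3,4) by (auto simp: field_simps)
  then have "0 < 1 / q" "1 / q < 1" by linarith+
  then have q: "1 < q" by (simp add: field_simps zero_less_divide_iff split: if_splits)
  interpret delay_form p q r \<eta> T
    using assms q T by unfold_locales auto
  have lt: "\<alpha> < \<beta>" using False assms by simp
  note G = delay_Green_formula[OF lt assms(6,7,8,9)]
  note defs = V_def[OF lt assms(6,7,8,9)] U_def[OF lt assms(6,7,8,9)]
  show ?thesis
    unfolding Let_def using G by (simp only: defs[abs_def]) 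
next
  case True
  \<comment> \<open>The integrand may be anything here, as the interval is a null set.\<close>
  have Z: "negligible {\<alpha>}" by simp
  have "AE t in lebesgue. t \<notin> {\<alpha>}" using Z by (intro AE_not_in) (simp only: negligible_iff_null_sets)
  then have "AE t in lebesgue. t \<in> {\<alpha>..\<beta>} \<longrightarrow> P t" for P
    by (rule eventually_mono) (simp add: True)
  then have "AE t in lebesgue_on {\<alpha>..\<beta>}. P t" for P
    by (simp add: AE_restrict_space_iff)
  moreover have "g absolutely_integrable_on {\<alpha>..\<beta>}" for g :: "real \<Rightarrow> complex"
    by (rule absolutely_integrable_spike[where f="\<lambda>_. 0", OF _ Z]) (use True in auto)
  moreover from this have "(LINT t:{\<alpha>..\<beta>}|lebesgue. g t) = 0" for g :: "real \<Rightarrow> complex"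
    using set_lebesgue_integral_eq_integral(2)[of "{\<alpha>..\<beta>}" g] True by simp
  ultimately show ?thesis unfolding Let_def using True by simp
qed

end
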